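(* Let $\alpha\in(1,2)$ and let $\beta,\gamma\in[0,1]$ be such that $\gamma+\beta\ne0$. Suppose that the pair $(u,a_1)\in L^2(0,T;H_0^1(\Omega)\cap H^2(\Omega))\times D((-\Delta)^\beta)$ is a solution of the backward problem corresponding to the measurement data $u(\cdot,T)$, i.e. $u$ solves the fractional wave equation with initial values $a_0=0$ and $a_1$. If $\|(-\Delta)^\beta a_1\|_{L^2(\Omega)}\le M$ for some positive constant $M$, then $$\|a_1\|_{D((-\Delta)^{-\gamma})}\le C_T\,M^{\frac{1-\gamma}{1+\beta}}\,\|u(\cdot,T)\|_{L^2(\Omega)}^{\frac{\beta+\gamma}{\beta+1}}$$ provided that one of the following conditions holds: (i) $\alpha\in(1,\frac43]$ and $T>0$; (ii) $\alpha\in(\frac43,2)$ and $T>0$ satisfies $T^\alpha\notin\bigcup_{k=1}^\infty\{\frac{t_1}{\lambda_k},\dots,\frac{t_N}{\lambda_k}\}$. Here $C_T>0$ is a constant independent of $a_1$ and $u$, which may depend on $\alpha,\beta,\gamma,T$ and $\Omega$.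
   Context: $\Omega\subset\mathbb R^d$, $d\in\{1,2,3\}$, is a bounded domain with sufficiently smooth boundary. The fractional wave equation is $$\partial_t^\alpha u-\Delta u=0 \text{ in }\Omega\times(0,T),\quad u(x,0)=a_0(x),\ \ \tfrac{\partial}{\partial t}u(x,0)=a_1(x)\text{ in }\Omega,\quad u=0\text{ on }\partial\Omega\times(0,T),$$ where $\partial_t^\alpha\psi(t)=\frac1{\Gamma(2-\alpha)}\int_0^t(t-\tau)^{1-\alpha}\psi''(\tau)\,d\tau$ is the Caputo derivative. The backward problem is to determine $a_1$ from $u(\cdot,T)$ when $a_0=0$. The Mittag-Leffler function is $E_{\alpha,\beta}(z)=\sum_{k=0}^\infty\frac{z^k}{\Gamma(\alpha k+\beta)}$, and $\{t_k\}_{k=1}^N$ is the (finite, possibly empty) set of positive roots of $t\mapsto E_{\alpha,2}(-t)$. $\{\lambda_k,\varphi_k\}_{k\ge1}$ is the Dirichlet eigensystem of $-\Delta$ on $\Omega$, with $0<\lambda_1\le\lambda_2\le\cdots\to\infty$ and $\{\varphi_k\}$ an orthonormal basis of $L^2(\Omega)$. For $a_0=0$ and $a_1\in L^2(\Omega)$ the (unique weak) solution is $u(\cdot,t)=\sum_{n\ge1}tE_{\alpha,2}(-\lambda_nt^\alpha)(a_1,\varphi_n)\varphi_n$, where $(\cdot,\cdot)$ is the $L^2(\Omega)$ inner product. For $\gamma\in\mathbb R$, $(-\Delta)^\gamma\psi=\sum_n\lambda_n^\gamma(\psi,\varphi_n)\varphi_n$, $\|\psi\|_{D((-\Delta)^\gamma)}=\left(\sum_{n\ge1}|\lambda_n^\gamma(\psi,\varphi_n)|^2\right)^{1/2}$,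 and $D((-\Delta)^\gamma)$ is the set of $\psi\in L^2(\Omega)$ for which this is finite. *)

theory Defs
  imports "HOL-Analysis.Analysis"
begin

section \<open>The Mittag-Leffler function and the Caputo derivative\<close>

definition mittag_leffler :: "real \<Rightarrow> real \<Rightarrow> 'a::{real_normed_field,banach} \<Rightarrow> 'a" where
  "mittag_leffler \<alpha> \<beta> z = (\<Sum>k. z ^ k /\<^sub>R Gamma (\<alpha> * real k + \<beta>))"

definition mittag_leffler_roots :: "real \<Rightarrow> real set" where
  "mittag_leffler_roots \<alpha> = {t. t > 0 \<and> mittag_leffler \<alpha> 2 (- t) = 0}"

definition caputo :: "real \<Rightarrow> (real \<Rightarrow> real) \<Rightarrow> real \<Rightarrow> real" where
  "caputo \<alpha> \<psi> t =
     1 / Gamma (2 - \<alpha>) *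
     (LINT \<tau>|lebesgue_on {0<..<t}. (t - \<tau>) powr (1 - \<alpha>) * deriv (deriv \<psi>) \<tau>)"

text \<open>
  Scalar functions on \<open>[0, T]\<close> whose Caputo derivative is meaningful: \<open>\<psi>\<close> is continuously
  differentiable on \<open>[0, T]\<close> and twice differentiable in \<open>(0, T)\<close> with \<open>\<psi>''\<close> in \<open>L\<^sup>1(0, T)\<close>.
  The derivative at \<open>0\<close> and \<open>T\<close> is one-sided.
\<close>

definition caputo_regular :: "real \<Rightarrow> (real \<Rightarrow> real) \<Rightarrow> bool" where
  "caputo_regular T \<psi> \<longleftrightarrow>
     (\<exists>\<psi>'. (\<forall>t\<in>{0..T}. (\<psi> has_real_derivative \<psi>' t) (at t within {0..T})) \<and>
           continuous_on {0..T} \<psi>') \<and>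
     (\<forall>t\<in>{0<..<T}. deriv \<psi> field_differentiable (at t)) \<and>
     integrable (lebesgue_on {0<..<T}) (deriv (deriv \<psi>))"

section \<open>The space of square integrable functions\<close>

text \<open>
  Elements are functions rather than equivalence classes; every notion below that
  is applied to them is invariant under changes on null sets.
\<close>

definition L2_space :: "'a::euclidean_space set \<Rightarrow> ('a \<Rightarrow> real) set" where
  "L2_space \<Omega> =
     {f. f \<in> borel_measurable (lebesgue_on \<Omega>) \<and> integrable (lebesgue_on \<Omega>) (\<lambda>x. (f x)\<^sup>2)}"

definition L2_inner :: "'a::euclidean_space set \<Rightarrow> ('a \<Rightarrow> real) \<Rightarrow> ('a \<Rightarrow> real) \<Rightarrow> real" where
  "L2_inner \<Omega> f g = (LINT x|lebesgue_on \<Omega>. f x * g x)"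

definition L2_norm :: "'a::euclidean_space set \<Rightarrow> ('a \<Rightarrow> real) \<Rightarrow> real" where
  "L2_norm \<Omega> f = sqrt (L2_inner \<Omega> f f)"

text \<open>\<open>g = (\<Sum>n. c n * \<phi> n)\<close> with convergence in \<open>L\<^sup>2(\<Omega>)\<close>.\<close>

definition L2_sums ::
  "'a::euclidean_space set \<Rightarrow> (nat \<Rightarrow> 'a \<Rightarrow> real) \<Rightarrow> (nat \<Rightarrow> real) \<Rightarrow> ('a \<Rightarrow> real) \<Rightarrow> bool" where
  "L2_sums \<Omega> \<phi> c g \<longleftrightarrow>
     g \<in> L2_space \<Omega> \<and>
     (\<lambda>N. L2_norm \<Omega> (\<lambda>x. g x - (\<Sum>n<N. c n * \<phi> n x))) \<longlonglongrightarrow> 0"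

definition L2_orthonormal_basis ::
  "'a::euclidean_space set \<Rightarrow> (nat \<Rightarrow> 'a \<Rightarrow> real) \<Rightarrow> bool" where
  "L2_orthonormal_basis \<Omega> \<phi> \<longleftrightarrow>
     (\<forall>n. \<phi> n \<in> L2_space \<Omega>) \<and>
     (\<forall>m n. L2_inner \<Omega> (\<phi> m) (\<phi> n) = (if m = n then 1 else 0)) \<and>
     (\<forall>f\<in>L2_space \<Omega>. L2_sums \<Omega> \<phi> (\<lambda>n. L2_inner \<Omega> f (\<phi> n)) f)"

section \<open>Smooth functions and smooth domains\<close>

text \<open>Functions of class \<open>C\<^sup>k\<close> on an open set \<open>U\<close>; \<open>g\<close> is the gradient.\<close>

primrec Ck_on :: "nat \<Rightarrow> 'a::euclidean_space set \<Rightarrow> ('a \<Rightarrow> real) \<Rightarrow> bool" where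
  "Ck_on 0 U f \<longleftrightarrow> continuous_on U f"
| "Ck_on (Suc k) U f \<longleftrightarrow>
     (\<exists>g. (\<forall>x\<in>U. (f has_derivative (\<lambda>h. g x \<bullet> h)) (at x)) \<and>
          (\<forall>i\<in>Basis. Ck_on k U (\<lambda>x. g x \<bullet> i)))"

text \<open>
  The boundary is of class \<open>C\<^sup>2\<close>: near each boundary point \<open>\<Omega>\<close> is the sublevel set of a
  \<open>C\<^sup>2\<close> function with non-vanishing gradient.
\<close>

definition C2_boundary :: "'a::euclidean_space set \<Rightarrow> bool" where
  "C2_boundary \<Omega> \<longleftrightarrow>
     (\<forall>p\<in>frontier \<Omega>. \<exists>U \<rho>. open U \<and> p \<in> U \<and> Ck_on 2 U \<rho> \<and>
        (\<forall>x\<in>U. \<exists>h. frechet_derivative \<rho> (at x) h \<noteq> 0) \<and>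
        \<Omega> \<inter> U = {x\<in>U. \<rho> x < 0} \<and> frontier \<Omega> \<inter> U = {x\<in>U. \<rho> x = 0})"

definition smooth_bounded_domain :: "'a::euclidean_space set \<Rightarrow> bool" where
  "smooth_bounded_domain \<Omega> \<longleftrightarrow>
     open \<Omega> \<and> connected \<Omega> \<and> \<Omega> \<noteq> {} \<and> bounded \<Omega> \<and> C2_boundary \<Omega>"

section \<open>Sobolev spaces\<close>

definition test_functions :: "'a::euclidean_space set \<Rightarrow> ('a \<Rightarrow> real) set" where
  "test_functions \<Omega> =
     {v. (\<forall>k. Ck_on k UNIV v) \<and> (\<exists>K. compact K \<and> K \<subseteq> \<Omega> \<and> (\<forall>x. x \<notin> K \<longrightarrow> v x = 0))}"

definition partial :: "'a::euclidean_space \<Rightarrow> ('a \<Rightarrow> real) \<Rightarrow> 'a \<Rightarrow> real" where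
  "partial i v x = frechet_derivative v (at x) i"

text \<open>\<open>g\<close> is the weak partial derivative of \<open>f\<close> in the direction \<open>i\<close>, both in \<open>L\<^sup>2(\<Omega>)\<close>.\<close>

definition weak_partial ::
  "'a::euclidean_space set \<Rightarrow> 'a \<Rightarrow> ('a \<Rightarrow> real) \<Rightarrow> ('a \<Rightarrow> real) \<Rightarrow> bool" where
  "weak_partial \<Omega> i f g \<longleftrightarrow>
     f \<in> L2_space \<Omega> \<and> g \<in> L2_space \<Omega> \<and>
     (\<forall>v\<in>test_functions \<Omega>. L2_inner \<Omega> f (partial i v) = - L2_inner \<Omega> g v)"

text \<open>\<open>H\<^sub>0\<^sup>1(\<Omega>)\<close> is the closure of the test functions in \<open>H\<^sup>1(\<Omega>)\<close>.\<close>

definition H01_space :: "'a::euclidean_space set \<Rightarrow> ('a \<Rightarrow> real) set" where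
  "H01_space \<Omega> =
     {f \<in> L2_space \<Omega>. \<exists>Df. (\<forall>i\<in>Basis. weak_partial \<Omega> i f (Df i)) \<and>
        (\<exists>v. (\<forall>n. v n \<in> test_functions \<Omega>) \<and>
             (\<lambda>n::nat. L2_norm \<Omega> (\<lambda>x. f x - v n x)) \<longlonglongrightarrow> 0 \<and>
             (\<forall>i\<in>Basis. (\<lambda>n. L2_norm \<Omega> (\<lambda>x. Df i x - partial i (v n) x)) \<longlonglongrightarrow> 0))}"

text \<open>\<open>Df\<close> and \<open>D2f\<close> are the families of first and second weak partial derivatives of \<open>f\<close>.\<close>

definition weak_partials2 ::
  "'a::euclidean_space set \<Rightarrow> ('a \<Rightarrow> real) \<Rightarrow> ('a \<Rightarrow> 'a \<Rightarrow> real) \<Rightarrow> ('a \<Rightarrow> 'a \<Rightarrow> 'a \<Rightarrow> real) \<Rightarrow> bool" where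
  "weak_partials2 \<Omega> f Df D2f \<longleftrightarrow>
     (\<forall>i\<in>Basis. weak_partial \<Omega> i f (Df i) \<and>
        (\<forall>j\<in>Basis. weak_partial \<Omega> j (Df i) (D2f i j)))"

definition H2_space :: "'a::euclidean_space set \<Rightarrow> ('a \<Rightarrow> real) set" where
  "H2_space \<Omega> = {f \<in> L2_space \<Omega>. \<exists>Df D2f. weak_partials2 \<Omega> f Df D2f}"

text \<open>\<open>f \<in> H\<^sup>2(\<Omega>)\<close> and \<open>\<Delta>f = g\<close> almost everywhere in \<open>\<Omega>\<close>.\<close>

definition has_laplacian ::
  "'a::euclidean_space set \<Rightarrow> ('a \<Rightarrow> real) \<Rightarrow> ('a \<Rightarrow> real) \<Rightarrow> bool" where
  "has_laplacian \<Omega> f g \<longleftrightarrow>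
     g \<in> L2_space \<Omega> \<and>
     (\<exists>Df D2f. weak_partials2 \<Omega> f Df D2f \<and>
        (AE x in lebesgue_on \<Omega>. g x = (\<Sum>i\<in>Basis. D2f i i x)))"

text \<open>
  \<open>L\<^sup>2(0, T; H\<^sub>0\<^sup>1(\<Omega>) \<inter> H\<^sup>2(\<Omega>))\<close>. Square integrability of \<open>t \<mapsto> \<parallel>u t\<parallel>\<close> in the
  \<open>H\<^sup>2(\<Omega>)\<close> norm is expressed by square integrability over \<open>(0, T) \<times> \<Omega>\<close> of \<open>u\<close> and its spatial
  weak derivatives up to order two.
\<close>

definition L2_time_H01_H2 :: "real \<Rightarrow> 'a::euclidean_space set \<Rightarrow> (real \<Rightarrow> 'a \<Rightarrow> real) set" where
  "L2_time_H01_H2 T \<Omega> =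
     {u. (\<lambda>(t, x). u t x) \<in> L2_space ({0<..<T} \<times> \<Omega>) \<and>
         (\<exists>Du D2u.
            (\<forall>i\<in>Basis. (\<lambda>(t, x). Du t i x) \<in> L2_space ({0<..<T} \<times> \<Omega>)) \<and>
            (\<forall>i\<in>Basis. \<forall>j\<in>Basis. (\<lambda>(t, x). D2u t i j x) \<in> L2_space ({0<..<T} \<times> \<Omega>)) \<and>
            (AE t in lebesgue_on {0<..<T}.
               u t \<in> H01_space \<Omega> \<and> weak_partials2 \<Omega> (u t) (Du t) (D2u t)))}"

section \<open>The Dirichlet Laplacian and its fractional powers\<close>

text \<open>
  Eigenvalues are listed with multiplicity in increasing order, indexed from \<open>0\<close>:
  \<open>lam n\<close> and \<open>\<phi> n\<close> are the \<open>(n + 1)\<close>-st eigenvalue and eigenfunction.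
\<close>

definition dirichlet_eigensystem ::
  "'a::euclidean_space set \<Rightarrow> (nat \<Rightarrow> real) \<Rightarrow> (nat \<Rightarrow> 'a \<Rightarrow> real) \<Rightarrow> bool" where
  "dirichlet_eigensystem \<Omega> lam \<phi> \<longleftrightarrow>
     0 < lam 0 \<and> mono lam \<and> filterlim lam at_top sequentially \<and>
     L2_orthonormal_basis \<Omega> \<phi> \<and>
     (\<forall>n. \<phi> n \<in> H01_space \<Omega> \<inter> H2_space \<Omega> \<and> has_laplacian \<Omega> (\<phi> n) (\<lambda>x. - lam n * \<phi> n x))"

definition frac_domain ::
  "'a::euclidean_space set \<Rightarrow> (nat \<Rightarrow> real) \<Rightarrow> (nat \<Rightarrow> 'a \<Rightarrow> real) \<Rightarrow> real \<Rightarrow> ('a \<Rightarrow> real) set" where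
  "frac_domain \<Omega> lam \<phi> s =
     {f \<in> L2_space \<Omega>. summable (\<lambda>n. \<bar>lam n powr s * L2_inner \<Omega> f (\<phi> n)\<bar>\<^sup>2)}"

definition frac_norm ::
  "'a::euclidean_space set \<Rightarrow> (nat \<Rightarrow> real) \<Rightarrow> (nat \<Rightarrow> 'a \<Rightarrow> real) \<Rightarrow> real \<Rightarrow> ('a \<Rightarrow> real) \<Rightarrow> real" where
  "frac_norm \<Omega> lam \<phi> s f = sqrt (\<Sum>n. \<bar>lam n powr s * L2_inner \<Omega> f (\<phi> n)\<bar>\<^sup>2)"

text \<open>\<open>g = (-\<Delta>)\<^sup>s f\<close>, which determines \<open>g\<close> almost everywhere in \<open>\<Omega>\<close>.\<close>

definition has_frac_laplacian ::
  "'a::euclidean_space set \<Rightarrow> (nat \<Rightarrow> real) \<Rightarrow> (nat \<Rightarrow> 'a \<Rightarrow> real) \<Rightarrow> real \<Rightarrow>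
   ('a \<Rightarrow> real) \<Rightarrow> ('a \<Rightarrow> real) \<Rightarrow> bool" where
  "has_frac_laplacian \<Omega> lam \<phi> s f g \<longleftrightarrow>
     L2_sums \<Omega> \<phi> (\<lambda>n. lam n powr s * L2_inner \<Omega> f (\<phi> n)) g"

section \<open>The fractional wave equation\<close>

text \<open>
  Weak solutions on \<open>\<Omega> \<times> (0, T)\<close>. For merely square integrable initial data \<open>u''\<close> need not be
  Bochner integrable near \<open>t = 0\<close> in \<open>L\<^sup>2(\<Omega>)\<close>, so the Caputo derivative and the second initial
  condition are understood weakly in space, after pairing with an arbitrary \<open>v\<close> in the domain
  \<open>H\<^sub>0\<^sup>1(\<Omega>) \<inter> H\<^sup>2(\<Omega>)\<close> of the Dirichlet Laplacian. Continuity of \<open>u\<close> on \<open>[0, T]\<close> with values in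
  \<open>L\<^sup>2(\<Omega>)\<close> gives a meaning to \<open>u 0\<close> and \<open>u T\<close>; the boundary condition is \<open>u t \<in> H\<^sub>0\<^sup>1(\<Omega>)\<close>.
\<close>

definition fractional_wave_solution ::
  "real \<Rightarrow> real \<Rightarrow> 'a::euclidean_space set \<Rightarrow> ('a \<Rightarrow> real) \<Rightarrow> ('a \<Rightarrow> real) \<Rightarrow>
   (real \<Rightarrow> 'a \<Rightarrow> real) \<Rightarrow> bool" where
  "fractional_wave_solution \<alpha> T \<Omega> a0 a1 u \<longleftrightarrow>
     (\<forall>t\<in>{0..T}. u t \<in> L2_space \<Omega>) \<and>
     (\<forall>t\<in>{0..T}. ((\<lambda>s. L2_norm \<Omega> (\<lambda>x. u s x - u t x)) \<longlongrightarrow> 0) (at t within {0..T})) \<and>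
     (AE t in lebesgue_on {0<..<T}. u t \<in> H01_space \<Omega>) \<and>
     (AE x in lebesgue_on \<Omega>. u 0 x = a0 x) \<and>
     (\<forall>v \<in> H01_space \<Omega> \<inter> H2_space \<Omega>.
        caputo_regular T (\<lambda>t. L2_inner \<Omega> (u t) v) \<and>
        ((\<lambda>t. L2_inner \<Omega> (u t) v) has_real_derivative L2_inner \<Omega> a1 v) (at 0 within {0..T}) \<and>
        (AE t in lebesgue_on {0<..<T}.
           \<exists>g. has_laplacian \<Omega> (u t) g \<and>
               caputo \<alpha> (\<lambda>s. L2_inner \<Omega> (u s) v) t - L2_inner \<Omega> g v = 0))"

end

theory Submission
  imports Defs "HOL-Complex_Analysis.Complex_Analysis" "HOL-Real_Asymp.Real_Asymp"
begin

text \<open>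
  Why the estimate holds. Write \<open>a\<^sub>n = (a1, \<phi>\<^sub>n)\<close> and \<open>U\<^sub>n = (u T, \<phi>\<^sub>n)\<close>. Testing the equation with \<open>\<phi>\<^sub>n\<close>
  and using the symmetry of the Dirichlet Laplacian (\<open>laplacian_symmetric\<close>), the coefficient
  \<open>(u t, \<phi>\<^sub>n)\<close> satisfies a scalar Caputo equation. Fractional integration turns it into a Volterra
  equation, and iterating the latter gives \<open>U\<^sub>n = a\<^sub>n T E\<^sub>\<alpha>\<^sub>,\<^sub>2(- \<lambda>\<^sub>n T\<^sup>\<alpha>)\<close> (\<open>caputo_equation_solution\<close>,
  \<open>solution_coefficient\<close>). If the multiplier \<open>\<bar>T E\<^sub>\<alpha>\<^sub>,\<^sub>2(- \<lambda>\<^sub>n T\<^sup>\<alpha>)\<bar>\<close> is at least \<open>c / \<lambda>\<^sub>n\<close>, then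
  \<open>c \<bar>a\<^sub>n\<bar> / \<lambda>\<^sub>n \<le> \<bar>U\<^sub>n\<bar>\<close>, and the claim is Hoelder's inequality between the weights \<open>\<lambda>\<^sub>n\<^sup>\<beta>\<close> and \<open>\<lambda>\<^sub>n\<^sup>-\<^sup>1\<close>
  (\<open>spectral_interpolation\<close>).

  The lower bound on the multiplier needs two facts about \<open>E\<^sub>\<alpha>\<^sub>,\<^sub>2(- x)\<close> for \<open>x > 0\<close>: it is at least a
  multiple of \<open>1 / x\<close> for large \<open>x\<close> (\<open>mittag_leffler_decay_lower\<close>), and it has no zero when \<open>\<alpha> \<le> 4/3\<close>
  (\<open>mittag_leffler_pos\<close>); for \<open>\<alpha> > 4/3\<close> the zeros are excluded by hypothesis. Both facts follow from the
  representation
  \<open>t E\<^sub>\<alpha>\<^sub>,\<^sub>2(- t\<^sup>\<alpha>) = (2 / pi) sin (\<alpha> pi / 2) \<integral>\<^sub>0\<^sup>\<infinity> sin (x t) q(x) dx\<close> with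
  \<open>q(x) = x\<^sup>\<alpha>\<^sup>-\<^sup>2 / \<bar>1 + (\<i> x)\<^sup>\<alpha>\<bar>\<^sup>2\<close> (\<open>mittag_leffler_sine_transform\<close>). To prove it, both sides are
  shown to have the Laplace transform \<open>s\<^sup>\<alpha>\<^sup>-\<^sup>2 / (1 + s\<^sup>\<alpha>)\<close>: the left one by termwise integration, the right
  one by Cauchy's integral formula in the right half plane. An integration by parts changes the sine
  transform of \<open>q\<close> into the integral of \<open>(1 - cos (x t)) (- q'(x)) / t\<close>. For \<open>\<alpha> \<le> 4/3\<close> the density \<open>q\<close> is
  decreasing, whence positivity. In general \<open>- q'(x)\<close> is at least a multiple of \<open>x\<^sup>\<alpha>\<^sup>-\<^sup>3\<close> near \<open>0\<close> and
  integrable away from \<open>0\<close>, whence the decay rate.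
\<close>

section \<open>Square integrable functions\<close>

lemma L2_measurable: "f \<in> L2_space \<Omega> \<Longrightarrow> f \<in> borel_measurable (lebesgue_on \<Omega>)"
  by (simp add: L2_space_def)

lemma L2_prod_integrable:
  assumes "f \<in> L2_space \<Omega>" "g \<in> L2_space \<Omega>"
  shows "integrable (lebesgue_on \<Omega>) (\<lambda>x. f x * g x)"
proof (rule Bochner_Integration.integrable_bound)
  show "integrable (lebesgue_on \<Omega>) (\<lambda>x. (f x)\<^sup>2 + (g x)\<^sup>2)"
    using assms by (intro Bochner_Integration.integrable_add) (auto simp: L2_space_def)
  show "(\<lambda>x. f x * g x) \<in> borel_measurable (lebesgue_on \<Omega>)"
    using assms by (intro borel_measurable_times L2_measurable)
  have "\<bar>a * b\<bar> \<le> a\<^sup>2 + b\<^sup>2" for a b :: real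
  proof -
    have "2 * (\<bar>a\<bar> * \<bar>b\<bar>) \<le> a\<^sup>2 + b\<^sup>2"
      using sum_squares_bound[of "\<bar>a\<bar>" "\<bar>b\<bar>"] by (simp add: mult.assoc)
    moreover have "0 \<le> \<bar>a\<bar> * \<bar>b\<bar>" by simp
    ultimately have "\<bar>a\<bar> * \<bar>b\<bar> \<le> a\<^sup>2 + b\<^sup>2" by linarith
    then show ?thesis by (simp add: abs_mult)
  qed
  then show "AE x in lebesgue_on \<Omega>. norm (f x * g x) \<le> norm ((f x)\<^sup>2 + (g x)\<^sup>2)"
    by simp
qed

lemma L2_add [intro]:
  assumes "f \<in> L2_space \<Omega>" "g \<in> L2_space \<Omega>"
  shows "(\<lambda>x. f x + g x) \<in> L2_space \<Omega>"
proof -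
  have "integrable (lebesgue_on \<Omega>) (\<lambda>x. (f x)\<^sup>2 + (g x)\<^sup>2 + 2 * (f x * g x))"
    using assms L2_prod_integrable[OF assms]
    by (intro Bochner_Integration.integrable_add integrable_mult_right) (auto simp: L2_space_def)
  then show ?thesis
    using assms by (auto simp: L2_space_def power2_sum algebra_simps)
qed

lemma L2_scale [intro]: "f \<in> L2_space \<Omega> \<Longrightarrow> (\<lambda>x. c * f x) \<in> L2_space \<Omega>"
  by (auto simp: L2_space_def power_mult_distrib)

lemma L2_diff [intro]:
  "f \<in> L2_space \<Omega> \<Longrightarrow> g \<in> L2_space \<Omega> \<Longrightarrow> (\<lambda>x. f x - g x) \<in> L2_space \<Omega>"
  using L2_add[of f \<Omega> "\<lambda>x. -1 * g x"] L2_scale[of g \<Omega> "-1"] by simp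

lemma L2_sum [intro]:
  "(\<And>i. i \<in> I \<Longrightarrow> f i \<in> L2_space \<Omega>) \<Longrightarrow> (\<lambda>x. \<Sum>i\<in>I. f i x) \<in> L2_space \<Omega>"
proof (induction I rule: infinite_finite_induct)
  case (insert i I)
  then show ?case using L2_add[of "f i" \<Omega> "\<lambda>x. \<Sum>i\<in>I. f i x"] by simp
qed (auto simp: L2_space_def)

lemma L2_inner_commute: "L2_inner \<Omega> f g = L2_inner \<Omega> g f"
  by (simp add: L2_inner_def mult.commute)

lemma L2_inner_scale_left: "L2_inner \<Omega> (\<lambda>x. c * f x) g = c * L2_inner \<Omega> f g"
  by (simp add: L2_inner_def mult.assoc)

lemma L2_inner_scale_right: "L2_inner \<Omega> f (\<lambda>x. c * g x) = c * L2_inner \<Omega> f g"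
  by (simp add: L2_inner_commute[of \<Omega> f] L2_inner_scale_left)

lemma L2_inner_diff_left:
  assumes "f \<in> L2_space \<Omega>" "g \<in> L2_space \<Omega>" "h \<in> L2_space \<Omega>"
  shows "L2_inner \<Omega> (\<lambda>x. f x - g x) h = L2_inner \<Omega> f h - L2_inner \<Omega> g h"
  unfolding L2_inner_def left_diff_distrib
  by (intro Bochner_Integration.integral_diff L2_prod_integrable assms)

lemma L2_inner_sum_left:
  assumes "\<And>i. i \<in> I \<Longrightarrow> f i \<in> L2_space \<Omega>" "h \<in> L2_space \<Omega>"
  shows "L2_inner \<Omega> (\<lambda>x. \<Sum>i\<in>I. f i x) h = (\<Sum>i\<in>I. L2_inner \<Omega> (f i) h)"
  unfolding L2_inner_def sum_distrib_right
  by (intro Bochner_Integration.integral_sum L2_prod_integrable assms)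

lemma L2_inner_AE_cong:
  assumes "AE x in lebesgue_on \<Omega>. f x = f' x" "f' \<in> L2_space \<Omega>" "f \<in> L2_space \<Omega>" "g \<in> L2_space \<Omega>"
  shows "L2_inner \<Omega> f g = L2_inner \<Omega> f' g"
  unfolding L2_inner_def
  using assms by (intro integral_cong_AE borel_measurable_times L2_measurable) auto

lemma L2_inner_nonneg: "0 \<le> L2_inner \<Omega> f f"
  by (simp add: L2_inner_def)

lemma L2_norm_nonneg [simp]: "0 \<le> L2_norm \<Omega> f"
  by (simp add: L2_norm_def L2_inner_nonneg)

lemma L2_norm_power2: "(L2_norm \<Omega> f)\<^sup>2 = L2_inner \<Omega> f f"
  by (simp add: L2_norm_def L2_inner_nonneg)

lemma L2_inner_expand:
  assumes "f \<in> L2_space \<Omega>" "g \<in> L2_space \<Omega>"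
  shows "L2_inner \<Omega> (\<lambda>x. f x - t * g x) (\<lambda>x. f x - t * g x)
    = L2_inner \<Omega> f f - 2 * t * L2_inner \<Omega> f g + t\<^sup>2 * L2_inner \<Omega> g g"
proof -
  have g: "(\<lambda>x. t * g x) \<in> L2_space \<Omega>" and d: "(\<lambda>x. f x - t * g x) \<in> L2_space \<Omega>"
    using assms by auto
  have "L2_inner \<Omega> (\<lambda>x. f x - t * g x) h = L2_inner \<Omega> f h - t * L2_inner \<Omega> g h"
    if "h \<in> L2_space \<Omega>" for h
    using L2_inner_diff_left[OF assms(1) g that] by (simp only: L2_inner_scale_left)
  note * = this[OF d] this[OF assms(1)] this[OF assms(2)]
  have "L2_inner \<Omega> (\<lambda>x. f x - t * g x) (\<lambda>x. f x - t * g x)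
    = L2_inner \<Omega> (\<lambda>x. f x - t * g x) f - t * L2_inner \<Omega> (\<lambda>x. f x - t * g x) g"
    by (rule trans[OF *(1)]) (intro arg_cong2[where f = "(-)"] arg_cong2[where f = "(*)"] refl L2_inner_commute)
  also have "\<dots> = L2_inner \<Omega> f f - t * L2_inner \<Omega> g f - t * (L2_inner \<Omega> f g - t * L2_inner \<Omega> g g)"
    by (simp only: *(2,3))
  finally show ?thesis
    by (simp add: L2_inner_commute[of \<Omega> g f] algebra_simps power2_eq_square)
qed

lemma L2_Cauchy_Schwarz:
  assumes f: "f \<in> L2_space \<Omega>" and g: "g \<in> L2_space \<Omega>"
  shows "\<bar>L2_inner \<Omega> f g\<bar> \<le> L2_norm \<Omega> f * L2_norm \<Omega> g"
proof -
  define A B C where "A = L2_inner \<Omega> f f" and "B = L2_inner \<Omega> f g" and "C = L2_inner \<Omega> g g"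
  have pos: "0 \<le> A - 2 * t * B + t\<^sup>2 * C" for t
    unfolding A_def B_def C_def
    using L2_inner_nonneg L2_inner_expand[OF f g, of t] by metis
  have "B\<^sup>2 \<le> A * C"
  proof (cases "C = 0")
    case True
    have "B = 0"
    proof (rule ccontr)
      assume "B \<noteq> 0"
      with pos[of "(A + 1) / (2 * B)"] True show False by simp
    qed
    then show ?thesis using True by simp
  next
    case False
    then have "C > 0" using L2_inner_nonneg[of \<Omega> g] by (simp add: C_def)
    with pos[of "B / C"] show ?thesis by (simp add: field_simps power2_eq_square)
  qed
  then have "B\<^sup>2 \<le> (L2_norm \<Omega> f * L2_norm \<Omega> g)\<^sup>2"
    by (simp add: power_mult_distrib L2_norm_power2 A_def C_def)
  then show ?thesis
    unfolding B_def by (simp flip: abs_le_square_iff)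
qed

lemma L2_inner_tendsto:
  assumes f: "f \<in> L2_space \<Omega>" and g: "g \<in> L2_space \<Omega>" and v: "\<And>n. v n \<in> L2_space \<Omega>"
    and lim: "(\<lambda>n::nat. L2_norm \<Omega> (\<lambda>x. f x - v n x)) \<longlonglongrightarrow> 0"
  shows "(\<lambda>n. L2_inner \<Omega> (v n) g) \<longlonglongrightarrow> L2_inner \<Omega> f g"
proof (rule LIM_zero_cancel, rule tendsto_0_le[where K = "L2_norm \<Omega> g", OF lim], rule always_eventually, rule)
  fix n
  have "L2_inner \<Omega> (v n) g - L2_inner \<Omega> f g = - L2_inner \<Omega> (\<lambda>x. f x - v n x) g"
    by (simp add: L2_inner_diff_left f g v)
  then show "norm (L2_inner \<Omega> (v n) g - L2_inner \<Omega> f g)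
      \<le> norm (L2_norm \<Omega> (\<lambda>x. f x - v n x)) * L2_norm \<Omega> g"
    using L2_Cauchy_Schwarz[OF L2_diff[OF f v] g, of n] by simp
qed

section \<open>Symmetry of the Dirichlet Laplacian\<close>

lemma test_function_L2:
  assumes "open \<Omega>" "bounded \<Omega>" "v \<in> test_functions \<Omega>"
  shows "v \<in> L2_space \<Omega>"
proof -
  from assms(3) obtain K where K: "compact K" "\<And>x. x \<notin> K \<Longrightarrow> v x = 0" and "Ck_on 0 UNIV v"
    unfolding test_functions_def by blast
  then have cont: "continuous_on UNIV v" by simp
  have "bounded (v ` K)"
    using compact_continuous_image[OF continuous_on_subset[OF cont] K(1)] compact_imp_bounded by blast
  then obtain B where B: "\<And>x. x \<in> K \<Longrightarrow> \<bar>v x\<bar> \<le> B" and "B > 0"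
    by (force simp: bounded_pos)
  have B: "(v x)\<^sup>2 \<le> B\<^sup>2" for x
    using B[of x] K(2)[of x] \<open>B > 0\<close> by (cases "x \<in> K") (auto intro: abs_le_square_iff[THEN iffD1])
  have meas: "v \<in> borel_measurable (lebesgue_on \<Omega>)"
    using continuous_imp_measurable_on_sets_lebesgue[OF continuous_on_subset[OF cont]] assms(1)
    by (simp add: borel_open)
  have fin: "finite_measure (lebesgue_on \<Omega>)"
    using bounded_set_imp_lmeasurable[OF assms(2)] assms(1)
    by (intro finite_measureI) (simp add: emeasure_restrict_space fmeasurable_def borel_open)
  have "integrable (lebesgue_on \<Omega>) (\<lambda>x. (v x)\<^sup>2)"
    using B meas by (intro finite_measure.integrable_const_bound[OF fin, of _ "B\<^sup>2"]) auto
  with meas show ?thesis by (simp add: L2_space_def)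
qed

lemma partial_test_function:
  assumes v: "v \<in> test_functions \<Omega>" and i: "i \<in> Basis"
  shows "partial i v \<in> test_functions \<Omega>"
proof -
  from v obtain K where K: "compact K" "K \<subseteq> \<Omega>" "\<And>x. x \<notin> K \<Longrightarrow> v x = 0"
    and Ck: "\<And>k. Ck_on k UNIV v"
    unfolding test_functions_def by blast
  have "Ck_on k UNIV (partial i v)" for k
  proof -
    from Ck[of "Suc k"] obtain g where g: "\<And>x. (v has_derivative (\<lambda>h. g x \<bullet> h)) (at x)"
      and Ckg: "Ck_on k UNIV (\<lambda>x. g x \<bullet> i)" using i by auto
    have "partial i v = (\<lambda>x. g x \<bullet> i)"
      by (simp add: partial_def fun_eq_iff flip: frechet_derivative_at[OF g])
    with Ckg show ?thesis by simp
  qed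
  moreover have "partial i v x = 0" if "x \<notin> K" for x
  proof -
    have "(v has_derivative (\<lambda>_. 0)) (at x)"
      by (rule has_derivative_transform_within_open[where s = "- K" and f = "\<lambda>_. 0"])
        (use K that in \<open>auto simp: compact_imp_closed open_Compl\<close>)
    from frechet_derivative_at[OF this] show ?thesis by (simp add: partial_def fun_eq_iff)
  qed
  ultimately show ?thesis using K unfolding test_functions_def by blast
qed

text \<open>
  The two weak gradients, the one attached to membership in \<open>H\<^sub>0\<^sup>1\<close> and the one attached to
  membership in \<open>H\<^sup>2\<close>, need not be identified: their difference is orthogonal to every test
  function, in particular to the partial derivatives of test functions, and hence to every limit of
  such derivatives.
\<close>

lemma H01_H2_Green:
  assumes \<Omega>: "open \<Omega>" "bounded \<Omega>" and f: "f \<in> H01_space \<Omega>" and g: "g \<in> H01_space \<Omega>"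
    and Df: "weak_partials2 \<Omega> f Df D2f" and Dg: "weak_partials2 \<Omega> g Dg D2g" and i: "i \<in> Basis"
  shows "L2_inner \<Omega> (D2f i i) g = L2_inner \<Omega> f (D2g i i)"
proof -
  note T = test_function_L2[OF \<Omega>]
  \<comment> \<open>\<open>Eg\<close> is the weak derivative of \<open>g\<close> approximated by derivatives of test functions; against it, any
    two weak derivatives of the same function have the same inner product\<close>
  have key: "\<exists>Eg. weak_partial \<Omega> i g Eg \<and> (\<forall>h Dh D2h. weak_partial \<Omega> i h Dh \<longrightarrow> weak_partial \<Omega> i Dh D2h \<longrightarrow>
      L2_inner \<Omega> D2h g = - L2_inner \<Omega> Dh Eg \<and>
      (\<forall>Eh. weak_partial \<Omega> i h Eh \<longrightarrow> L2_inner \<Omega> Dh Eg = L2_inner \<Omega> Eh Eg))"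
    if "g \<in> H01_space \<Omega>" for g
  proof -
    from that i obtain Eg v where Eg: "weak_partial \<Omega> i g Eg" and v: "\<And>n::nat. v n \<in> test_functions \<Omega>"
      and lim0: "(\<lambda>n. L2_norm \<Omega> (\<lambda>x. g x - v n x)) \<longlonglongrightarrow> 0"
      and lim1: "(\<lambda>n. L2_norm \<Omega> (\<lambda>x. Eg x - partial i (v n) x)) \<longlonglongrightarrow> 0"
      unfolding H01_space_def by blast
    have gL: "g \<in> L2_space \<Omega>" "Eg \<in> L2_space \<Omega>" using Eg by (auto simp: weak_partial_def)
    note pv = partial_test_function[OF v i]
    have "L2_inner \<Omega> D2h g = - L2_inner \<Omega> Dh Eg \<and>
      (\<forall>Eh. weak_partial \<Omega> i h Eh \<longrightarrow> L2_inner \<Omega> Dh Eg = L2_inner \<Omega> Eh Eg)"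
      if Dh: "weak_partial \<Omega> i h Dh" and D2h: "weak_partial \<Omega> i Dh D2h" for h Dh D2h
    proof (intro conjI allI impI)
      have L: "Dh \<in> L2_space \<Omega>" "D2h \<in> L2_space \<Omega>" using D2h by (auto simp: weak_partial_def)
      have a: "(\<lambda>n. L2_inner \<Omega> (v n) D2h) \<longlonglongrightarrow> L2_inner \<Omega> g D2h"
        by (intro L2_inner_tendsto gL L T v lim0)
      have b: "(\<lambda>n. L2_inner \<Omega> (partial i (v n)) Dh) \<longlonglongrightarrow> L2_inner \<Omega> Eg Dh"
        by (intro L2_inner_tendsto gL L T pv lim1)
      have "L2_inner \<Omega> (v n) D2h = - L2_inner \<Omega> (partial i (v n)) Dh" for n
        using D2h v[of n] by (simp add: weak_partial_def L2_inner_commute)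
      with a tendsto_minus[OF b] have "L2_inner \<Omega> g D2h = - L2_inner \<Omega> Eg Dh"
        by (simp add: LIMSEQ_unique)
      then show "L2_inner \<Omega> D2h g = - L2_inner \<Omega> Dh Eg" by (simp add: L2_inner_commute)
      fix Eh assume Eh: "weak_partial \<Omega> i h Eh"
      have c: "(\<lambda>n. L2_inner \<Omega> (partial i (v n)) Eh) \<longlonglongrightarrow> L2_inner \<Omega> Eg Eh"
        by (rule L2_inner_tendsto[OF gL(2) _ T[OF pv] lim1]) (use Eh in \<open>simp add: weak_partial_def\<close>)
      have "L2_inner \<Omega> Dh (partial i (v n)) = L2_inner \<Omega> Eh (partial i (v n))" for n
      proof -
        have "L2_inner \<Omega> h (partial i (partial i (v n))) = - L2_inner \<Omega> E (partial i (v n))"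
          if "weak_partial \<Omega> i h E" for E
          using that pv[of n] by (simp add: weak_partial_def)
        from this[OF Dh] this[OF Eh] show ?thesis by simp
      qed
      then have "(\<lambda>n. L2_inner \<Omega> (partial i (v n)) Dh) \<longlonglongrightarrow> L2_inner \<Omega> Eg Eh"
        using c by (simp add: L2_inner_commute)
      with b have "L2_inner \<Omega> Eg Dh = L2_inner \<Omega> Eg Eh" by (rule LIMSEQ_unique)
      then show "L2_inner \<Omega> Dh Eg = L2_inner \<Omega> Eh Eg" by (simp add: L2_inner_commute)
    qed
    with Eg show ?thesis by blast
  qed
  have Df': "weak_partial \<Omega> i f (Df i)" "weak_partial \<Omega> i (Df i) (D2f i i)"
    and Dg': "weak_partial \<Omega> i g (Dg i)" "weak_partial \<Omega> i (Dg i) (D2g i i)"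
    using Df Dg i by (auto simp: weak_partials2_def)
  obtain Ef where Ef: "weak_partial \<Omega> i f Ef"
    "L2_inner \<Omega> (D2g i i) f = - L2_inner \<Omega> (Dg i) Ef"
    "\<And>Eg. weak_partial \<Omega> i g Eg \<Longrightarrow> L2_inner \<Omega> (Dg i) Ef = L2_inner \<Omega> Eg Ef"
    using key[OF f] Dg' by blast
  obtain Eg where Eg: "weak_partial \<Omega> i g Eg"
    "L2_inner \<Omega> (D2f i i) g = - L2_inner \<Omega> (Df i) Eg"
    "\<And>Ef. weak_partial \<Omega> i f Ef \<Longrightarrow> L2_inner \<Omega> (Df i) Eg = L2_inner \<Omega> Ef Eg"
    using key[OF g] Df' by blast
  show ?thesis
    using Ef(2) Eg(2) Ef(3)[OF Eg(1)] Eg(3)[OF Ef(1)] by (simp add: L2_inner_commute)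
qed

lemma laplacian_symmetric:
  assumes \<Omega>: "open \<Omega>" "bounded \<Omega>" and f: "f \<in> H01_space \<Omega>" and g: "g \<in> H01_space \<Omega>"
    and lf: "has_laplacian \<Omega> f lf" and lg: "has_laplacian \<Omega> g lg"
  shows "L2_inner \<Omega> lf g = L2_inner \<Omega> f lg"
proof -
  from lf obtain Df D2f where Df: "weak_partials2 \<Omega> f Df D2f"
    and lf: "lf \<in> L2_space \<Omega>" "AE x in lebesgue_on \<Omega>. lf x = (\<Sum>i\<in>Basis. D2f i i x)"
    unfolding has_laplacian_def by blast
  from lg obtain Dg D2g where Dg: "weak_partials2 \<Omega> g Dg D2g"
    and lg: "lg \<in> L2_space \<Omega>" "AE x in lebesgue_on \<Omega>. lg x = (\<Sum>i\<in>Basis. D2g i i x)"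
    unfolding has_laplacian_def by blast
  have L: "f \<in> L2_space \<Omega>" "g \<in> L2_space \<Omega>" using f g by (auto simp: H01_space_def)
  have L2: "D2f i i \<in> L2_space \<Omega>" "D2g i i \<in> L2_space \<Omega>" if "i \<in> Basis" for i
    using Df Dg that by (auto simp: weak_partials2_def weak_partial_def)
  have "L2_inner \<Omega> lf g = (\<Sum>i\<in>Basis. L2_inner \<Omega> (D2f i i) g)"
    using L2_inner_AE_cong[OF lf(2) _ lf(1) L(2)] L2 by (simp add: L2_sum L2_inner_sum_left L)
  also have "\<dots> = (\<Sum>i\<in>Basis. L2_inner \<Omega> (D2g i i) f)"
    using H01_H2_Green[OF \<Omega> f g Df Dg] by (simp add: L2_inner_commute)
  also have "\<dots> = L2_inner \<Omega> lg f"
    using L2_inner_AE_cong[OF lg(2) _ lg(1) L(1)] L2 by (simp add: L2_sum L2_inner_sum_left L)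
  finally show ?thesis by (simp add: L2_inner_commute)
qed

section \<open>Fourier coefficients and interpolation\<close>

lemma Bessel_inequality:
  assumes \<phi>: "L2_orthonormal_basis \<Omega> \<phi>" and f: "f \<in> L2_space \<Omega>"
  shows "(\<Sum>n<N. (L2_inner \<Omega> f (\<phi> n))\<^sup>2) \<le> (L2_norm \<Omega> f)\<^sup>2"
proof -
  define c where "c n = L2_inner \<Omega> f (\<phi> n)" for n
  define S where "S x = (\<Sum>n<N. c n * \<phi> n x)" for x
  have \<phi>L: "\<phi> n \<in> L2_space \<Omega>" for n using \<phi> by (simp add: L2_orthonormal_basis_def)
  have orth: "L2_inner \<Omega> (\<phi> m) (\<phi> n) = (if m = n then 1 else 0)" for m n
    using \<phi> by (simp add: L2_orthonormal_basis_def)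
  have S_def': "S = (\<lambda>x. \<Sum>n<N. c n * \<phi> n x)" by (simp add: S_def fun_eq_iff)
  have S: "S \<in> L2_space \<Omega>" unfolding S_def' using \<phi>L by (intro L2_sum L2_scale)
  have S_inner: "L2_inner \<Omega> S g = (\<Sum>n<N. c n * L2_inner \<Omega> (\<phi> n) g)" if "g \<in> L2_space \<Omega>" for g
    unfolding S_def' using \<phi>L that
    by (subst L2_inner_sum_left) (auto simp: L2_inner_scale_left)
  have 1: "L2_inner \<Omega> S f = (\<Sum>n<N. (c n)\<^sup>2)"
    unfolding S_inner[OF f] by (simp add: c_def L2_inner_commute power2_eq_square)
  have "L2_inner \<Omega> (\<phi> n) S = (if n < N then c n else 0)" for n
    using S_inner[OF \<phi>L[of n]] by (simp add: L2_inner_commute[of _ S] orth if_distrib cong: if_cong)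
  then have 2: "L2_inner \<Omega> S S = (\<Sum>n<N. (c n)\<^sup>2)"
    unfolding S_inner[OF S] by (simp add: power2_eq_square)
  have "0 \<le> L2_inner \<Omega> (\<lambda>x. f x - 1 * S x) (\<lambda>x. f x - 1 * S x)"
    by (rule L2_inner_nonneg)
  also have "\<dots> = L2_inner \<Omega> f f - (\<Sum>n<N. (c n)\<^sup>2)"
    unfolding L2_inner_expand[OF f S] using 1 2 by (simp add: L2_inner_commute)
  finally show ?thesis by (simp add: L2_norm_power2 c_def)
qed

lemma L2_sums_coefficient:
  assumes \<phi>: "L2_orthonormal_basis \<Omega> \<phi>" and g: "L2_sums \<Omega> \<phi> c g"
  shows "L2_inner \<Omega> g (\<phi> m) = c m"
proof -
  have \<phi>L: "\<phi> n \<in> L2_space \<Omega>" for n using \<phi> by (simp add: L2_orthonormal_basis_def)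
  have orth: "L2_inner \<Omega> (\<phi> m) (\<phi> n) = (if m = n then 1 else 0)" for m n
    using \<phi> by (simp add: L2_orthonormal_basis_def)
  have lim: "(\<lambda>N. L2_inner \<Omega> (\<lambda>x. \<Sum>n<N. c n * \<phi> n x) (\<phi> m)) \<longlonglongrightarrow> L2_inner \<Omega> g (\<phi> m)"
    using g by (intro L2_inner_tendsto \<phi>L L2_sum L2_scale) (auto simp: L2_sums_def)
  have "L2_inner \<Omega> (\<lambda>x. \<Sum>n<N. c n * \<phi> n x) (\<phi> m) = (if m < N then c m else 0)" for N
    using \<phi>L by (subst L2_inner_sum_left) (auto simp: L2_inner_scale_left orth if_distrib cong: if_cong)
  then have "\<forall>\<^sub>F N in sequentially. L2_inner \<Omega> (\<lambda>x. \<Sum>n<N. c n * \<phi> n x) (\<phi> m) = c m"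
    by (auto simp: eventually_sequentially intro!: exI[of _ "Suc m"])
  from Lim_transform_eventually[OF lim this] show ?thesis
    by (simp add: LIMSEQ_const_iff)
qed

text \<open>
  The interpolation step: with \<open>\<theta> = (1 - \<gamma>) / (1 + \<beta>)\<close> one has
  \<open>l\<^sup>-\<^sup>2\<^sup>\<gamma> = (l\<^sup>2\<^sup>\<beta>)\<^sup>\<theta> (l\<^sup>-\<^sup>2)\<^sup>1\<^sup>-\<^sup>\<theta>\<close>, so the claim is Hoelder's inequality, here in the form of
  Young's inequality applied to each summand after normalisation.
\<close>

lemma spectral_interpolation:
  fixes l a U :: "nat \<Rightarrow> real"
  assumes l: "\<And>n. l n > 0" and c: "c > 0" and U: "\<And>n. c * \<bar>a n\<bar> \<le> l n * \<bar>U n\<bar>"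
    and M: "M > 0" "\<And>N. (\<Sum>n<N. (l n powr \<beta> * a n)\<^sup>2) \<le> M\<^sup>2"
    and B: "B \<ge> 0" "\<And>N. (\<Sum>n<N. (U n)\<^sup>2) \<le> B\<^sup>2"
    and \<beta>\<gamma>: "0 \<le> \<beta>" "0 \<le> \<gamma>" "\<gamma> \<le> 1" "0 < \<beta> + \<gamma>"
  shows "sqrt (\<Sum>n. \<bar>l n powr (- \<gamma>) * a n\<bar>\<^sup>2)
    \<le> (1 / c) powr ((\<beta> + \<gamma>) / (\<beta> + 1)) * M powr ((1 - \<gamma>) / (1 + \<beta>)) * B powr ((\<beta> + \<gamma>) / (\<beta> + 1))"
proof (cases "B = 0")
  case True
  have "a n = 0" for n
  proof -
    have "(U n)\<^sup>2 \<le> (\<Sum>k<Suc n. (U k)\<^sup>2)" by (intro member_le_sum) auto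
    also note B(2)[of "Suc n"]
    finally have "(U n)\<^sup>2 \<le> 0" using True by simp
    then have "U n = 0" by simp
    with U[of n] c show ?thesis by (simp add: mult_le_0_iff)
  qed
  with True show ?thesis by simp
next
  case False
  with B have Bp: "B > 0" by simp
  define \<theta> where "\<theta> = (1 - \<gamma>) / (1 + \<beta>)"
  have \<theta>: "0 \<le> \<theta>" "0 < 1 - \<theta>" "1 - \<theta> = (\<beta> + \<gamma>) / (\<beta> + 1)" "\<theta> * (1 + \<beta>) = 1 - \<gamma>"
    using \<beta>\<gamma> by (auto simp: \<theta>_def field_simps)
  define P Q where "P = M\<^sup>2" and "Q = (B / c)\<^sup>2"
  have PQ: "P > 0" "Q > 0" using M Bp c by (auto simp: P_def Q_def)
  define X Y where "X n = (l n powr \<beta> * a n)\<^sup>2" and "Y n = (a n / l n)\<^sup>2" for n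
  define K where "K = P powr \<theta> * Q powr (1 - \<theta>)"
  have summand_le: "(l n powr (- \<gamma>) * a n)\<^sup>2 \<le> K * (\<theta> * (X n / P) + (1 - \<theta>) * (Y n / Q))" for n
  proof (cases "a n = 0")
    case True
    then show ?thesis by (simp add: X_def Y_def)
  next
    case False
    have pos: "X n > 0" "Y n > 0" using False l[of n] by (auto simp: X_def Y_def)
    have ln_eq: "ln ((l n powr (- \<gamma>) * a n)\<^sup>2) = \<theta> * ln (X n) + (1 - \<theta>) * ln (Y n)"
    proof -
      have *: "ln (x\<^sup>2) = 2 * ln \<bar>x\<bar>" if "x \<noteq> 0" for x :: real
        using ln_realpow[of "\<bar>x\<bar>" 2] that by simp
      have L: "ln (X n) = 2 * \<beta> * ln (l n) + 2 * ln \<bar>a n\<bar>"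
        "ln (Y n) = - 2 * ln (l n) + 2 * ln \<bar>a n\<bar>"
        "ln ((l n powr (- \<gamma>) * a n)\<^sup>2) = - 2 * \<gamma> * ln (l n) + 2 * ln \<bar>a n\<bar>"
        unfolding X_def Y_def using False l[of n]
        by (simp_all add: * abs_mult ln_mult ln_div algebra_simps)
      have \<gamma>: "\<gamma> = 1 - \<theta> * (1 + \<beta>)" using \<theta>(4) by simp
      show ?thesis unfolding L by (subst \<gamma>) (simp add: algebra_simps)
    qed
    have "(l n powr (- \<gamma>) * a n)\<^sup>2 = X n powr \<theta> * Y n powr (1 - \<theta>)"
    proof -
      have "0 < (l n powr (- \<gamma>) * a n)\<^sup>2" using False l[of n] by simp
      then have "(l n powr (- \<gamma>) * a n)\<^sup>2 = exp (ln ((l n powr (- \<gamma>) * a n)\<^sup>2))" by simp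
      also have "\<dots> = X n powr \<theta> * Y n powr (1 - \<theta>)"
        unfolding ln_eq using pos by (simp add: powr_def exp_add)
      finally show ?thesis .
    qed
    also have "\<dots> = K * ((X n / P) powr \<theta> * (Y n / Q) powr (1 - \<theta>))"
      using pos PQ by (simp add: K_def powr_divide)
    also have "\<dots> \<le> K * (\<theta> * (X n / P) + (1 - \<theta>) * (Y n / Q))"
      using Youngs_inequality_0[of \<theta> "1 - \<theta>" "X n / P" "Y n / Q"] pos PQ \<theta>
      by (intro mult_left_mono) (auto simp: K_def)
    finally show ?thesis .
  qed
  have "(\<Sum>n<N. (l n powr (- \<gamma>) * a n)\<^sup>2) \<le> K" for N
  proof -
    have X: "(\<Sum>n<N. X n) \<le> P" using M(2) by (simp add: X_def P_def)
    have "Y n \<le> (U n / c)\<^sup>2" for n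
    proof -
      have "\<bar>a n / l n\<bar> \<le> \<bar>U n / c\<bar>" using U[of n] l[of n] c by (simp add: field_simps)
      then show ?thesis unfolding Y_def by (simp only: abs_le_square_iff)
    qed
    then have "(\<Sum>n<N. Y n) \<le> (\<Sum>n<N. (U n / c)\<^sup>2)" by (intro sum_mono)
    also have "\<dots> \<le> Q"
      using B(2)[of N] c by (simp add: Q_def power_divide divide_right_mono flip: sum_divide_distrib)
    finally have Y: "(\<Sum>n<N. Y n) \<le> Q" .
    have "(\<Sum>n<N. (l n powr (- \<gamma>) * a n)\<^sup>2) \<le> (\<Sum>n<N. K * (\<theta> * (X n / P) + (1 - \<theta>) * (Y n / Q)))"
      by (intro sum_mono summand_le)
    also have "\<dots> = K * (\<theta> * ((\<Sum>n<N. X n) / P) + (1 - \<theta>) * ((\<Sum>n<N. Y n) / Q))"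
      by (simp add: sum.distrib sum_distrib_left sum_divide_distrib distrib_left)
    also have "\<dots> \<le> K * (\<theta> * 1 + (1 - \<theta>) * 1)"
      using X Y PQ \<theta> by (intro mult_left_mono add_mono) (auto simp: K_def)
    finally show ?thesis by simp
  qed
  then have "summable (\<lambda>n. \<bar>l n powr (- \<gamma>) * a n\<bar>\<^sup>2)" "(\<Sum>n. \<bar>l n powr (- \<gamma>) * a n\<bar>\<^sup>2) \<le> K"
    by (auto intro!: summableI_nonneg_bounded[where x = K] suminf_le_const)
  then have "sqrt (\<Sum>n. \<bar>l n powr (- \<gamma>) * a n\<bar>\<^sup>2) \<le> sqrt K" by simp
  also have "\<dots> = M powr \<theta> * (B / c) powr (1 - \<theta>)"
    using M Bp c by (simp add: K_def P_def Q_def real_sqrt_mult powr_half_sqrt[symmetric] powr_powr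
        diff_divide_distrib flip: powr_numeral)
  also have "\<dots> = (1 / c) powr (1 - \<theta>) * M powr \<theta> * B powr (1 - \<theta>)"
    using Bp c by (simp add: powr_divide)
  finally show ?thesis unfolding \<theta>(3) by (simp add: \<theta>_def)
qed

section \<open>The Mittag-Leffler series\<close>

lemma fact_le_Gamma:
  assumes "1 \<le> \<alpha>" "1 \<le> \<beta>" "k \<ge> 1"
  shows "fact k \<le> Gamma (\<alpha> * real k + \<beta>)"
proof -
  have "1 * real k \<le> \<alpha> * real k" using assms by (intro mult_right_mono) auto
  then have le: "1 + real k \<le> \<alpha> * real k + \<beta>" using assms by linarith
  have "Gamma (1 + real k) \<le> Gamma (\<alpha> * real k + \<beta>)"
    using Gamma_real_strict_mono[of "1 + real k" "\<alpha> * real k + \<beta>"] le assms(3)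
    by (cases "1 + real k = \<alpha> * real k + \<beta>") auto
  then show ?thesis using Gamma_fact[of k, where 'a = real] by simp
qed

lemma mittag_leffler_summable:
  fixes x :: real
  assumes "1 \<le> \<alpha>" "1 \<le> \<beta>"
  shows "summable (\<lambda>k. x ^ k / Gamma (\<alpha> * real k + \<beta>))"
proof (rule summable_comparison_test_ev)
  show "\<forall>\<^sub>F k in sequentially. norm (x ^ k / Gamma (\<alpha> * real k + \<beta>)) \<le> \<bar>x\<bar> ^ k / fact k"
    using eventually_ge_at_top[of 1]
  proof eventually_elim
    case (elim k)
    have "\<bar>x\<bar> ^ k / \<bar>Gamma (\<alpha> * real k + \<beta>)\<bar> \<le> \<bar>x\<bar> ^ k / fact k"
      using fact_le_Gamma[OF assms elim] less_le_trans[OF fact_gt_zero fact_le_Gamma[OF assms elim]]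
      by (intro divide_left_mono) auto
    then show ?case by (simp add: power_abs)
  qed
  show "summable (\<lambda>k. \<bar>x\<bar> ^ k / fact k)"
    using summable_exp[of "\<bar>x\<bar>"] by (simp add: divide_inverse mult.commute)
qed

lemma mittag_leffler_sums:
  fixes x :: real
  assumes "1 \<le> \<alpha>" "1 \<le> \<beta>"
  shows "(\<lambda>k. x ^ k / Gamma (\<alpha> * real k + \<beta>)) sums mittag_leffler \<alpha> \<beta> x"
  using summable_sums[OF mittag_leffler_summable[OF assms, of x]]
  by (simp add: mittag_leffler_def divide_inverse mult.commute)

section \<open>Fractional integrals\<close>

text \<open>Open and closed intervals give the same integrand here, since \<open>0 powr x = 0\<close>.\<close>

lemma Beta_integral_shifted:
  fixes a b r t :: real
  assumes a: "a > 0" and b: "b > 0" and rt: "r < t"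
  shows "has_bochner_integral lborel
    (\<lambda>s. indicator {r<..<t} s * ((t - s) powr (b - 1) * (s - r) powr (a - 1)))
    ((t - r) powr (a + b - 1) * Beta a b)"
proof -
  define f :: "real \<Rightarrow> real" where
    "f x = indicator {0..1} x * (x powr (a - 1) * (1 - x) powr (b - 1))" for x
  have "set_lebesgue_integral lborel {0..1} (\<lambda>x. x powr (a - 1) * (1 - x) powr (b - 1)) = Beta a b"
    using integrable_Beta[OF a b] has_integral_Beta_real[OF a b]
    by (simp add: set_borel_integral_eq_integral integral_unique)
  then have "has_bochner_integral lborel f (Beta a b)"
    using integrable_Beta[OF a b]
    by (simp add: has_bochner_integral_iff f_def[abs_def] set_integrable_def set_lebesgue_integral_def)
  then have "has_bochner_integral lborel (\<lambda>s. f (- r / (t - r) + 1 / (t - r) * s)) (Beta a b /\<^sub>R \<bar>1 / (t - r)\<bar>)"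
    using rt by (subst (asm) lborel_has_bochner_integral_real_affine_iff[of "1 / (t - r)" _ _ "- r / (t - r)"]) auto
  then have "has_bochner_integral lborel
     (\<lambda>s. (t - r) powr (a + b - 2) * f (- r / (t - r) + 1 / (t - r) * s))
     ((t - r) powr (a + b - 2) * (Beta a b /\<^sub>R \<bar>1 / (t - r)\<bar>))"
    by (rule has_bochner_integral_mult_right)
  moreover have "(t - r) powr (a + b - 2) * (Beta a b /\<^sub>R \<bar>1 / (t - r)\<bar>) = (t - r) powr (a + b - 1) * Beta a b"
  proof -
    have "(t - r) powr (a + b - 1) = (t - r) * (t - r) powr (a + b - 2)"
      using rt powr_mult_base[of "t - r" "a + b - 2"] by (simp add: add.commute)
    then show ?thesis using rt by simp
  qed
  moreover have "(t - r) powr (a + b - 2) * f (- r / (t - r) + 1 / (t - r) * s)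
    = indicator {r<..<t} s * ((t - s) powr (b - 1) * (s - r) powr (a - 1))" for s
  proof -
    have eq: "- r / (t - r) + 1 / (t - r) * s = (s - r) / (t - r)"
      "1 - (s - r) / (t - r) = (t - s) / (t - r)"
      using rt by (simp add: diff_divide_distrib, simp add: divide_simps)
    show ?thesis
    proof (cases "s \<in> {r<..<t}")
      case True
      then have "(s - r) / (t - r) \<in> {0..1}" using rt by simp
      then have f: "f ((s - r) / (t - r)) = (s - r) powr (a - 1) / (t - r) powr (a - 1) * ((t - s) powr (b - 1) / (t - r) powr (b - 1))"
        using rt True unfolding f_def eq(2) by (simp add: powr_divide)
      have p: "(t - r) powr (a + b - 2) = (t - r) powr (a - 1) * (t - r) powr (b - 1)"
        by (simp flip: powr_add)
      have nz: "(t - r) powr (a - 1) \<noteq> 0" "(t - r) powr (b - 1) \<noteq> 0" using rt by auto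
      show ?thesis unfolding eq(1) f p using True nz by simp
    next
      case False
      then consider "s \<le> r" | "s \<ge> t" by fastforce
      then have "f ((s - r) / (t - r)) = 0"
      proof cases
        case 1
        then show ?thesis using rt by (cases "s = r") (auto simp: f_def indicator_def field_simps)
      next
        case 2
        then show ?thesis using rt by (cases "s = t") (auto simp: f_def indicator_def field_simps)
      qed
      then show ?thesis unfolding eq(1) using False by simp
    qed
  qed
  ultimately show ?thesis by (simp only:)
qed

lemma fractional_integral_power:
  fixes \<alpha> p t :: real
  assumes "\<alpha> > 0" "p > -1" "t > 0"
  shows "has_bochner_integral lborel
    (\<lambda>s. indicator {0<..<t} s * ((t - s) powr (\<alpha> - 1) * s powr p))
    (t powr (p + \<alpha>) * (Gamma \<alpha> * Gamma (p + 1) / Gamma (p + 1 + \<alpha>)))"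
  using Beta_integral_shifted[of "p + 1" \<alpha> 0 t] assms by (simp add: Beta_def mult.commute add.commute)

lemma continuous_kernel_integrable:
  fixes \<psi> :: "real \<Rightarrow> real"
  assumes "1 < \<alpha>" "continuous_on {0..T} \<psi>" "t \<le> T"
  shows "integrable lborel (\<lambda>s. indicator {0<..<t} s * ((t - s) powr (\<alpha> - 1) * \<psi> s))"
proof -
  have "continuous_on {0..t} (\<lambda>s. (t - s) powr (\<alpha> - 1) * \<psi> s)"
    using assms
    by (intro continuous_on_mult continuous_on_powr' continuous_intros continuous_on_subset[OF assms(2)]) auto
  then have "set_integrable lborel {0..t} (\<lambda>s. (t - s) powr (\<alpha> - 1) * \<psi> s)"
    by (rule borel_integrable_atLeastAtMost')
  then have "set_integrable lborel {0<..<t} (\<lambda>s. (t - s) powr (\<alpha> - 1) * \<psi> s)"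
    by (rule set_integrable_subset) auto
  then show ?thesis by (simp add: set_integrable_def)
qed

text \<open>
  Iterating the Volterra equation \<open>n\<close> times produces the first \<open>n\<close> terms of the Mittag-Leffler
  series, with a remainder bounded by the general term of another Mittag-Leffler series.
\<close>

lemma Volterra_equation_solution:
  fixes \<psi> :: "real \<Rightarrow> real"
  assumes \<alpha>: "1 < \<alpha>" and l: "l > 0" and cont: "continuous_on {0..T} \<psi>"
    and eq: "\<And>t. t \<in> {0<..T} \<Longrightarrow> \<psi> t = a * t -
        l / Gamma \<alpha> * (\<integral>s. indicator {0<..<t} s * ((t - s) powr (\<alpha> - 1) * \<psi> s) \<partial>lborel)"
    and t: "t \<in> {0<..T}"
  shows "\<psi> t = a * t * mittag_leffler \<alpha> 2 (- l * t powr \<alpha>)"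
proof -
  have "bounded (\<psi> ` {0..T})"
    using compact_continuous_image[OF cont] compact_imp_bounded by blast
  then obtain M where M: "\<And>s. s \<in> {0..T} \<Longrightarrow> \<bar>\<psi> s\<bar> \<le> M" and "M > 0"
    by (force simp: bounded_pos)
  define S where "S n t = (\<Sum>k<n. (- l) ^ k * t powr (\<alpha> * real k + 1) / Gamma (\<alpha> * real k + 2))" for n t
  define Rb where "Rb n t = M * (l ^ n * t powr (\<alpha> * real n) / Gamma (\<alpha> * real n + 1))" for n t
  define K where "K t f = (\<integral>s. indicator {0<..<t} s * ((t - s) powr (\<alpha> - 1) * f s) \<partial>lborel)"
    for t and f :: "real \<Rightarrow> real"
  have \<Gamma>: "Gamma \<alpha> > 0" "Gamma (\<alpha> * real k + 2) > 0" "Gamma (\<alpha> * real k + 1) > 0" for k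
    using \<alpha> by (auto intro!: Gamma_real_pos add_nonneg_pos)
  have pw: "has_bochner_integral lborel (\<lambda>s. indicator {0<..<t} s * ((t - s) powr (\<alpha> - 1) * s powr p))
      (t powr (p + \<alpha>) * (Gamma \<alpha> * Gamma (p + 1) / Gamma (p + 1 + \<alpha>)))" if "p \<ge> 0" "t \<in> {0<..T}" for p t
    using that \<alpha> by (intro fractional_integral_power) auto
  have bound: "\<bar>\<psi> t - a * S n t\<bar> \<le> Rb n t" if "t \<in> {0<..T}" for n t
    using that
  proof (induction n arbitrary: t)
    case 0
    then show ?case using M[of t] \<open>M > 0\<close> by (simp add: S_def Rb_def)
  next
    case (Suc n)
    note t = Suc.prems
    have hS: "has_bochner_integral lborel (\<lambda>s. indicator {0<..<t} s * ((t - s) powr (\<alpha> - 1) * S n s))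
       (\<Sum>k<n. (- l) ^ k / Gamma (\<alpha> * real k + 2) *
         (t powr (\<alpha> * real k + 1 + \<alpha>) * (Gamma \<alpha> * Gamma (\<alpha> * real k + 1 + 1) / Gamma (\<alpha> * real k + 1 + 1 + \<alpha>))))"
    proof -
      have *: "indicator {0<..<t} s * ((t - s) powr (\<alpha> - 1) * S n s) = (\<Sum>k<n. (- l) ^ k / Gamma (\<alpha> * real k + 2) *
         (indicator {0<..<t} s * ((t - s) powr (\<alpha> - 1) * s powr (\<alpha> * real k + 1))))" for s
        by (simp add: S_def sum_distrib_left mult_ac)
      show ?thesis unfolding * using \<alpha> t
        by (intro has_bochner_integral_sum has_bochner_integral_mult_right pw) auto
    qed
    have KS: "l / Gamma \<alpha> * K t (S n) = t - S (Suc n) t"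
    proof -
      have "l / Gamma \<alpha> * K t (S n) = (\<Sum>k<n. - ((- l) ^ Suc k * t powr (\<alpha> * real (Suc k) + 1) / Gamma (\<alpha> * real (Suc k) + 2)))"
        unfolding K_def has_bochner_integral_integral_eq[OF hS] sum_distrib_left
      proof (intro sum.cong refl)
        fix k
        have e: "\<alpha> * real (Suc k) + 1 = \<alpha> * real k + 1 + \<alpha>" "\<alpha> * real (Suc k) + 2 = \<alpha> * real k + 1 + 1 + \<alpha>"
          "\<alpha> * real k + 1 + 1 = \<alpha> * real k + 2"
          by (auto simp: algebra_simps)
        show "l / Gamma \<alpha> * ((- l) ^ k / Gamma (\<alpha> * real k + 2) * (t powr (\<alpha> * real k + 1 + \<alpha>) *
           (Gamma \<alpha> * Gamma (\<alpha> * real k + 1 + 1) / Gamma (\<alpha> * real k + 1 + 1 + \<alpha>)))) =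
           - ((- l) ^ Suc k * t powr (\<alpha> * real (Suc k) + 1) / Gamma (\<alpha> * real (Suc k) + 2))"
          unfolding e(1,2) using \<Gamma>(1) \<Gamma>(2)[of k] by (simp add: e(3))
      qed
      also have "\<dots> = t - S (Suc n) t"
        using t Gamma_fact[of 1, where 'a = real] by (simp add: S_def sum.lessThan_Suc_shift sum_negf del: sum.lessThan_Suc)
      finally show ?thesis .
    qed
    have i\<psi>: "integrable lborel (\<lambda>s. indicator {0<..<t} s * ((t - s) powr (\<alpha> - 1) * \<psi> s))"
      using t by (intro continuous_kernel_integrable[OF \<alpha> cont]) auto
    have iS: "integrable lborel (\<lambda>s. indicator {0<..<t} s * ((t - s) powr (\<alpha> - 1) * (a * S n s)))"
      using integrable_mult_right[OF integrable.intros[OF hS], of a] by (simp add: mult_ac)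
    have KaS: "K t (\<lambda>s. a * S n s) = a * K t (S n)"
      unfolding K_def by (subst integral_mult_right_zero[symmetric]) (simp add: mult_ac)
    have diff: "K t (\<lambda>s. \<psi> s - a * S n s) = K t \<psi> - a * K t (S n)"
      unfolding KaS[symmetric] unfolding K_def
      by (subst Bochner_Integration.integral_diff[OF i\<psi> iS, symmetric]) (simp add: algebra_simps)
    have iR: "integrable lborel (\<lambda>s. indicator {0<..<t} s * ((t - s) powr (\<alpha> - 1) * (\<psi> s - a * S n s)))"
      using Bochner_Integration.integrable_diff[OF i\<psi> iS] by (simp add: algebra_simps)
    have hB: "has_bochner_integral lborel (\<lambda>s. indicator {0<..<t} s * ((t - s) powr (\<alpha> - 1) * Rb n s))
      (M * l ^ n / Gamma (\<alpha> * real n + 1) * (t powr (\<alpha> * real n + \<alpha>) * (Gamma \<alpha> * Gamma (\<alpha> * real n + 1) / Gamma (\<alpha> * real n + 1 + \<alpha>))))"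
      using has_bochner_integral_mult_right[OF pw[of "\<alpha> * real n" t], of "M * l ^ n / Gamma (\<alpha> * real n + 1)"] \<alpha> t
      by (simp add: Rb_def mult_ac)
    have "\<bar>K t (\<lambda>s. \<psi> s - a * S n s)\<bar> \<le> K t (Rb n)"
      unfolding K_def
    proof (rule integral_abs_bound[THEN order.trans], rule integral_mono)
      show "integrable lborel (\<lambda>s. \<bar>indicator {0<..<t} s * ((t - s) powr (\<alpha> - 1) * (\<psi> s - a * S n s))\<bar>)"
        using iR by simp
      show "integrable lborel (\<lambda>s. indicator {0<..<t} s * ((t - s) powr (\<alpha> - 1) * Rb n s))"
        using hB by (simp add: has_bochner_integral_iff)
      fix s
      show "\<bar>indicator {0<..<t} s * ((t - s) powr (\<alpha> - 1) * (\<psi> s - a * S n s))\<bar>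
        \<le> indicator {0<..<t} s * ((t - s) powr (\<alpha> - 1) * Rb n s)"
        using Suc.IH[of s] t by (auto simp: indicator_def abs_mult intro!: mult_left_mono)
    qed
    then have "l / Gamma \<alpha> * \<bar>K t (\<lambda>s. \<psi> s - a * S n s)\<bar> \<le> l / Gamma \<alpha> * K t (Rb n)"
      using l \<Gamma>(1) by (intro mult_left_mono) auto
    also have "\<dots> = Rb (Suc n) t"
      unfolding K_def has_bochner_integral_integral_eq[OF hB] using \<Gamma>(1) \<Gamma>(3)[of n]
      by (simp add: Rb_def distrib_left add_ac)
    finally have le: "l / Gamma \<alpha> * \<bar>K t (\<lambda>s. \<psi> s - a * S n s)\<bar> \<le> Rb (Suc n) t" .
    have "\<psi> t - a * S (Suc n) t = a * (t - S (Suc n) t) - l / Gamma \<alpha> * K t \<psi>"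
      using eq[OF t] by (simp add: K_def algebra_simps)
    also have "\<dots> = - (l / Gamma \<alpha> * K t (\<lambda>s. \<psi> s - a * S n s))"
      unfolding diff KS[symmetric] by (simp add: algebra_simps)
    finally show ?case using le l \<Gamma>(1) by (simp add: abs_mult)
  qed
  have pwr: "t powr (\<alpha> * real k) = (t powr \<alpha>) ^ k" for k
    using t by (simp add: powr_powr[symmetric] powr_realpow)
  have "Rb n t = M * ((l * t powr \<alpha>) ^ n / Gamma (\<alpha> * real n + 1))" for n
    by (simp add: Rb_def pwr power_mult_distrib)
  then have R0: "(\<lambda>n. Rb n t) \<longlonglongrightarrow> 0"
    using tendsto_mult_right_zero[OF summable_LIMSEQ_zero[OF mittag_leffler_summable[of \<alpha> 1 "l * t powr \<alpha>"]]] \<alpha>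
    by simp
  have S: "S n t = t * (\<Sum>k<n. (- l * t powr \<alpha>) ^ k / Gamma (\<alpha> * real k + 2))" for n
    using t by (simp add: S_def sum_distrib_left powr_add pwr power_mult_distrib mult_ac flip: power_mult_distrib)
  have "(\<lambda>n. S n t) \<longlonglongrightarrow> t * mittag_leffler \<alpha> 2 (- l * t powr \<alpha>)"
    unfolding S using mittag_leffler_sums[of \<alpha> 2 "- l * t powr \<alpha>"] \<alpha>
    by (intro tendsto_mult_left) (simp add: sums_def)
  then have "(\<lambda>n. \<psi> t - a * S n t) \<longlonglongrightarrow> \<psi> t - a * (t * mittag_leffler \<alpha> 2 (- l * t powr \<alpha>))"
    by (intro tendsto_intros)
  moreover have "(\<lambda>n. \<psi> t - a * S n t) \<longlonglongrightarrow> 0"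
    using bound[OF t] by (intro Lim_null_comparison[OF _ R0]) auto
  ultimately have "\<psi> t - a * (t * mittag_leffler \<alpha> 2 (- l * t powr \<alpha>)) = 0"
    by (rule LIMSEQ_unique)
  then show ?thesis by simp
qed

text \<open>The composition of the fractional integrals of orders \<open>\<alpha>\<close> and \<open>2 - \<alpha>\<close> is the double integral.\<close>

lemma fractional_integral_semigroup:
  fixes f :: "real \<Rightarrow> real"
  assumes \<alpha>: "1 < \<alpha>" "\<alpha> < 2" and f: "integrable lborel f"
  shows "(\<integral>s. indicator {0<..<t} s * ((t - s) powr (\<alpha> - 1) *
      (\<integral>r. indicator {0<..<s} r * ((s - r) powr (1 - \<alpha>) * f r) \<partial>lborel)) \<partial>lborel)
    = Gamma \<alpha> * Gamma (2 - \<alpha>) * (\<integral>r. indicator {0<..<t} r * ((t - r) * f r) \<partial>lborel)"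
proof -
  define F where "F r s = indicator {0<..<t} r * f r *
    (indicator {r<..<t} s * ((t - s) powr (\<alpha> - 1) * (s - r) powr (1 - \<alpha>)))" for r s :: real
  have [measurable]: "f \<in> borel_measurable borel" using f by auto
  have inner: "has_bochner_integral lborel (\<lambda>s. indicator {r<..<t} s * ((t - s) powr (\<alpha> - 1) * (s - r) powr (1 - \<alpha>)))
     ((t - r) * (Gamma \<alpha> * Gamma (2 - \<alpha>)))" if "r < t" for r
    using Beta_integral_shifted[of "2 - \<alpha>" \<alpha> r t] \<alpha> that Gamma_fact[of 1, where 'a = real]
    by (simp add: Beta_def mult.commute)
  have hF: "has_bochner_integral lborel (F r) (Gamma \<alpha> * Gamma (2 - \<alpha>) * (indicator {0<..<t} r * ((t - r) * f r)))" for r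
  proof (cases "r \<in> {0<..<t}")
    case True
    then have "r < t" by simp
    from has_bochner_integral_mult_right[OF inner[OF this], of "indicator {0<..<t} r * f r"]
    show ?thesis unfolding F_def by (simp add: mult_ac)
  next
    case False
    then have "F r = (\<lambda>_. 0)" by (auto simp: F_def)
    with False show ?thesis by (simp add: has_bochner_integral_zero)
  qed
  have hF': "has_bochner_integral lborel (\<lambda>s. norm (F r s)) (norm (Gamma \<alpha> * Gamma (2 - \<alpha>) * (indicator {0<..<t} r * ((t - r) * f r))))" for r
  proof (cases "r \<in> {0<..<t}")
    case True
    then have "r < t" by simp
    have "Gamma \<alpha> > 0" "Gamma (2 - \<alpha>) > 0" using \<alpha> by auto
    then show ?thesis
      using has_bochner_integral_mult_right[OF inner[OF \<open>r < t\<close>], of "\<bar>f r\<bar>"] True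
      unfolding F_def by (simp add: abs_mult mult_ac)
  next
    case False
    then have "F r = (\<lambda>_. 0)" by (auto simp: F_def)
    with False show ?thesis by (simp add: has_bochner_integral_zero)
  qed
  have int: "integrable (lborel \<Otimes>\<^sub>M lborel) (case_prod F)"
  proof (rule lborel_pair.Fubini_integrable)
    have eq: "case_prod F = (\<lambda>p. indicator {0<..<t} (fst p) * f (fst p) *
      (indicator {p. fst p < snd p \<and> snd p < t} p * ((t - snd p) powr (\<alpha> - 1) * (snd p - fst p) powr (1 - \<alpha>))))"
      by (auto simp: F_def fun_eq_iff indicator_def)
    show "case_prod F \<in> borel_measurable (lborel \<Otimes>\<^sub>M lborel)"
      unfolding eq by measurable
    have "integrable lborel (\<lambda>r. norm (Gamma \<alpha> * Gamma (2 - \<alpha>) * (indicator {0<..<t} r * ((t - r) * f r))))"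
    proof (intro integrable_norm integrable_mult_right, rule Bochner_Integration.integrable_bound)
      show "integrable lborel (\<lambda>r. t * f r)" using f by simp
      show "AE r in lborel. norm (indicator {0<..<t} r * ((t - r) * f r)) \<le> norm (t * f r)"
        by (rule AE_I2) (auto simp: indicator_def abs_mult intro!: mult_right_mono)
    qed auto
    then show "integrable lborel (\<lambda>r. \<integral>s. norm (case_prod F (r, s)) \<partial>lborel)"
      by (simp only: prod.case has_bochner_integral_integral_eq[OF hF'])
    show "AE r in lborel. integrable lborel (\<lambda>s. case_prod F (r, s))"
      using hF by (auto simp: has_bochner_integral_iff)
  qed
  have "(\<integral>s. indicator {0<..<t} s * ((t - s) powr (\<alpha> - 1) *
      (\<integral>r. indicator {0<..<s} r * ((s - r) powr (1 - \<alpha>) * f r) \<partial>lborel)) \<partial>lborel)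
    = (\<integral>s. (\<integral>r. F r s \<partial>lborel) \<partial>lborel)"
  proof (intro Bochner_Integration.integral_cong refl)
    fix s
    have "F r s = indicator {0<..<t} s * (t - s) powr (\<alpha> - 1) * (indicator {0<..<s} r * ((s - r) powr (1 - \<alpha>) * f r))" for r
      by (auto simp: F_def indicator_def)
    then show "indicator {0<..<t} s * ((t - s) powr (\<alpha> - 1) *
        (\<integral>r. indicator {0<..<s} r * ((s - r) powr (1 - \<alpha>) * f r) \<partial>lborel)) = (\<integral>r. F r s \<partial>lborel)"
      by (simp only: integral_mult_right_zero mult.assoc)
  qed
  also have "\<dots> = (\<integral>r. (\<integral>s. F r s \<partial>lborel) \<partial>lborel)"
    using int by (rule lborel_pair.Fubini_integral)
  also have "\<dots> = Gamma \<alpha> * Gamma (2 - \<alpha>) * (\<integral>r. indicator {0<..<t} r * ((t - r) * f r) \<partial>lborel)"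
    by (simp only: has_bochner_integral_integral_eq[OF hF] integral_mult_right_zero)
  finally show ?thesis .
qed

text \<open>
  Applying the fractional integral of order \<open>\<alpha>\<close> to the equation \<open>\<partial>\<^sup>\<alpha> \<psi> = - l \<psi>\<close> turns the left-hand side
  into the double integral of \<open>\<psi>''\<close>, which is \<open>\<psi> t - a t\<close> by the fundamental theorem of calculus for
  \<open>(t - s) \<psi>' s + \<psi> s\<close>. The second derivative exists everywhere in \<open>(0, T)\<close> but need not be continuous,
  so the gauge integral is used for this last step.
\<close>

lemma caputo_equation_Volterra:
  assumes \<alpha>: "1 < \<alpha>" "\<alpha> < 2" and reg: "caputo_regular T \<psi>" and T: "T > 0" and \<psi>0: "\<psi> 0 = 0"
    and \<psi>1: "(\<psi> has_real_derivative a) (at 0 within {0..T})"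
    and eq: "AE t in lebesgue_on {0<..<T}. caputo \<alpha> \<psi> t = - l * \<psi> t" and t: "t \<in> {0<..T}"
  shows "\<psi> t = a * t - l / Gamma \<alpha> * (\<integral>s. indicator {0<..<t} s * ((t - s) powr (\<alpha> - 1) * \<psi> s) \<partial>lborel)"
proof -
  from reg obtain \<psi>' where d1: "\<And>t. t \<in> {0..T} \<Longrightarrow> (\<psi> has_real_derivative \<psi>' t) (at t within {0..T})"
    and c1: "continuous_on {0..T} \<psi>'"
    and d2: "\<And>t. t \<in> {0<..<T} \<Longrightarrow> deriv \<psi> field_differentiable (at t)"
    and i2: "integrable (lebesgue_on {0<..<T}) (deriv (deriv \<psi>))"
    unfolding caputo_regular_def by blast
  define g where "g = deriv (deriv \<psi>)"
  have \<psi>'0: "\<psi>' 0 = a"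
  proof (rule has_field_derivative_unique)
    show "(\<psi> has_real_derivative \<psi>' 0) (at 0 within {0..T})" using d1 T by simp
    show "(\<psi> has_real_derivative a) (at 0 within {0..T})" by fact
    show "at 0 within {0..T} \<noteq> bot" using T by (simp add: at_within_Icc_at_right)
  qed
  have d1': "(\<psi> has_real_derivative \<psi>' s) (at s)" if "s \<in> {0<..<T}" for s
    using d1[of s] that at_within_interior[of s "{0..T}"] by simp
  have cont: "continuous_on {0..T} \<psi>"
    using d1 by (intro DERIV_continuous_on) auto
  have d2': "(\<psi>' has_real_derivative g s) (at s)" if "s \<in> {0<..<T}" for s
  proof (rule has_field_derivative_transform_within_open[of "deriv \<psi>" _ _ "{0<..<T}"])
    show "(deriv \<psi> has_real_derivative g s) (at s)"
      unfolding g_def using d2[OF that] by (simp add: DERIV_deriv_iff_field_differentiable)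
  qed (use that d1' DERIV_imp_deriv in auto)
  have tT: "{0<..<t} \<subseteq> {0<..<T}" using t by auto
  \<comment> \<open>a Borel measurable version of the second derivative, for Fubini's theorem\<close>
  have "integrable lebesgue (\<lambda>x. indicator {0<..<T} x * g x)"
    using i2 by (simp add: integrable_restrict_space g_def)
  moreover then obtain f where f_meas: "f \<in> borel_measurable lborel"
    and f_AE: "AE x in lborel. indicator {0<..<T} x * g x = f x"
    using completion_ex_borel_measurable_real[of "\<lambda>x. indicator {0<..<T} x * g x" lborel]
    by blast
  ultimately have int_g: "integrable lebesgue (\<lambda>x. indicator {0<..<T} x * g x)" and int_f: "integrable lborel f"
    using integrable_cong_AE[of "\<lambda>x. indicator {0<..<T} x * g x" lebesgue f] f_meas
    by (auto simp: AE_completion_iff integrable_completion measurable_completion)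
  have [measurable]: "f \<in> borel_measurable borel" "(\<lambda>x. indicator {0<..<T} x * g x) \<in> borel_measurable lebesgue"
    using f_meas int_g by auto
  have transfer: "(\<integral>x. indicator {0<..<s} x * (w x * g x) \<partial>lebesgue) = (\<integral>x. indicator {0<..<s} x * (w x * f x) \<partial>lborel)"
    if "s \<le> T" and w [measurable]: "w \<in> borel_measurable borel" for s and w :: "real \<Rightarrow> real"
  proof -
    have "(\<integral>x. indicator {0<..<s} x * (w x * g x) \<partial>lebesgue) = (\<integral>x. indicator {0<..<s} x * w x * f x \<partial>lebesgue)"
    proof (rule integral_cong_AE)
      have e: "indicator {0<..<s} x * (w x * g x) = indicator {0<..<s} x * w x * (indicator {0<..<T} x * g x)" for x
        using that by (auto simp: indicator_def)
      have m: "(\<lambda>x. indicator {0<..<s} x * w x) \<in> borel_measurable lebesgue"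
        by (intro measurable_completion) measurable
      show "(\<lambda>x. indicator {0<..<s} x * (w x * g x)) \<in> borel_measurable lebesgue"
        unfolding e by (intro borel_measurable_times[OF m] borel_measurable_integrable[OF int_g])
      show "(\<lambda>x. indicator {0<..<s} x * w x * f x) \<in> borel_measurable lebesgue"
        by (intro measurable_completion) measurable
      show "AE x in lebesgue. indicator {0<..<s} x * (w x * g x) = indicator {0<..<s} x * w x * f x"
        unfolding e AE_completion_iff using f_AE by eventually_elim simp
    qed
    also have "\<dots> = (\<integral>x. indicator {0<..<s} x * w x * f x \<partial>lborel)"
      by (intro integral_completion) measurable
    finally show ?thesis by (simp add: mult.assoc)
  qed
  define k where "k s = (\<integral>r. indicator {0<..<s} r * ((s - r) powr (1 - \<alpha>) * f r) \<partial>lborel)" for s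
  have caputo: "caputo \<alpha> \<psi> s = k s / Gamma (2 - \<alpha>)" if "s \<le> T" for s
    using transfer[OF that, of "\<lambda>r. (s - r) powr (1 - \<alpha>)"]
    by (simp add: caputo_def k_def g_def integral_restrict_space)
  have [measurable]: "k \<in> borel_measurable borel"
  proof -
    have "(\<lambda>p. indicator {0<..<fst p} (snd p) * ((fst p - snd p) powr (1 - \<alpha>) * f (snd p)))
       = (\<lambda>p. indicator {p. 0 < snd p \<and> snd p < fst p} p * ((fst p - snd p) powr (1 - \<alpha>) * f (snd p)))"
      by (auto simp: indicator_def)
    then have "(\<lambda>(s, r). indicator {0<..<s} r * ((s - r) powr (1 - \<alpha>) * f r)) \<in> borel_measurable (borel \<Otimes>\<^sub>M lborel)"
      by (simp add: case_prod_unfold)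
    then show ?thesis
      unfolding k_def[abs_def] by (rule lborel.borel_measurable_lebesgue_integral)
  qed
  have \<Gamma>: "Gamma \<alpha> > 0" "Gamma (2 - \<alpha>) > 0" using \<alpha> by auto
  have k_eq: "AE s in lborel. s \<in> {0<..<T} \<longrightarrow> k s = - l * Gamma (2 - \<alpha>) * \<psi> s"
  proof -
    have "AE s in lborel. s \<in> {0<..<T} \<longrightarrow> caputo \<alpha> \<psi> s = - l * \<psi> s"
      using eq by (simp add: AE_restrict_space_iff AE_completion_iff)
    then show ?thesis
    proof eventually_elim
      case (elim s)
      show ?case
      proof
        assume s: "s \<in> {0<..<T}"
        then have "k s / Gamma (2 - \<alpha>) = - l * \<psi> s" using elim caputo[of s] by simp
        then show "k s = - l * Gamma (2 - \<alpha>) * \<psi> s" using \<Gamma> by (simp add: field_simps)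
      qed
    qed
  qed
  have cancel: "I = - l / Gamma \<alpha> * J" if "Gamma \<alpha> * Gamma (2 - \<alpha>) * I = Gamma (2 - \<alpha>) * (- l * J)" for I J
  proof -
    have "Gamma (2 - \<alpha>) * (Gamma \<alpha> * I) = Gamma (2 - \<alpha>) * (- l * J)" using that by (simp add: mult_ac)
    then have "Gamma \<alpha> * I = - l * J" using \<Gamma> by (subst (asm) mult_left_cancel) auto
    then show ?thesis using \<Gamma> by (simp add: field_simps)
  qed
  have int_\<psi>: "integrable lborel (\<lambda>s. indicator {0<..<t} s * ((t - s) powr (\<alpha> - 1) * \<psi> s))"
    using t by (intro continuous_kernel_integrable[OF \<alpha>(1) cont]) auto
  have "Gamma \<alpha> * Gamma (2 - \<alpha>) * (\<integral>r. indicator {0<..<t} r * ((t - r) * f r) \<partial>lborel)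
    = (\<integral>s. indicator {0<..<t} s * ((t - s) powr (\<alpha> - 1) * k s) \<partial>lborel)"
    unfolding k_def by (rule fractional_integral_semigroup[OF \<alpha> int_f, symmetric])
  also have "\<dots> = (\<integral>s. - l * Gamma (2 - \<alpha>) * (indicator {0<..<t} s * ((t - s) powr (\<alpha> - 1) * \<psi> s)) \<partial>lborel)"
  proof (rule integral_cong_AE)
    show "(\<lambda>s. indicator {0<..<t} s * ((t - s) powr (\<alpha> - 1) * k s)) \<in> borel_measurable lborel"
      by measurable
    show "(\<lambda>s. - l * Gamma (2 - \<alpha>) * (indicator {0<..<t} s * ((t - s) powr (\<alpha> - 1) * \<psi> s))) \<in> borel_measurable lborel"
      by (intro borel_measurable_times[OF borel_measurable_const] borel_measurable_integrable[OF int_\<psi>])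
    show "AE s in lborel. indicator {0<..<t} s * ((t - s) powr (\<alpha> - 1) * k s)
        = - l * Gamma (2 - \<alpha>) * (indicator {0<..<t} s * ((t - s) powr (\<alpha> - 1) * \<psi> s))"
      using k_eq by eventually_elim (use tT in \<open>auto simp: indicator_def\<close>)
  qed
  also have "\<dots> = Gamma (2 - \<alpha>) * (- l * (\<integral>s. indicator {0<..<t} s * ((t - s) powr (\<alpha> - 1) * \<psi> s) \<partial>lborel))"
    by (subst integral_mult_right_zero) simp
  finally have "(\<integral>r. indicator {0<..<t} r * ((t - r) * f r) \<partial>lborel)
      = - l / Gamma \<alpha> * (\<integral>s. indicator {0<..<t} s * ((t - s) powr (\<alpha> - 1) * \<psi> s) \<partial>lborel)"
    by (rule cancel)
  moreover have "(\<integral>r. indicator {0<..<t} r * ((t - r) * f r) \<partial>lborel) = \<psi> t - a * t"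
  proof -
    define G where "G s = (t - s) * \<psi>' s + \<psi> s" for s
    have "((\<lambda>s. (t - s) * g s) has_integral (G t - G 0)) {0..t}"
    proof (rule fundamental_theorem_of_calculus_interior)
      show "continuous_on {0..t} G"
        unfolding G_def using t
        by (intro continuous_intros continuous_on_subset[OF c1] continuous_on_subset[OF cont]) auto
      fix s assume s: "s \<in> {0<..<t}"
      then have s': "s \<in> {0<..<T}" using tT by auto
      have "(G has_real_derivative ((t - s) * g s)) (at s)"
        unfolding G_def by (auto intro!: derivative_eq_intros d1'[OF s'] d2'[OF s'])
      then show "(G has_vector_derivative (t - s) * g s) (at s)"
        by (simp add: has_real_derivative_iff_has_vector_derivative)
    qed (use t in auto)
    then have "((\<lambda>s. (t - s) * g s) has_integral (G t - G 0)) {0<..<t}"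
      by (simp add: has_integral_Icc_iff_Ioo)
    moreover have "set_integrable lebesgue {0<..<t} (\<lambda>s. (t - s) * g s)"
      unfolding set_integrable_def
    proof (rule Bochner_Integration.integrable_bound)
      show "integrable lebesgue (\<lambda>x. t * (indicator {0<..<T} x * g x))" using int_g by simp
      have e: "indicator {0<..<t} x *\<^sub>R ((t - x) * g x) = indicator {0<..<t} x * (t - x) * (indicator {0<..<T} x * g x)" for x
        using tT by (auto simp: indicator_def)
      have m: "(\<lambda>x. indicator {0<..<t} x * (t - x)) \<in> borel_measurable lebesgue"
        by (intro measurable_completion) measurable
      show "(\<lambda>x. indicator {0<..<t} x *\<^sub>R ((t - x) * g x)) \<in> borel_measurable lebesgue"
        unfolding e by (intro borel_measurable_times[OF m] borel_measurable_integrable[OF int_g])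
      show "AE x in lebesgue. norm (indicator {0<..<t} x *\<^sub>R ((t - x) * g x)) \<le> norm (t * (indicator {0<..<T} x * g x))"
        unfolding e by (rule AE_I2) (auto simp: indicator_def abs_mult intro!: mult_right_mono)
    qed
    ultimately have "(LINT s:{0<..<t}|lebesgue. (t - s) * g s) = G t - G 0"
      by (metis has_integral_set_lebesgue has_integral_unique)
    then show ?thesis
      using transfer[of t "\<lambda>s. t - s"] t
      by (simp add: set_lebesgue_integral_def mult.commute[of a t] G_def \<psi>0 \<psi>'0)
  qed
  ultimately show ?thesis by simp
qed

lemma caputo_equation_solution:
  assumes \<alpha>: "1 < \<alpha>" "\<alpha> < 2" and l: "l > 0" and T: "T > 0" and reg: "caputo_regular T \<psi>" and \<psi>0: "\<psi> 0 = 0"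
    and \<psi>1: "(\<psi> has_real_derivative a) (at 0 within {0..T})"
    and eq: "AE t in lebesgue_on {0<..<T}. caputo \<alpha> \<psi> t = - l * \<psi> t"
  shows "\<psi> T = a * T * mittag_leffler \<alpha> 2 (- l * T powr \<alpha>)"
proof (rule Volterra_equation_solution[OF \<alpha>(1) l])
  show "continuous_on {0..T} \<psi>"
    using reg DERIV_continuous_on[of "{0..T}" \<psi>] unfolding caputo_regular_def by blast
  show "\<psi> t = a * t - l / Gamma \<alpha> * (\<integral>s. indicator {0<..<t} s * ((t - s) powr (\<alpha> - 1) * \<psi> s) \<partial>lborel)"
    if "t \<in> {0<..T}" for t
    by (rule caputo_equation_Volterra[OF \<alpha> reg T \<psi>0 \<psi>1 eq that])
qed (use T in auto)

section \<open>Laplace transforms\<close>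

text \<open>
  Uniqueness for the Laplace transform on an arithmetic progression: by the Weierstrass theorem the
  hypothesis extends from powers of \<open>exp (- t)\<close> to continuous functions of \<open>exp (- t)\<close>, in
  particular to a tent function supported where \<open>f\<close> is positive.
\<close>

lemma Laplace_zero_imp_nonpos:
  fixes f :: "real \<Rightarrow> real"
  assumes cont: "continuous_on {0<..} f"
    and int: "integrable lborel (\<lambda>t. indicator {0<..} t * (exp (- s * t) * f t))"
    and zero: "\<And>n::nat. (\<integral>t. exp (- t) ^ n * (indicator {0<..} t * (exp (- s * t) * f t)) \<partial>lborel) = 0"
    and t0: "t0 > 0"
  shows "f t0 \<le> 0"
proof (rule ccontr)
  assume "\<not> f t0 \<le> 0"
  then have pos: "f t0 > 0" by simp
  define g where "g t = indicator {0<..} t * (exp (- s * t) * f t)" for t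
  have int_g: "integrable lborel g" using int by (simp add: g_def[abs_def])
  have [measurable]: "g \<in> borel_measurable borel" using int_g by auto
  have bounded_mult: "integrable lborel (\<lambda>t. \<phi> (exp (- t)) * g t)"
    if [measurable]: "\<phi> \<in> borel_measurable borel" and b: "\<And>x. x \<in> {0..1} \<Longrightarrow> \<bar>\<phi> x\<bar> \<le> B" for \<phi> :: "real \<Rightarrow> real" and B
  proof (rule Bochner_Integration.integrable_bound)
    show "integrable lborel (\<lambda>t. B * g t)" using int_g by simp
    show "AE t in lborel. norm (\<phi> (exp (- t)) * g t) \<le> norm (B * g t)"
    proof (rule AE_I2)
      fix t
      show "norm (\<phi> (exp (- t)) * g t) \<le> norm (B * g t)"
      proof (cases "t > 0")
        case True
        then have "\<bar>\<phi> (exp (- t))\<bar> \<le> \<bar>B\<bar>" using b[of "exp (- t)"] by simp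
        then show ?thesis by (simp add: abs_mult mult_right_mono)
      qed (simp add: g_def)
    qed
  qed measurable
  have poly: "(\<integral>t. p (exp (- t)) * g t \<partial>lborel) = 0" if "real_polynomial_function p" for p
  proof -
    from that obtain a n where p: "p = (\<lambda>x. \<Sum>i\<le>n. a i * x ^ i)"
      by (auto simp: real_polynomial_function_iff_sum)
    have "(\<integral>t. p (exp (- t)) * g t \<partial>lborel) = (\<integral>t. (\<Sum>i\<le>n. a i * (exp (- t) ^ i * g t)) \<partial>lborel)"
      by (simp add: p sum_distrib_right mult.assoc)
    also have "\<dots> = (\<Sum>i\<le>n. \<integral>t. a i * (exp (- t) ^ i * g t) \<partial>lborel)"
    proof (rule Bochner_Integration.integral_sum)
      fix i
      show "integrable lborel (\<lambda>t. a i * (exp (- t) ^ i * g t))"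
        by (intro integrable_mult_right bounded_mult[of "\<lambda>x. x ^ i" 1]) (auto simp: power_abs power_le_one)
    qed
    also have "\<dots> = 0"
      using zero by (simp add: g_def)
    finally show ?thesis .
  qed
  have cont_zero: "(\<integral>t. \<phi> (exp (- t)) * g t \<partial>lborel) = 0"
    if \<phi>: "continuous_on UNIV \<phi>" for \<phi> :: "real \<Rightarrow> real"
  proof (rule ccontr)
    assume nz: "(\<integral>t. \<phi> (exp (- t)) * g t \<partial>lborel) \<noteq> 0"
    define I where "I = (\<integral>t. \<bar>g t\<bar> \<partial>lborel)"
    define e where "e = \<bar>\<integral>t. \<phi> (exp (- t)) * g t \<partial>lborel\<bar> / (I + 1)"
    have "I \<ge> 0" by (simp add: I_def)
    then have "e > 0" using nz by (simp add: e_def)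
    obtain p where p: "real_polynomial_function p" "\<And>x. x \<in> {0..1} \<Longrightarrow> \<bar>\<phi> x - p x\<bar> < e"
      using Stone_Weierstrass_real_polynomial_function[of "{0..1::real}" \<phi> e] \<open>e > 0\<close>
        continuous_on_subset[OF \<phi>] by auto
    have pc: "continuous_on UNIV p"
      using p(1) unfolding real_polynomial_function_iff_sum by (auto intro!: continuous_intros)
    have meas: "\<phi> \<in> borel_measurable borel" "p \<in> borel_measurable borel"
      using \<phi> pc by (auto intro: borel_measurable_continuous_onI)
    have bdd: "\<exists>B. \<forall>x\<in>{0..1}. \<bar>h x\<bar> \<le> B" if "continuous_on UNIV h" for h :: "real \<Rightarrow> real"
      using compact_continuous_image[OF continuous_on_subset[OF that], of "{0..1}"] compact_imp_bounded
      by (fastforce simp: bounded_iff)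
    from bdd[OF \<phi>] obtain B where "\<And>x. x \<in> {0..1} \<Longrightarrow> \<bar>\<phi> x\<bar> \<le> B" by blast
    then have i1: "integrable lborel (\<lambda>t. \<phi> (exp (- t)) * g t)" using meas by (intro bounded_mult) auto
    from bdd[OF pc]
    obtain B where "\<And>x. x \<in> {0..1} \<Longrightarrow> \<bar>p x\<bar> \<le> B" by blast
    then have i2: "integrable lborel (\<lambda>t. p (exp (- t)) * g t)" using meas by (intro bounded_mult) auto
    have "(\<integral>t. \<phi> (exp (- t)) * g t \<partial>lborel) = (\<integral>t. \<phi> (exp (- t)) * g t - p (exp (- t)) * g t \<partial>lborel)"
      by (simp add: Bochner_Integration.integral_diff[OF i1 i2] poly[OF p(1)])
    also have "\<bar>\<dots>\<bar> \<le> (\<integral>t. e * \<bar>g t\<bar> \<partial>lborel)"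
    proof (rule integral_abs_bound[THEN order.trans], rule integral_mono)
      show "integrable lborel (\<lambda>t. \<bar>\<phi> (exp (- t)) * g t - p (exp (- t)) * g t\<bar>)"
        using i1 i2 by simp
      show "integrable lborel (\<lambda>t. e * \<bar>g t\<bar>)" using int_g by simp
      fix t
      show "\<bar>\<phi> (exp (- t)) * g t - p (exp (- t)) * g t\<bar> \<le> e * \<bar>g t\<bar>"
      proof (cases "t > 0")
        case True
        then have "\<bar>\<phi> (exp (- t)) - p (exp (- t))\<bar> \<le> e" using p(2)[of "exp (- t)"] by simp
        then show ?thesis by (simp add: abs_mult mult_right_mono flip: left_diff_distrib)
      qed (simp add: g_def)
    qed
    also have "\<dots> = e * I" by (simp add: I_def)
    also have "\<dots> < e * (I + 1)" using \<open>e > 0\<close> by simp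
    also have "\<dots> = \<bar>\<integral>t. \<phi> (exp (- t)) * g t \<partial>lborel\<bar>" using \<open>I \<ge> 0\<close> by (simp add: e_def)
    finally show False by simp
  qed
  have "isCont f t0" using cont t0 by (simp add: continuous_on_eq_continuous_at)
  then obtain d where d: "d > 0" "\<And>t. \<bar>t - t0\<bar> < d \<Longrightarrow> \<bar>f t - f t0\<bar> < f t0"
    unfolding continuous_at_eps_delta dist_real_def using pos by blast
  have dpos: "f t > 0" if "\<bar>t - t0\<bar> < d" for t using d(2)[OF that] by linarith
  have "isCont ln (exp (- t0))" by (intro isCont_ln) simp
  then obtain r where r: "r > 0" "\<And>x. \<bar>x - exp (- t0)\<bar> < r \<Longrightarrow> \<bar>ln x - ln (exp (- t0))\<bar> < d"
    unfolding continuous_at_eps_delta dist_real_def using d(1) by blast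
  define \<phi> where "\<phi> x = max 0 (r - \<bar>x - exp (- t0)\<bar>)" for x
  have "continuous_on UNIV \<phi>" unfolding \<phi>_def by (intro continuous_intros)
  define h where "h t = \<phi> (exp (- t)) * g t" for t
  have fpos: "f t > 0" if "\<phi> (exp (- t)) \<noteq> 0" for t
  proof -
    have "\<bar>exp (- t) - exp (- t0)\<bar> < r" using that by (auto simp: \<phi>_def max_def split: if_splits)
    from r(2)[OF this] dpos[of t] show ?thesis by (simp add: abs_minus_commute)
  qed
  have h0: "h t \<ge> 0" for t
  proof (cases "\<phi> (exp (- t)) = 0")
    case False
    have "0 \<le> \<phi> (exp (- t))" by (simp add: \<phi>_def)
    then show ?thesis using fpos[OF False] by (simp add: h_def g_def indicator_def)
  qed (simp add: h_def)
  have int_h: "integrable lborel h"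
    unfolding h_def
  proof (rule bounded_mult)
    show "\<phi> \<in> borel_measurable borel" using \<open>continuous_on UNIV \<phi>\<close> by (rule borel_measurable_continuous_onI)
    show "\<bar>\<phi> x\<bar> \<le> r" for x using r(1) by (simp add: \<phi>_def)
  qed
  have "(\<integral>t. h t \<partial>lborel) = 0"
    unfolding h_def by (rule cont_zero) fact
  then have AE0: "AE t in lborel. h t = 0"
    using integral_nonneg_eq_0_iff_AE[OF int_h] h0 by simp
  define U where "U = {t. \<bar>exp (- t) - exp (- t0)\<bar> < r} \<inter> {0<..}"
  have "open U"
    unfolding U_def by (intro open_Int open_Collect_less open_greaterThan continuous_intros)
  have "h t \<noteq> 0" if "t \<in> U" for t
  proof -
    have "\<phi> (exp (- t)) > 0" "t > 0" using that by (auto simp: U_def \<phi>_def)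
    with fpos[of t] show ?thesis by (simp add: h_def g_def)
  qed
  with AE0 have "AE t in lborel. t \<notin> U" by (auto elim: eventually_mono)
  then have "U \<in> null_sets lborel"
    using \<open>open U\<close> by (subst AE_iff_null_sets) auto
  then have "negligible U" by (simp add: negligible_iff_null_sets null_sets_completionI)
  moreover have "t0 \<in> U" using t0 r(1) by (simp add: U_def)
  ultimately show False using \<open>open U\<close> open_not_negligible by blast
qed

lemma Laplace_transform_unique:
  fixes f g :: "real \<Rightarrow> real"
  assumes f: "continuous_on {0<..} f" "\<And>s. s > \<sigma> \<Longrightarrow> has_bochner_integral lborel (\<lambda>t. indicator {0<..} t * (exp (- s * t) * f t)) (L s)"
    and g: "continuous_on {0<..} g" "\<And>s. s > \<sigma> \<Longrightarrow> has_bochner_integral lborel (\<lambda>t. indicator {0<..} t * (exp (- s * t) * g t)) (L s)"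
    and t: "t > 0"
  shows "f t = g t"
proof -
  have "a t \<le> b t" if a: "continuous_on {0<..} a" "\<And>s. s > \<sigma> \<Longrightarrow> has_bochner_integral lborel (\<lambda>t. indicator {0<..} t * (exp (- s * t) * a t)) (L s)"
    and b: "continuous_on {0<..} b" "\<And>s. s > \<sigma> \<Longrightarrow> has_bochner_integral lborel (\<lambda>t. indicator {0<..} t * (exp (- s * t) * b t)) (L s)" for a b
  proof -
    have hb: "has_bochner_integral lborel (\<lambda>t. indicator {0<..} t * (exp (- s * t) * (a t - b t))) 0" if "s > \<sigma>" for s
      using has_bochner_integral_diff[OF a(2)[OF that] b(2)[OF that]] by (simp add: right_diff_distrib)
    have "a t - b t \<le> 0"
    proof (rule Laplace_zero_imp_nonpos[of "\<lambda>t. a t - b t" "\<sigma> + 1"])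
      show "continuous_on {0<..} (\<lambda>t. a t - b t)" by (intro continuous_intros a b)
      show "integrable lborel (\<lambda>t. indicator {0<..} t * (exp (- (\<sigma> + 1) * t) * (a t - b t)))"
        using hb[of "\<sigma> + 1"] by (simp add: has_bochner_integral_iff)
      fix n :: nat
      have e: "exp (- t) ^ n * exp (- (\<sigma> + 1) * t) = exp (- (\<sigma> + 1 + n) * t)" for t
        by (simp add: exp_of_nat_mult[symmetric] mult_exp_exp algebra_simps)
      have "exp (- t) ^ n * (indicator {0<..} t * (exp (- (\<sigma> + 1) * t) * (a t - b t)))
        = indicator {0<..} t * (exp (- (\<sigma> + 1 + n) * t) * (a t - b t))" for t
        unfolding e[symmetric] by simp
      then show "(\<integral>t. exp (- t) ^ n * (indicator {0<..} t * (exp (- (\<sigma> + 1) * t) * (a t - b t))) \<partial>lborel) = 0"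
        using hb[of "\<sigma> + 1 + n"] by (simp only: has_bochner_integral_iff)
    qed fact
    then show ?thesis by simp
  qed
  from this[OF f g] this[OF g f] show ?thesis by simp
qed

lemma Laplace_transform_power:
  fixes s p :: real
  assumes s: "s > 0" and p: "p > -1"
  shows "has_bochner_integral lborel (\<lambda>t. indicator {0<..} t * (exp (- s * t) * t powr p)) (Gamma (p + 1) / s powr (p + 1))"
proof -
  have "has_bochner_integral lborel (\<lambda>t. indicator {0<..} t * t powr p / exp t) (Gamma (p + 1))"
  proof (rule has_bochner_integral_nn_integral)
    have "ennreal (Gamma (p + 1)) = (\<integral>\<^sup>+t. ennreal (indicator {0..} t * t powr p / exp t) \<partial>lborel)"
      using Gamma_conv_nn_integral_real[of "p + 1"] p by simp
    also have "\<dots> = (\<integral>\<^sup>+t. ennreal (indicator {0<..} t * t powr p / exp t) \<partial>lborel)"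
      by (intro nn_integral_cong) (auto simp: indicator_def)
    finally show "(\<integral>\<^sup>+t. ennreal (indicator {0<..} t * t powr p / exp t) \<partial>lborel) = ennreal (Gamma (p + 1))" ..
  qed (use p in \<open>auto intro!: Gamma_real_nonneg\<close>)
  then have "has_bochner_integral lborel (\<lambda>t. indicator {0<..} (0 + s * t) * (0 + s * t) powr p / exp (0 + s * t)) (Gamma (p + 1) /\<^sub>R \<bar>s\<bar>)"
    using s by (subst (asm) lborel_has_bochner_integral_real_affine_iff[of s _ _ 0]) auto
  from has_bochner_integral_mult_right[OF this, of "s powr (- p)"]
  have "has_bochner_integral lborel (\<lambda>t. s powr (- p) * (indicator {0<..} (0 + s * t) * (0 + s * t) powr p / exp (0 + s * t)))
     (s powr (- p) * (Gamma (p + 1) /\<^sub>R \<bar>s\<bar>))" .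
  moreover have "s powr (- p) * (indicator {0<..} (0 + s * t) * (0 + s * t) powr p / exp (0 + s * t))
     = indicator {0<..} t * (exp (- s * t) * t powr p)" for t
    using s by (auto simp: indicator_def powr_mult powr_minus exp_minus field_simps zero_less_mult_iff)
  moreover have "s powr (- p) * (Gamma (p + 1) /\<^sub>R \<bar>s\<bar>) = Gamma (p + 1) / s powr (p + 1)"
    using s by (simp add: powr_minus powr_add field_simps)
  ultimately show ?thesis by (simp only:)
qed

text \<open>Termwise integration; it is justified for \<open>s > 1\<close>, where the series of transforms is geometric with ratio \<open>- s\<^sup>-\<^sup>\<alpha>\<close>.\<close>

lemma Laplace_transform_mittag_leffler:
  fixes s :: real
  assumes \<alpha>: "1 < \<alpha>" and s: "s > 1"
  shows "has_bochner_integral lborel (\<lambda>t. indicator {0<..} t * (exp (- s * t) * (t * mittag_leffler \<alpha> 2 (- (t powr \<alpha>)))))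
    (s powr (\<alpha> - 2) / (1 + s powr \<alpha>))"
proof -
  define f where "f k t = (-1) ^ k / Gamma (\<alpha> * real k + 2) * (indicator {0<..} t * (exp (- s * t) * t powr (\<alpha> * real k + 1)))"
    for k :: nat and t
  have \<Gamma>: "Gamma (\<alpha> * real k + 2) > 0" for k using \<alpha> by (auto intro!: Gamma_real_pos add_nonneg_pos)
  define x where "x = s powr (- \<alpha>)"
  have x: "0 < x" "x < 1" using s \<alpha> powr_less_mono[of "- \<alpha>" 0 s] by (auto simp: x_def)
  have hb: "has_bochner_integral lborel (\<lambda>t. indicator {0<..} t * (exp (- s * t) * t powr (\<alpha> * real k + 1)))
      (Gamma (\<alpha> * real k + 2) * (s powr (-2) * x ^ k))" for k
  proof -
    have p: "\<alpha> * real k + 1 > -1" using \<alpha> by (simp add: add_nonneg_pos less_le_trans[of _ 0])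
    have "x ^ k = x powr real k" using x by (simp add: powr_realpow)
    also have "\<dots> = s powr (- \<alpha> * real k)" by (simp add: x_def powr_powr)
    finally have xk: "x ^ k = s powr (- \<alpha> * real k)" .
    have "- (\<alpha> * real k + 2) = -2 + - \<alpha> * real k" by simp
    then have "s powr (-2) * x ^ k = s powr (- (\<alpha> * real k + 2))"
      unfolding xk by (simp only: powr_add)
    then have "1 / s powr (\<alpha> * real k + 2) = s powr (-2) * x ^ k"
      by (simp only: powr_minus_divide)
    with Laplace_transform_power[OF _ p, of s] s show ?thesis
      by (simp add: add.assoc divide_inverse mult.assoc)
  qed
  have hf: "has_bochner_integral lborel (f k) (s powr (-2) * (- x) ^ k)" for k
    using has_bochner_integral_mult_right[OF hb[of k], of "(-1) ^ k / Gamma (\<alpha> * real k + 2)"] \<Gamma>[of k]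
    by (simp add: f_def[abs_def] power_minus[of x] mult_ac)
  have fnorm: "norm (f k t) = 1 / Gamma (\<alpha> * real k + 2) * (indicator {0<..} t * (exp (- s * t) * t powr (\<alpha> * real k + 1)))" for k t
    using \<Gamma>[of k] by (simp add: f_def abs_mult power_abs)
  have hfn: "has_bochner_integral lborel (\<lambda>t. norm (f k t)) (s powr (-2) * x ^ k)" for k
    using has_bochner_integral_mult_right[OF hb[of k], of "1 / Gamma (\<alpha> * real k + 2)"] \<Gamma>[of k]
    unfolding fnorm by (simp add: mult_ac)
  have fsums: "(\<lambda>k. f k t) sums (indicator {0<..} t * (exp (- s * t) * (t * mittag_leffler \<alpha> 2 (- (t powr \<alpha>)))))" for t
  proof (cases "t > 0")
    case True
    have "f k t = (exp (- s * t) * t) * ((- (t powr \<alpha>)) ^ k / Gamma (\<alpha> * real k + 2))" for k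
    proof -
      have "t powr (\<alpha> * real k + 1) = t * (t powr \<alpha>) ^ k"
        using True by (simp add: powr_add powr_powr[symmetric] powr_realpow)
      then show ?thesis using True by (simp add: f_def power_minus[of "t powr \<alpha>"])
    qed
    then show ?thesis
      using sums_mult[OF mittag_leffler_sums[of \<alpha> 2 "- (t powr \<alpha>)"], of "exp (- s * t) * t"] \<alpha> True by (simp add: mult.assoc)
  qed (simp add: f_def)
  have 1: "AE t in lborel. summable (\<lambda>k. norm (f k t))"
  proof (rule AE_I2)
    fix t :: real
    show "summable (\<lambda>k. norm (f k t))"
    proof (cases "t > 0")
      case True
      have "norm (f k t) = (exp (- s * t) * t) * ((t powr \<alpha>) ^ k / Gamma (\<alpha> * real k + 2))" for k
      proof -
        have "t powr (\<alpha> * real k + 1) = t * (t powr \<alpha>) ^ k"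
          using True by (simp add: powr_add powr_powr[symmetric] powr_realpow)
        then show ?thesis unfolding fnorm using True by simp
      qed
      then show ?thesis
        using summable_mult[OF mittag_leffler_summable[of \<alpha> 2 "t powr \<alpha>"], of "exp (- s * t) * t"] \<alpha> by simp
    qed (simp add: f_def)
  qed
  have 2: "summable (\<lambda>k. \<integral>t. norm (f k t) \<partial>lborel)"
    unfolding has_bochner_integral_integral_eq[OF hfn] using x by (intro summable_mult summable_geometric) auto
  have int: "integrable lborel (f k)" for k using hf by (simp add: has_bochner_integral_iff)
  have "has_bochner_integral lborel (\<lambda>t. \<Sum>k. f k t) (\<Sum>k. integral\<^sup>L lborel (f k))"
    using integrable_suminf[OF int 1 2] integral_suminf[OF int 1 2] by (simp add: has_bochner_integral_iff)
  moreover have "(\<Sum>k. integral\<^sup>L lborel (f k)) = s powr (\<alpha> - 2) / (1 + s powr \<alpha>)"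
  proof -
    have "(\<lambda>k. s powr (-2) * (- x) ^ k) sums (s powr (-2) * (1 / (1 - (- x))))"
      using x by (intro sums_mult geometric_sums) auto
    moreover have "s powr (-2) * (1 / (1 - (- x))) = s powr (\<alpha> - 2) / (1 + s powr \<alpha>)"
      using s by (simp add: x_def powr_minus powr_diff field_simps)
    ultimately show ?thesis
      unfolding has_bochner_integral_integral_eq[OF hf] by (simp add: sums_iff)
  qed
  moreover have "(\<lambda>t. \<Sum>k. f k t) = (\<lambda>t. indicator {0<..} t * (exp (- s * t) * (t * mittag_leffler \<alpha> 2 (- (t powr \<alpha>)))))"
    using fsums by (auto simp: sums_iff)
  ultimately show ?thesis by simp
qed

lemma continuous_mittag_leffler:
  assumes "1 \<le> \<alpha>" "1 \<le> \<beta>"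
  shows "isCont (mittag_leffler \<alpha> \<beta> :: real \<Rightarrow> real) x"
proof -
  have "isCont (\<lambda>x. \<Sum>k. inverse (Gamma (\<alpha> * real k + \<beta>)) * x ^ k) x"
    using mittag_leffler_summable[OF assms, of "\<bar>x\<bar> + 1"]
    by (intro isCont_powser[where K = "\<bar>x\<bar> + 1"]) (auto simp: divide_inverse mult.commute)
  then show ?thesis
    by (simp add: mittag_leffler_def[abs_def] mult.commute)
qed

section \<open>A contour integral over the right half plane\<close>

lemma norm_powr_of_real: "norm (z powr (of_real a :: complex)) = norm z powr a"
  by (cases "z = 0") (auto simp: powr_def)

lemma one_plus_powr_nonzero:
  fixes z :: complex
  assumes \<alpha>: "0 < \<alpha>" "\<alpha> < 2" and z: "Re z \<ge> 0"
  shows "1 + z powr of_real \<alpha> \<noteq> 0"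
proof
  assume eq: "1 + z powr of_real \<alpha> = 0"
  then have z0: "z \<noteq> 0" by auto
  have m1: "z powr of_real \<alpha> = -1" using eq by (simp add: add_eq_0_iff)
  then have "norm z powr \<alpha> = 1" by (metis norm_powr_of_real norm_minus_cancel norm_one)
  define x where "x = \<alpha> * Im (Ln z)"
  have "Re (z powr of_real \<alpha>) = norm z powr \<alpha> * cos x"
    using z0 by (simp add: powr_def x_def Re_exp)
  with m1 \<open>norm z powr \<alpha> = 1\<close> have "cos x = -1" by simp
  moreover have "\<bar>x\<bar> < pi"
  proof -
    have "\<bar>Im (Ln z)\<bar> \<le> pi / 2" using Im_Ln_pos_le[of z] Re_Ln_pos_le[OF z0] z by simp
    then have "\<alpha> * \<bar>Im (Ln z)\<bar> \<le> \<alpha> * (pi / 2)" using \<alpha> by (intro mult_left_mono) auto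
    also have "\<dots> < pi" using \<alpha> by simp
    finally show ?thesis using \<alpha> by (simp add: x_def abs_mult)
  qed
  ultimately show False
    using cos_monotone_0_pi[of "\<bar>x\<bar>" pi] by simp
qed

text \<open>
  Cauchy's integral formula at \<open>s\<close> for \<open>z\<^sup>\<alpha>\<^sup>-\<^sup>1 / ((1 + z\<^sup>\<alpha>) (z + s))\<close> on the rectangle
  \<open>[0, R] \<times> [- R, R]\<close>. The function is continuous on the closed right half plane, including the branch
  point \<open>0\<close>, and holomorphic in the interior, because \<open>\<alpha> < 2\<close> keeps \<open>z\<^sup>\<alpha>\<close> away from \<open>- 1\<close>. For large \<open>R\<close>,
  the integrand is at most \<open>4 / R\<^sup>3\<close> on the three sides off the imaginary axis; on the imaginary axis its real part is
  an even function, proportional to \<open>g\<close>.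
\<close>

lemma half_plane_transform_tendsto:
  fixes \<alpha> s :: real
  assumes \<alpha>: "1 < \<alpha>" "\<alpha> < 2" and s: "s > 0"
  defines "g \<equiv> \<lambda>\<omega>. \<omega> powr (\<alpha> - 1) / ((1 + 2 * cos (\<alpha> * pi / 2) * \<omega> powr \<alpha> + (\<omega> powr \<alpha>)\<^sup>2) * (s\<^sup>2 + \<omega>\<^sup>2))"
  shows "(\<lambda>n. integral {0..real n} g) \<longlonglongrightarrow> pi / (2 * sin (\<alpha> * pi / 2)) * (s powr (\<alpha> - 2) / (1 + s powr \<alpha>))"
    and "g integrable_on {0..R}"
proof -
  define S where "S = {z::complex. Re z \<ge> 0}"
  define f where "f z = z powr of_real (\<alpha> - 1) / ((1 + z powr of_real \<alpha>) * (z + of_real s))" for z :: complex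
  define F where "F z = f z / (z - of_real s)" for z
  define w0 where "w0 = s powr (\<alpha> - 2) / (1 + s powr \<alpha>) / 2"
  have nz: "1 + z powr of_real \<alpha> \<noteq> 0" "z + of_real s \<noteq> 0" if "z \<in> S" for z
    using one_plus_powr_nonzero[of \<alpha> z] that \<alpha> s by (auto simp: S_def complex_eq_iff)
  have intS: "interior S = {z. Re z > 0}"
    using interior_halfspace_ge[of "1::complex" 0] by (simp add: S_def inner_complex_def)
  have convS: "convex S"
    using convex_halfspace_ge[of 0 "1::complex"] by (simp add: S_def inner_complex_def)
  have contf: "continuous_on S f"
    unfolding f_def using \<alpha> nz
    by (intro continuous_intros) (auto simp: S_def)
  have diff: "f field_differentiable at z" if "z \<in> interior S" for z
  proof -
    have "z \<in> S" "z \<notin> \<real>\<^sub>\<le>\<^sub>0" using that intS interior_subset[of S] by (auto simp: complex_nonpos_Reals_iff)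
    then show ?thesis
      unfolding f_def using nz[of z]
      by (intro field_differentiable_divide field_differentiable_mult field_differentiable_add
          field_differentiable_const field_differentiable_ident)
        (auto simp: field_differentiable_def intro!: has_field_derivative_powr)
  qed
  have sin_pos: "sin (\<alpha> * pi / 2) > 0" using \<alpha> by (intro sin_gt_zero) auto
  have ln_axis: "Ln (Complex 0 x) = Complex (ln \<bar>x\<bar>) (sgn x * pi / 2)" if "x \<noteq> 0" for x
  proof (rule Ln_unique)
    show "exp (Complex (ln \<bar>x\<bar>) (sgn x * pi / 2)) = Complex 0 x"
      using that by (cases "x > 0") (auto simp: complex_eq_iff Re_exp Im_exp)
  qed (use that pi_gt_zero in \<open>auto simp: sgn_if\<close>)
  have powr_axis: "Complex 0 x powr of_real a = of_real (\<bar>x\<bar> powr a) * Complex (cos (a * pi / 2)) (sgn x * sin (a * pi / 2))"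
    if "x \<noteq> 0" for x a
    using that by (cases "x > 0") (auto simp: powr_def ln_axis complex_eq_iff Re_exp Im_exp)
  define D where "D x = 1 + 2 * cos (\<alpha> * pi / 2) * x powr \<alpha> + (x powr \<alpha>)\<^sup>2" for x
  have Dpos: "D x > 0" for x
  proof -
    have "D x = (x powr \<alpha> + cos (\<alpha> * pi / 2))\<^sup>2 + (sin (\<alpha> * pi / 2))\<^sup>2"
      using sin_cos_squared_add[of "\<alpha> * pi / 2"] by (simp add: D_def power2_eq_square algebra_simps)
    then show ?thesis using sin_pos by (simp add: add_nonneg_pos)
  qed
  have ReF: "Re (F (Complex 0 x)) = - sin (\<alpha> * pi / 2) * g \<bar>x\<bar>" for x
  proof (cases "x = 0")
    case True
    then show ?thesis by (simp add: F_def f_def g_def flip: zero_complex.code)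
  next
    case False
    define w where "w = \<bar>x\<bar> powr \<alpha>"
    define c u where "c = cos (\<alpha> * pi / 2)" and "u = sin (\<alpha> * pi / 2)"
    have cu: "cos ((\<alpha> - 1) * pi / 2) = u" "sin ((\<alpha> - 1) * pi / 2) = - c"
      by (auto simp: c_def u_def left_diff_distrib diff_divide_distrib cos_diff sin_diff)
    have den: "(1 + Complex 0 x powr of_real \<alpha>) = Complex (1 + w * c) (sgn x * (w * u))"
      using False by (simp add: powr_axis w_def c_def u_def complex_eq_iff)
    have num: "Complex 0 x powr of_real (\<alpha> - 1) = of_real (\<bar>x\<bar> powr (\<alpha> - 1)) * Complex u (- sgn x * c)"
      using False powr_axis[of x "\<alpha> - 1"] by (simp only: cu) simp
    have sq: "(Complex 0 x + of_real s) * (Complex 0 x - of_real s) = of_real (- (s\<^sup>2 + x\<^sup>2))"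
      by (simp add: complex_eq_iff power2_eq_square)
    have "F (Complex 0 x) = of_real (\<bar>x\<bar> powr (\<alpha> - 1)) * (Complex u (- sgn x * c) / Complex (1 + w * c) (sgn x * (w * u))) / of_real (- (s\<^sup>2 + x\<^sup>2))"
      by (simp only: F_def f_def num den sq[symmetric] divide_divide_eq_left times_divide_eq_right mult.assoc)
    moreover have "Re (of_real r * q / of_real k) = r * Re q / k" for r k q
      by (simp add: Re_divide_of_real)
    ultimately have "Re (F (Complex 0 x)) = \<bar>x\<bar> powr (\<alpha> - 1) * Re (Complex u (- sgn x * c) / Complex (1 + w * c) (sgn x * (w * u))) / (- (s\<^sup>2 + x\<^sup>2))"
      by (simp only:)
    also have "Re (Complex u (- sgn x * c) / Complex (1 + w * c) (sgn x * (w * u))) = u / D \<bar>x\<bar>"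
    proof -
      have sg: "sgn x * sgn x = 1" using False by (simp add: sgn_if)
      have "(1 + w * c)\<^sup>2 + (sgn x * (w * u))\<^sup>2 = 1 + 2 * w * c + w\<^sup>2 * (c\<^sup>2 + (sgn x * sgn x) * u\<^sup>2)"
        by (simp add: power2_eq_square algebra_simps)
      also have "\<dots> = D \<bar>x\<bar>"
        unfolding sg by (simp add: D_def c_def u_def w_def)
      finally have d: "(1 + w * c)\<^sup>2 + (sgn x * (w * u))\<^sup>2 = D \<bar>x\<bar>" .
      have n: "u * (1 + w * c) + (- sgn x * c) * (sgn x * (w * u)) = u * (1 + w * c) - (sgn x * sgn x) * (c * w * u)"
        by (simp add: algebra_simps)
      show ?thesis by (simp only: Re_divide complex.sel d n sg) (simp add: algebra_simps)
    qed
    finally have "Re (F (Complex 0 x)) = \<bar>x\<bar> powr (\<alpha> - 1) * (u / D \<bar>x\<bar>) / (- (s\<^sup>2 + x\<^sup>2))" .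
    moreover have "g \<bar>x\<bar> = \<bar>x\<bar> powr (\<alpha> - 1) / (D \<bar>x\<bar> * (s\<^sup>2 + x\<^sup>2))" by (simp add: g_def D_def)
    moreover have "p * (u / d) / (- k) = - u * (p / (d * k))" for p d k :: real by simp
    ultimately show ?thesis by (simp only: u_def)
  qed
  have contg: "continuous_on {0..R} g" for R
    unfolding g_def using \<alpha> s Dpos
    by (intro continuous_on_divide continuous_on_mult continuous_on_add continuous_on_power continuous_on_powr' continuous_intros)
      (auto simp: D_def[symmetric] less_imp_neq[THEN not_sym] add_pos_nonneg)
  then show int_g: "g integrable_on {0..R}" for R by (rule integrable_continuous_real)
  define R0 where "R0 = max (s + 1) (max (2 * s) 2)"
  have key: "\<bar>integral {0..R} g - pi / (2 * sin (\<alpha> * pi / 2)) * (2 * w0)\<bar> \<le> (8 / sin (\<alpha> * pi / 2)) / R\<^sup>2" if R: "R \<ge> R0" for R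
  proof -
    have R': "R > s" "R \<ge> 2 * s" "R \<ge> 2" "R > 0" using R s by (auto simp: R0_def)
    define a1 a2 a3 a4 where "a1 = Complex 0 (- R)" and "a2 = Complex R (- R)" and "a3 = Complex R R" and "a4 = Complex 0 R"
    have seg: "closed_segment a1 a2 = {z. Im z = - R \<and> 0 \<le> Re z \<and> Re z \<le> R}"
      "closed_segment a2 a3 = {z. Re z = R \<and> - R \<le> Im z \<and> Im z \<le> R}"
      "closed_segment a3 a4 = {z. Im z = R \<and> 0 \<le> Re z \<and> Re z \<le> R}"
      "closed_segment a1 a4 = {z. Re z = 0 \<and> - R \<le> Im z \<and> Im z \<le> R}"
      using R' by (auto simp: a1_def a2_def a3_def a4_def closed_segment_same_Im closed_segment_same_Re closed_segment_eq_real_ivl)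
    have segS: "closed_segment a1 a2 \<subseteq> S - {of_real s}" "closed_segment a2 a3 \<subseteq> S - {of_real s}"
      "closed_segment a3 a4 \<subseteq> S - {of_real s}" "closed_segment a1 a4 \<subseteq> S - {of_real s}"
      unfolding seg using R' s by (auto simp: S_def)
    then have segS': "closed_segment a4 a1 \<subseteq> S - {of_real s}" by (subst closed_segment_commute)
    have contF: "continuous_on (S - {of_real s}) F"
      unfolding F_def by (intro continuous_intros continuous_on_subset[OF contf]) auto
    have ci: "F contour_integrable_on (linepath a b)"
      if "closed_segment a b \<subseteq> S - {of_real s}" for a b
      by (intro contour_integrable_continuous_linepath continuous_on_subset[OF contF] that)
    have ci': "F contour_integrable_on (linepath a1 a2)" "F contour_integrable_on (linepath a2 a3)"
      "F contour_integrable_on (linepath a3 a4)" "F contour_integrable_on (linepath a1 a4)" "F contour_integrable_on (linepath a4 a1)"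
      by (rule ci, rule segS segS')+
    have rect: "rectpath a1 a3 = linepath a1 a2 +++ linepath a2 a3 +++ linepath a3 a4 +++ linepath a4 a1"
      by (simp add: rectpath_def Let_def a1_def a2_def a3_def a4_def)
    have pim: "path_image (rectpath a1 a3) \<subseteq> S - {of_real s}"
      unfolding rect using segS segS' by (simp add: path_image_join)
    have "((\<lambda>w. f w / (w - of_real s)) has_contour_integral (2 * pi * \<i> * winding_number (rectpath a1 a3) (of_real s) * f (of_real s))) (rectpath a1 a3)"
      by (rule Cauchy_integral_formula_weak[OF convS finite.emptyI contf])
        (use diff pim intS s in auto)
    moreover have "winding_number (rectpath a1 a3) (of_real s) = 1"
      using R' s by (intro winding_number_rectpath) (auto simp: in_box_complex_iff a1_def a3_def)
    moreover have "f (of_real s) = of_real w0"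
    proof -
      have "f (of_real s) = of_real (s powr (\<alpha> - 1)) / ((1 + of_real (s powr \<alpha>)) * (of_real s + of_real s))"
        using s powr_of_real[of s "\<alpha> - 1"] powr_of_real[of s \<alpha>] unfolding f_def by (simp only: less_imp_le)
      then have "f (of_real s) = of_real (s powr (\<alpha> - 1) / ((1 + s powr \<alpha>) * (s + s)))"
        by simp
      moreover have "s powr (\<alpha> - 1) / ((1 + s powr \<alpha>) * (s + s)) = w0"
      proof -
        have "s powr (\<alpha> - 1) = s powr (\<alpha> - 2) * s"
          using s powr_add[of s "\<alpha> - 2" 1] by simp
        moreover have "1 + s powr \<alpha> > 0" by (simp add: add_pos_nonneg)
        ultimately show ?thesis using s by (simp add: w0_def)
      qed
      ultimately show ?thesis by (simp only:)
    qed
    ultimately have CI: "contour_integral (rectpath a1 a3) F = 2 * pi * \<i> * of_real w0"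
      unfolding F_def by (intro contour_integral_unique) simp
    have sum: "contour_integral (linepath a1 a2) F + contour_integral (linepath a2 a3) F + contour_integral (linepath a3 a4) F
       - contour_integral (linepath a1 a4) F = 2 * pi * \<i> * of_real w0"
    proof -
      have "contour_integral (linepath a4 a1) F = - contour_integral (linepath a1 a4) F"
        by (rule contour_integral_reverse_linepath, rule continuous_on_subset[OF contF])
          (rule segS')
      moreover have "contour_integral (rectpath a1 a3) F = contour_integral (linepath a1 a2) F +
          (contour_integral (linepath a2 a3) F + (contour_integral (linepath a3 a4) F + contour_integral (linepath a4 a1) F))"
        unfolding rect using ci' by (simp add: contour_integrable_join)
      ultimately show ?thesis using CI by simp
    qed
    have Fbound: "norm (F z) \<le> 4 / R ^ 3" if z: "z \<in> S" "norm z \<ge> R" for z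
    proof -
      define r where "r = norm z"
      have r: "r \<ge> R" using z by (simp add: r_def)
      have "r powr \<alpha> \<ge> r powr 1" using r R' \<alpha> by (intro powr_mono) auto
      then have ra: "r powr \<alpha> \<ge> 2" using r R' by simp
      have 1: "norm (1 + z powr of_real \<alpha>) \<ge> r powr \<alpha> / 2"
      proof -
        have "r powr \<alpha> - 1 \<le> norm (1 + z powr of_real \<alpha>)"
          using norm_triangle_ineq2[of "z powr of_real \<alpha>" "-1"] by (simp add: norm_powr_of_real r_def add.commute)
        with ra show ?thesis by simp
      qed
      have 2: "norm ((z + of_real s) * (z - of_real s)) \<ge> r\<^sup>2 / 2"
      proof -
        have "(z + of_real s) * (z - of_real s) = z\<^sup>2 - of_real (s\<^sup>2)" by (simp add: power2_eq_square algebra_simps)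
        then have "norm ((z + of_real s) * (z - of_real s)) \<ge> r\<^sup>2 - s\<^sup>2"
          using norm_triangle_ineq2[of "z\<^sup>2" "of_real (s\<^sup>2)"] s by (simp add: norm_power r_def)
        moreover have "(2 * s)\<^sup>2 \<le> r\<^sup>2" using r R' s by (intro power_mono) auto
        moreover have "(2 * s)\<^sup>2 = 4 * s\<^sup>2" "0 \<le> s\<^sup>2" by auto
        ultimately show ?thesis by linarith
      qed
      have "norm (F z) = r powr (\<alpha> - 1) / (norm (1 + z powr of_real \<alpha>) * norm ((z + of_real s) * (z - of_real s)))"
        by (simp only: F_def f_def norm_divide norm_mult norm_powr_of_real r_def divide_divide_eq_left mult.assoc)
      also have "\<dots> \<le> r powr (\<alpha> - 1) / (r powr \<alpha> / 2 * (r\<^sup>2 / 2))"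
        using 1 2 r R' ra by (intro divide_left_mono mult_mono mult_pos_pos) (auto intro: less_le_trans)
      also have "\<dots> = 4 / r ^ 3"
        using r R' by (simp add: powr_diff power2_eq_square power3_eq_cube)
      also have "\<dots> \<le> 4 / R ^ 3" using r R' by (intro divide_left_mono power_mono) auto
      finally show ?thesis .
    qed
    have big: "z \<in> S \<and> norm z \<ge> R" if "z \<in> closed_segment a1 a2 \<union> closed_segment a2 a3 \<union> closed_segment a3 a4" for z
      using that R' abs_Im_le_cmod[of z] abs_Re_le_cmod[of z] unfolding seg by (auto simp: S_def)
    have bnd: "norm (contour_integral (linepath a b) F) \<le> 4 / R ^ 3 * norm (b - a)"
      if "F contour_integrable_on (linepath a b)" "closed_segment a b \<subseteq> closed_segment a1 a2 \<union> closed_segment a2 a3 \<union> closed_segment a3 a4" for a b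
      using that big Fbound R' by (intro contour_integral_bound_linepath) auto
    define I where "I = contour_integral (linepath a1 a2) F + contour_integral (linepath a2 a3) F + contour_integral (linepath a3 a4) F"
    have I4: "norm I \<le> 4 / R ^ 3 * norm (a2 - a1) + 4 / R ^ 3 * norm (a3 - a2) + 4 / R ^ 3 * norm (a4 - a3)"
      unfolding I_def by (intro norm_triangle_le add_mono bnd ci') auto
    have "norm (a2 - a1) = R" "norm (a3 - a2) = 2 * R" "norm (a4 - a3) = R"
      using R' by (auto simp: a1_def a2_def a3_def a4_def cmod_def real_sqrt_mult)
    then have I: "norm I \<le> 16 / R\<^sup>2"
      using I4 R' by (simp add: power3_eq_cube power2_eq_square)
    define J where "J = contour_integral (linepath a1 a4) F"
    have "(F has_contour_integral J) (linepath a1 a4)"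
      unfolding J_def using ci' by (intro has_contour_integral_integral)
    then have "((\<lambda>x. F (Complex 0 x)) has_integral (- \<i> * J)) {-R..R}"
      using R' by (subst (asm) has_contour_integral_linepath_same_Re_iff[of _ 0 _ "-R" R]) (auto simp: a1_def a4_def)
    from has_integral_linear[OF this bounded_linear_Re]
    have "((\<lambda>x. Re (F (Complex 0 x))) has_integral Re (- \<i> * J)) {-R..R}"
      by (simp only: o_def)
    then have hJ: "((\<lambda>x. - sin (\<alpha> * pi / 2) * g \<bar>x\<bar>) has_integral Im J) {-R..R}"
      unfolding ReF by simp
    have h1: "((\<lambda>x. - sin (\<alpha> * pi / 2) * g \<bar>x\<bar>) has_integral (- sin (\<alpha> * pi / 2) * integral {0..R} g)) {0..R}"
      by (rule has_integral_eq[OF _ has_integral_mult_right[OF integrable_integral[OF int_g]]]) auto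
    then have "((\<lambda>x. - sin (\<alpha> * pi / 2) * g \<bar>- x\<bar>) has_integral (- sin (\<alpha> * pi / 2) * integral {0..R} g)) {- R..- 0}"
      by (subst has_integral_reflect_real[where f = "\<lambda>x. - sin (\<alpha> * pi / 2) * g \<bar>x\<bar>"])
    then have "((\<lambda>x. - sin (\<alpha> * pi / 2) * g \<bar>x\<bar>) has_integral (- sin (\<alpha> * pi / 2) * integral {0..R} g)) {- R..0}"
      by simp
    from has_integral_combine[OF _ _ this h1] R'
    have "((\<lambda>x. - sin (\<alpha> * pi / 2) * g \<bar>x\<bar>) has_integral (- sin (\<alpha> * pi / 2) * integral {0..R} g + - sin (\<alpha> * pi / 2) * integral {0..R} g)) {-R..R}"
      by simp
    from has_integral_unique[OF hJ this]
    have ImJ: "Im J = - 2 * sin (\<alpha> * pi / 2) * integral {0..R} g" by simp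
    have "I - J = 2 * pi * \<i> * of_real w0" using sum by (simp add: I_def J_def)
    from arg_cong[OF this, of Im] have "Im I - Im J = 2 * pi * w0" by simp
    then have ImI: "Im I = 2 * pi * w0 - 2 * sin (\<alpha> * pi / 2) * integral {0..R} g"
      by (simp add: ImJ)
    have "integral {0..R} g - pi / (2 * sin (\<alpha> * pi / 2)) * (2 * w0) = - Im I / (2 * sin (\<alpha> * pi / 2))"
      unfolding ImI using sin_pos by (simp add: diff_divide_distrib)
    then have "\<bar>integral {0..R} g - pi / (2 * sin (\<alpha> * pi / 2)) * (2 * w0)\<bar> = \<bar>Im I\<bar> / (2 * sin (\<alpha> * pi / 2))"
      using sin_pos by (simp add: abs_mult)
    also have "\<dots> \<le> (16 / R\<^sup>2) / (2 * sin (\<alpha> * pi / 2))"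
      using sin_pos abs_Im_le_cmod[of I] I by (intro divide_right_mono) auto
    finally show ?thesis using sin_pos by (simp add: field_simps)
  qed
  have "(\<lambda>n. integral {0..real n} g - pi / (2 * sin (\<alpha> * pi / 2)) * (2 * w0)) \<longlonglongrightarrow> 0"
  proof (rule Lim_null_comparison)
    show "\<forall>\<^sub>F n in sequentially. norm (integral {0..real n} g - pi / (2 * sin (\<alpha> * pi / 2)) * (2 * w0)) \<le> (8 / sin (\<alpha> * pi / 2)) / (real n)\<^sup>2"
      using eventually_ge_at_top[of "nat \<lceil>R0\<rceil>"]
    proof eventually_elim
      case (elim n)
      then have "R0 \<le> real n" by linarith
      from key[OF this] show ?case by (simp only: real_norm_def)
    qed
    show "(\<lambda>n. (8 / sin (\<alpha> * pi / 2)) / (real n)\<^sup>2) \<longlonglongrightarrow> 0"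
      by (intro tendsto_divide_0[OF tendsto_const] filterlim_at_top_imp_at_infinity filterlim_pow_at_top filterlim_real_sequentially) auto
  qed
  moreover have "2 * w0 = s powr (\<alpha> - 2) / (1 + s powr \<alpha>)"
  proof -
    have "2 * (a / 2) = a" for a :: real by simp
    then show ?thesis unfolding w0_def .
  qed
  ultimately show "(\<lambda>n. integral {0..real n} g) \<longlonglongrightarrow> pi / (2 * sin (\<alpha> * pi / 2)) * (s powr (\<alpha> - 2) / (1 + s powr \<alpha>))"
    by (simp only: LIM_zero_iff)
qed

section \<open>A sine transform for the Mittag-Leffler function\<close>

text \<open>The quantity \<open>\<bar>1 + z\<^sup>\<alpha>\<bar>\<^sup>2\<close> at \<open>z = \<i> x\<close>, as a function of \<open>w = x\<^sup>\<alpha>\<close>.\<close>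

definition ml_denom :: "real \<Rightarrow> real \<Rightarrow> real" where
  "ml_denom \<alpha> w = 1 + 2 * cos (\<alpha> * pi / 2) * w + w\<^sup>2"

text \<open>
  Up to the factor \<open>- sin (\<alpha> pi / 2)\<close>, this is the imaginary part at \<open>z = \<i> x\<close>, \<open>x > 0\<close>, of the Laplace
  transform \<open>z\<^sup>\<alpha>\<^sup>-\<^sup>2 / (1 + z\<^sup>\<alpha>)\<close> of \<open>t \<mapsto> t E\<^sub>\<alpha>\<^sub>,\<^sub>2(- t\<^sup>\<alpha>)\<close>.
\<close>

definition ml_density :: "real \<Rightarrow> real \<Rightarrow> real" where
  "ml_density \<alpha> x = x powr (\<alpha> - 2) / ml_denom \<alpha> (x powr \<alpha>)"

text \<open>The negated derivative of the density; its sign is that of a quadratic polynomial in \<open>x\<^sup>\<alpha>\<close>.\<close>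

definition ml_slope :: "real \<Rightarrow> real \<Rightarrow> real" where
  "ml_slope \<alpha> x = x powr (\<alpha> - 3) *
     (((2 - \<alpha>) + 4 * cos (\<alpha> * pi / 2) * x powr \<alpha> + (2 + \<alpha>) * (x powr \<alpha>)\<^sup>2) / (ml_denom \<alpha> (x powr \<alpha>))\<^sup>2)"

text \<open>The sine transform of the density over \<open>(0, \<infinity>)\<close>.\<close>

definition ml_sine_transform :: "real \<Rightarrow> real \<Rightarrow> real" where
  "ml_sine_transform \<alpha> t = (\<integral>x. indicator {0<..} x * (sin (x * t) * ml_density \<alpha> x) \<partial>lborel)"

context
  fixes \<alpha> :: real
  assumes \<alpha>: "1 < \<alpha>" "\<alpha> < 2"
begin

lemma one_plus_cos_pos: "1 + cos (\<alpha> * pi / 2) > 0"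
proof -
  have "cos pi < cos (\<alpha> * pi / 2)"
    using \<alpha> by (intro cos_monotone_0_pi) auto
  then show ?thesis by simp
qed

lemma ml_denom_ge: "(1 + cos (\<alpha> * pi / 2)) * (1 + w\<^sup>2) \<le> ml_denom \<alpha> w"
proof -
  have c: "cos (\<alpha> * pi / 2) \<le> 0"
    using cos_monotone_0_pi[of "pi / 2" "\<alpha> * pi / 2"] \<alpha> by simp
  have "ml_denom \<alpha> w - (1 + cos (\<alpha> * pi / 2)) * (1 + w\<^sup>2) = - cos (\<alpha> * pi / 2) * (1 - w)\<^sup>2"
    by (simp add: ml_denom_def power2_eq_square algebra_simps)
  also have "\<dots> \<ge> 0" using c by (intro mult_nonneg_nonneg) auto
  finally show ?thesis by simp
qed

lemma ml_denom_pos: "ml_denom \<alpha> w > 0"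
proof -
  have "0 < (1 + cos (\<alpha> * pi / 2)) * (1 + w\<^sup>2)"
    using one_plus_cos_pos by (intro mult_pos_pos) (auto simp: add_pos_nonneg)
  with ml_denom_ge[of w] show ?thesis by linarith
qed

lemma ml_density_nonneg: "ml_density \<alpha> x \<ge> 0"
  using ml_denom_pos[of "x powr \<alpha>"] by (simp add: ml_density_def)

lemma ml_density_le: "ml_density \<alpha> x \<le> x powr (\<alpha> - 2) / (1 + cos (\<alpha> * pi / 2))"
proof -
  have "1 + cos (\<alpha> * pi / 2) \<le> (1 + cos (\<alpha> * pi / 2)) * (1 + (x powr \<alpha>)\<^sup>2)"
    using one_plus_cos_pos by (simp add: distrib_left)
  also note ml_denom_ge
  finally show ?thesis
    unfolding ml_density_def using one_plus_cos_pos ml_denom_pos[of "x powr \<alpha>"]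
    by (intro divide_left_mono mult_pos_pos) auto
qed

lemma ml_density_measurable [measurable]: "ml_density \<alpha> \<in> borel_measurable borel"
  unfolding ml_density_def[abs_def] ml_denom_def[abs_def] by measurable

lemma ml_slope_measurable [measurable]: "ml_slope \<alpha> \<in> borel_measurable borel"
  unfolding ml_slope_def[abs_def] ml_denom_def[abs_def] by measurable

text \<open>The majorant is the derivative of the bounded function \<open>(x / (1 + x))\<^sup>\<alpha>\<^sup>-\<^sup>1 / (\<alpha> - 1)\<close>.\<close>

lemma ml_density_integrable: "integrable lborel (\<lambda>x. indicator {0<..} x * ml_density \<alpha> x)"
proof -
  define m where "m x = x powr (\<alpha> - 2) * (1 + x) powr (- \<alpha>)" for x :: real
  define F where "F x = (x / (1 + x)) powr (\<alpha> - 1) / (\<alpha> - 1)" for x :: real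
  have dF: "DERIV F x :> m x" if "x > 0" for x
  proof -
    have "((\<lambda>x. x / (1 + x)) has_real_derivative (1 / (1 + x)\<^sup>2)) (at x)"
      using that by (auto intro!: derivative_eq_intros simp: power2_eq_square field_simps)
    from DERIV_cdivide[OF DERIV_fun_powr[OF this, of "\<alpha> - 1"], of "\<alpha> - 1"] that
    have "DERIV F x :> ((\<alpha> - 1) * (x / (1 + x)) powr (\<alpha> - 1 - 1) * (1 / (1 + x)\<^sup>2)) / (\<alpha> - 1)"
      unfolding F_def by simp
    moreover have "((\<alpha> - 1) * (x / (1 + x)) powr (\<alpha> - 1 - 1) * (1 / (1 + x)\<^sup>2)) / (\<alpha> - 1) = m x"
    proof -
      have "(1 + x) powr (- \<alpha>) = 1 / (1 + x) powr (\<alpha> - 2) * (1 / (1 + x)\<^sup>2)"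
      proof -
        have "(1 + x) powr (- \<alpha>) = (1 + x) powr (- (\<alpha> - 2)) * (1 + x) powr (- 2)"
          by (simp flip: powr_add)
        also have "(1 + x) powr (- 2) = 1 / (1 + x)\<^sup>2"
          using that by (simp add: powr_minus_divide)
        finally show ?thesis by (simp only: powr_minus_divide)
      qed
      then show ?thesis using that \<alpha> by (simp add: m_def powr_divide)
    qed
    ultimately show ?thesis by simp
  qed
  have "set_integrable lborel (einterval 0 \<infinity>) m"
  proof (rule interval_integral_FTC_nonneg(1)[where F = F])
    show "((F \<circ> real_of_ereal) \<longlongrightarrow> 0) (at_right 0)"
    proof -
      have "((\<lambda>x::real. (x / (1 + x)) powr (\<alpha> - 1) / (\<alpha> - 1)) \<longlongrightarrow> (0 / (1 + 0)) powr (\<alpha> - 1) / (\<alpha> - 1)) (at_right 0)"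
        using \<alpha> by (intro tendsto_intros tendsto_powr') (auto intro!: eventually_mono[OF eventually_at_right_less])
      then show ?thesis unfolding zero_ereal_def ereal_tendsto_simps F_def[abs_def] by simp
    qed
    have "((\<lambda>x::real. x / (1 + x)) \<longlongrightarrow> 1) at_top" by real_asymp
    then have "(F \<longlongrightarrow> 1 powr (\<alpha> - 1) / (\<alpha> - 1)) at_top"
      unfolding F_def[abs_def] using \<alpha> by (intro tendsto_intros) auto
    then show "((F \<circ> real_of_ereal) \<longlongrightarrow> 1 powr (\<alpha> - 1) / (\<alpha> - 1)) (at_left \<infinity>)"
      unfolding ereal_tendsto_simps .
    show "\<And>x. 0 < ereal x \<Longrightarrow> ereal x < \<infinity> \<Longrightarrow> isCont m x"
      unfolding m_def by (intro continuous_intros) auto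
  qed (use dF in \<open>auto simp: m_def\<close>)
  then have m: "integrable lborel (\<lambda>x. indicator {0<..} x * m x)"
    by (simp add: set_integrable_def einterval_def greaterThan_def)
  define K where "K = 4 / (1 + cos (\<alpha> * pi / 2))"
  show ?thesis
  proof (rule Bochner_Integration.integrable_bound)
    show "integrable lborel (\<lambda>x. K * (indicator {0<..} x * m x))" using m by simp
    show "AE x in lborel. norm (indicator {0<..} x * ml_density \<alpha> x) \<le> norm (K * (indicator {0<..} x * m x))"
    proof (rule AE_I2)
      fix x :: real
      show "norm (indicator {0<..} x * ml_density \<alpha> x) \<le> norm (K * (indicator {0<..} x * m x))"
      proof (cases "x > 0")
        case True
        define w where "w = x powr \<alpha>"
        have w: "w > 0" using True by (simp add: w_def)
        have mx: "max 1 x powr \<alpha> = max 1 w"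
          using powr_mono2[of \<alpha> x 1] powr_mono2[of \<alpha> 1 x] True \<alpha> by (cases "x \<le> 1") (auto simp: w_def)
        have "(1 + x) powr \<alpha> \<le> (2 * max 1 x) powr \<alpha>"
          using True \<alpha> by (intro powr_mono2) auto
        also have "\<dots> = 2 powr \<alpha> * max 1 w"
          using True mx by (simp add: powr_mult)
        also have "\<dots> \<le> 4 * (1 + w\<^sup>2)"
        proof (intro mult_mono)
          show "2 powr \<alpha> \<le> (4::real)" using powr_mono[of \<alpha> 2 "2::real"] \<alpha> by simp
          have "0 \<le> (w - 1)\<^sup>2" by simp
          then show "max 1 w \<le> 1 + w\<^sup>2" using w by (simp add: power2_eq_square algebra_simps)
        qed auto
        finally have "(1 + cos (\<alpha> * pi / 2)) / 4 * (1 + x) powr \<alpha> \<le> (1 + cos (\<alpha> * pi / 2)) * (1 + w\<^sup>2)"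
          using one_plus_cos_pos by simp
        also have "\<dots> \<le> ml_denom \<alpha> w" by (rule ml_denom_ge)
        finally have "x powr (\<alpha> - 2) / ml_denom \<alpha> w \<le> x powr (\<alpha> - 2) / ((1 + cos (\<alpha> * pi / 2)) / 4 * (1 + x) powr \<alpha>)"
          using one_plus_cos_pos ml_denom_pos[of w] True by (intro divide_left_mono mult_pos_pos) auto
        also have "\<dots> = K * m x"
          by (simp add: K_def m_def powr_minus_divide)
        finally have "ml_density \<alpha> x \<le> K * m x" by (simp add: ml_density_def w_def)
        then show ?thesis using True ml_density_nonneg[of x] by simp
      qed simp
    qed
  qed measurable
qed

lemma sine_density_integrable:
  "integrable lborel (\<lambda>x. indicator {0<..} x * (sin (x * t) * ml_density \<alpha> x))"
proof (rule Bochner_Integration.integrable_bound[OF ml_density_integrable])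
  show "AE x in lborel. norm (indicator {0<..} x * (sin (x * t) * ml_density \<alpha> x)) \<le> norm (indicator {0<..} x * ml_density \<alpha> x)"
    by (rule AE_I2) (auto simp: abs_mult indicator_def intro!: mult_left_le_one_le)
qed measurable

lemma continuous_ml_sine_transform: "isCont (ml_sine_transform \<alpha>) t"
  unfolding continuous_at_sequentially o_def
proof (intro allI impI)
  fix X :: "nat \<Rightarrow> real" assume X: "X \<longlonglongrightarrow> t"
  show "(\<lambda>n. ml_sine_transform \<alpha> (X n)) \<longlonglongrightarrow> ml_sine_transform \<alpha> t"
    unfolding ml_sine_transform_def
  proof (rule integral_dominated_convergence[OF _ _ ml_density_integrable])
    show "AE x in lborel. (\<lambda>n. indicator {0<..} x * (sin (x * X n) * ml_density \<alpha> x))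
        \<longlonglongrightarrow> indicator {0<..} x * (sin (x * t) * ml_density \<alpha> x)"
      by (rule AE_I2) (intro tendsto_intros X)
    show "\<And>n. AE x in lborel. norm (indicator {0<..} x * (sin (x * X n) * ml_density \<alpha> x)) \<le> indicator {0<..} x * ml_density \<alpha> x"
      using ml_density_nonneg
      by (intro AE_I2) (auto simp: abs_mult indicator_def intro!: mult_left_le_one_le)
  qed measurable
qed

lemma Laplace_transform_sin:
  fixes s x :: real
  assumes s: "s > 0"
  shows "has_bochner_integral lborel (\<lambda>t. indicator {0<..} t * (exp (- s * t) * sin (x * t))) (x / (s\<^sup>2 + x\<^sup>2))"
proof -
  define F where "F t = - exp (- s * t) * (s * sin (x * t) + x * cos (x * t)) / (s\<^sup>2 + x\<^sup>2)" for t
  have sx: "s\<^sup>2 + x\<^sup>2 > 0" using s by (simp add: add_pos_nonneg)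
  have ie: "integrable lborel (\<lambda>t. indicator {0<..} t * exp (- s * t))"
  proof -
    have "integrable lborel (\<lambda>t. indicator {0<..} t * (exp (- s * t) * t powr 0))"
      using Laplace_transform_power[OF s, of 0] by (simp add: has_bochner_integral_iff)
    moreover have "indicator {0<..} t * (exp (- s * t) * t powr 0) = indicator {0<..} t * exp (- s * t)" for t :: real
      by (auto simp: indicator_def)
    ultimately show ?thesis by (simp only:)
  qed
  have int: "integrable lborel (\<lambda>t. indicator {0<..} t * (exp (- s * t) * sin (x * t)))"
    by (rule Bochner_Integration.integrable_bound[OF ie]) (auto simp: indicator_def abs_mult)
  have "(LBINT t=0..\<infinity>. exp (- s * t) * sin (x * t)) = 0 - F 0"
  proof (rule interval_integral_FTC_integrable[where F = F])
    fix t :: real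
    have "DERIV (\<lambda>t. - exp (- s * t) * (s * sin (x * t) + x * cos (x * t))) t :>
        - (exp (- s * t) * - s * (s * sin (x * t) + x * cos (x * t)) +
        exp (- s * t) * (s * (cos (x * t) * x) + x * (- sin (x * t) * x)))"
      by (auto intro!: derivative_eq_intros simp: algebra_simps)
    from DERIV_cdivide[OF this, of "s\<^sup>2 + x\<^sup>2"]
    have "DERIV F t :> (- (exp (- s * t) * - s * (s * sin (x * t) + x * cos (x * t)) +
        exp (- s * t) * (s * (cos (x * t) * x) + x * (- sin (x * t) * x)))) / (s\<^sup>2 + x\<^sup>2)"
      unfolding F_def .
    also have "(- (exp (- s * t) * - s * (s * sin (x * t) + x * cos (x * t)) +
        exp (- s * t) * (s * (cos (x * t) * x) + x * (- sin (x * t) * x)))) = (s\<^sup>2 + x\<^sup>2) * (exp (- s * t) * sin (x * t))"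
      by (simp add: power2_eq_square algebra_simps)
    finally have "DERIV F t :> (s\<^sup>2 + x\<^sup>2) * (exp (- s * t) * sin (x * t)) / (s\<^sup>2 + x\<^sup>2)" .
    moreover have "(s\<^sup>2 + x\<^sup>2) * r / (s\<^sup>2 + x\<^sup>2) = r" for r
      by (rule nonzero_mult_div_cancel_left) (use s in simp)
    ultimately show "(F has_vector_derivative exp (- s * t) * sin (x * t)) (at t)"
      by (simp only: has_real_derivative_iff_has_vector_derivative)
    show "isCont (\<lambda>t. exp (- s * t) * sin (x * t)) t" by (intro continuous_intros)
  next
    show "set_integrable lborel (einterval 0 \<infinity>) (\<lambda>t. exp (- s * t) * sin (x * t))"
      using int by (simp add: set_integrable_def einterval_def greaterThan_def)
    have "isCont F 0" unfolding F_def using sx by (intro continuous_intros) auto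
    then have "(F \<longlongrightarrow> F 0) (at_right 0)"
      unfolding isCont_def by (rule filterlim_mono) (auto simp: at_within_le_at)
    then show "((F \<circ> real_of_ereal) \<longlongrightarrow> F 0) (at_right 0)"
      unfolding zero_ereal_def ereal_tendsto_simps .
    have "(F \<longlongrightarrow> 0) at_top"
    proof (rule Lim_null_comparison)
      show "\<forall>\<^sub>F t in at_top. norm (F t) \<le> exp (- s * t) * ((s + \<bar>x\<bar>) / (s\<^sup>2 + x\<^sup>2))"
      proof (rule always_eventually, rule allI)
        fix t
        have "\<bar>s * sin (x * t) + x * cos (x * t)\<bar> \<le> s * 1 + \<bar>x\<bar> * 1"
          using s by (intro abs_triangle_ineq[THEN order.trans] add_mono) (auto simp: abs_mult intro!: mult_left_le)
        then show "norm (F t) \<le> exp (- s * t) * ((s + \<bar>x\<bar>) / (s\<^sup>2 + x\<^sup>2))"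
          using sx by (simp add: F_def abs_mult divide_right_mono mult_left_mono)
      qed
      have "((\<lambda>t. exp (- s * t)) \<longlongrightarrow> 0) at_top" using s by real_asymp
      then show "((\<lambda>t. exp (- s * t) * ((s + \<bar>x\<bar>) / (s\<^sup>2 + x\<^sup>2))) \<longlongrightarrow> 0) at_top"
        by (rule tendsto_mult_left_zero)
    qed
    then show "((F \<circ> real_of_ereal) \<longlongrightarrow> 0) (at_left \<infinity>)"
      unfolding ereal_tendsto_simps .
  qed simp
  moreover have "0 - F 0 = x / (s\<^sup>2 + x\<^sup>2)" by (simp add: F_def)
  ultimately have "(LINT t:{0<..}|lborel. exp (- s * t) * sin (x * t)) = x / (s\<^sup>2 + x\<^sup>2)"
    by (simp add: interval_lebesgue_integral_0_infty)
  with int show ?thesis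
    by (simp add: has_bochner_integral_iff set_lebesgue_integral_def)
qed

text \<open>
  The integral is the limit of the integrals over \<open>[0, n]\<close>, whose convergence also gives integrability,
  the integrand being nonnegative.
\<close>

lemma half_plane_transform:
  assumes s: "s > 0"
  shows "has_bochner_integral lborel (\<lambda>x. indicator {0<..} x * (x / (s\<^sup>2 + x\<^sup>2) * ml_density \<alpha> x))
    (pi / (2 * sin (\<alpha> * pi / 2)) * (s powr (\<alpha> - 2) / (1 + s powr \<alpha>)))"
proof -
  define g where "g x = x powr (\<alpha> - 1) / ((1 + 2 * cos (\<alpha> * pi / 2) * x powr \<alpha> + (x powr \<alpha>)\<^sup>2) * (s\<^sup>2 + x\<^sup>2))" for x :: real
  note T = half_plane_transform_tendsto[OF \<alpha> s, folded g_def]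
  have g0: "g x \<ge> 0" for x
    using ml_denom_pos[of "x powr \<alpha>"] by (simp add: g_def ml_denom_def)
  have [measurable]: "g \<in> borel_measurable borel" unfolding g_def[abs_def] by measurable
  have g: "indicator {0<..} x * (x / (s\<^sup>2 + x\<^sup>2) * ml_density \<alpha> x) = indicator {0..} x * g x" for x
  proof -
    have "x powr (\<alpha> - 1) = x * x powr (\<alpha> - 2)" if "x > 0"
      using that powr_add[of x 1 "\<alpha> - 2"] by simp
    then show ?thesis by (auto simp: indicator_def g_def ml_density_def ml_denom_def)
  qed
  have "has_bochner_integral lborel (\<lambda>x. indicator {0..real n} x * g x) (integral {0..real n} g)" for n
  proof -
    have "(g has_integral integral {0..real n} g) {0..real n}"
      using T(2) by (rule integrable_integral)
    then have "((\<lambda>x. if x \<in> {0..real n} then g x else 0) has_integral integral {0..real n} g) UNIV"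
      by (simp only: has_integral_restrict_UNIV)
    then have h: "((\<lambda>x. indicator {0..real n} x * g x) has_integral integral {0..real n} g) UNIV"
      by (rule has_integral_cong[THEN iffD1, rotated]) (auto simp: indicator_def)
    show ?thesis
    proof (rule has_bochner_integral_nn_integral)
      show "(\<integral>\<^sup>+ x. ennreal (indicator {0..real n} x * g x) \<partial>lborel) = ennreal (integral {0..real n} g)"
        using h g0 by (intro nn_integral_has_integral_lborel) auto
      show "integral {0..real n} g \<ge> 0" using T(2) g0 by (intro integral_nonneg) auto
    qed (use g0 in auto)
  qed
  then have i: "integrable lborel (\<lambda>x. indicator {0..real n} x * g x)"
    and il: "(\<integral>x. indicator {0..real n} x * g x \<partial>lborel) = integral {0..real n} g" for n
    by (auto simp: has_bochner_integral_iff)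
  have lim: "AE x in lborel. (\<lambda>n. indicator {0..real n} x * g x) \<longlonglongrightarrow> indicator {0..} x * g x"
  proof (rule AE_I2, rule tendsto_eventually)
    fix x :: real
    show "\<forall>\<^sub>F n in sequentially. indicator {0..real n} x * g x = indicator {0..} x * g x"
      using eventually_ge_at_top[of "nat \<lceil>x\<rceil>"]
    proof eventually_elim
      case (elim n)
      then have "x \<le> real n" by linarith
      then show ?case by (auto simp: indicator_def)
    qed
  qed
  have mono: "AE x in lborel. mono (\<lambda>n. indicator {0..real n} x * g x)"
    using g0 by (intro AE_I2 monoI) (auto simp: indicator_def)
  have pos: "AE x in lborel. 0 \<le> indicator {0..real n} x * g x" for n using g0 by simp
  have meas: "(\<lambda>x. indicator {0..} x * g x) \<in> borel_measurable lborel" by measurable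
  show ?thesis unfolding g
    using integral_monotone_convergence_nonneg[OF i mono pos lim _ meas] T(1)
    unfolding il has_bochner_integral_iff by blast
qed

lemma Laplace_transform_ml_sine_transform:
  assumes s: "s > 0"
  shows "has_bochner_integral lborel (\<lambda>t. indicator {0<..} t * (exp (- s * t) * (2 / pi * sin (\<alpha> * pi / 2) * ml_sine_transform \<alpha> t)))
    (s powr (\<alpha> - 2) / (1 + s powr \<alpha>))"
proof -
  define e where "e t = indicator {0<..} t * exp (- s * t)" for t :: real
  define q where "q x = indicator {0<..} x * ml_density \<alpha> x" for x
  define G where "G t x = e t * q x * sin (x * t)" for t x
  have [measurable]: "e \<in> borel_measurable borel" "q \<in> borel_measurable borel"
    unfolding e_def[abs_def] q_def[abs_def] by measurable
  have int_e: "integrable lborel e"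
  proof -
    have "integrable lborel (\<lambda>t. indicator {0<..} t * (exp (- s * t) * t powr 0))"
      using Laplace_transform_power[OF s, of 0] by (simp add: has_bochner_integral_iff)
    moreover have "indicator {0<..} t * (exp (- s * t) * t powr 0) = e t" for t :: real
      by (auto simp: indicator_def e_def)
    ultimately show ?thesis by (simp only:)
  qed
  have int_q: "integrable lborel q" using ml_density_integrable by (simp add: q_def[abs_def])
  have prod: "integrable (lborel \<Otimes>\<^sub>M lborel) (\<lambda>p. e (fst p) * q (snd p))"
  proof (rule lborel_pair.Fubini_integrable)
    show "integrable lborel (\<lambda>t. \<integral>x. norm (e (fst (t, x)) * q (snd (t, x))) \<partial>lborel)"
      using int_e by (simp add: abs_mult)
    show "AE t in lborel. integrable lborel (\<lambda>x. e (fst (t, x)) * q (snd (t, x)))"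
      using int_q by simp
  qed measurable
  have int_G: "integrable (lborel \<Otimes>\<^sub>M lborel) (case_prod G)"
  proof (rule Bochner_Integration.integrable_bound[OF prod])
    show "case_prod G \<in> borel_measurable (lborel \<Otimes>\<^sub>M lborel)"
      unfolding G_def case_prod_unfold by measurable
    show "AE p in lborel \<Otimes>\<^sub>M lborel. norm (case_prod G p) \<le> norm (e (fst p) * q (snd p))"
      by (rule AE_I2) (auto simp: G_def abs_mult case_prod_unfold intro!: mult_left_le)
  qed
  have inner: "(\<integral>x. G t x \<partial>lborel) = indicator {0<..} t * (exp (- s * t) * ml_sine_transform \<alpha> t)" for t
  proof -
    have "(\<integral>x. G t x \<partial>lborel) = (\<integral>x. e t * (indicator {0<..} x * (sin (x * t) * ml_density \<alpha> x)) \<partial>lborel)"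
      by (intro Bochner_Integration.integral_cong) (auto simp: G_def q_def)
    then show ?thesis by (simp add: ml_sine_transform_def e_def)
  qed
  have outer: "(\<integral>t. G t x \<partial>lborel) = indicator {0<..} x * (x / (s\<^sup>2 + x\<^sup>2) * ml_density \<alpha> x)" for x
  proof -
    have "(\<integral>t. G t x \<partial>lborel) = (\<integral>t. q x * (indicator {0<..} t * (exp (- s * t) * sin (x * t))) \<partial>lborel)"
      by (intro Bochner_Integration.integral_cong) (auto simp: G_def e_def)
    also have "\<dots> = q x * (x / (s\<^sup>2 + x\<^sup>2))"
      by (simp only: integral_mult_right_zero has_bochner_integral_integral_eq[OF Laplace_transform_sin[OF s]])
    finally show ?thesis by (simp add: q_def)
  qed
  define L where "L = s powr (\<alpha> - 2) / (1 + s powr \<alpha>)"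
  have "(\<integral>t. indicator {0<..} t * (exp (- s * t) * ml_sine_transform \<alpha> t) \<partial>lborel) = pi / (2 * sin (\<alpha> * pi / 2)) * L"
    using lborel_pair.Fubini_integral[OF int_G] half_plane_transform[OF s]
    unfolding inner outer has_bochner_integral_iff L_def by simp
  moreover have "integrable lborel (\<lambda>t. indicator {0<..} t * (exp (- s * t) * ml_sine_transform \<alpha> t))"
    using lborel_pair.integrable_fst'[OF int_G] by (simp add: inner)
  ultimately have "has_bochner_integral lborel (\<lambda>t. indicator {0<..} t * (exp (- s * t) * ml_sine_transform \<alpha> t)) (pi / (2 * sin (\<alpha> * pi / 2)) * L)"
    by (simp only: has_bochner_integral_iff)
  from has_bochner_integral_mult_right[OF this, of "2 / pi * sin (\<alpha> * pi / 2)"]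
  have "has_bochner_integral lborel (\<lambda>t. 2 / pi * sin (\<alpha> * pi / 2) * (indicator {0<..} t * (exp (- s * t) * ml_sine_transform \<alpha> t)))
    (2 / pi * sin (\<alpha> * pi / 2) * (pi / (2 * sin (\<alpha> * pi / 2)) * L))" .
  moreover have "2 / pi * sin (\<alpha> * pi / 2) * (pi / (2 * sin (\<alpha> * pi / 2)) * L) = L"
  proof -
    have "sin (\<alpha> * pi / 2) > 0" using \<alpha> by (intro sin_gt_zero) auto
    then show ?thesis by simp
  qed
  moreover have "2 / pi * sin (\<alpha> * pi / 2) * (indicator {0<..} t * (exp (- s * t) * ml_sine_transform \<alpha> t))
    = indicator {0<..} t * (exp (- s * t) * (2 / pi * sin (\<alpha> * pi / 2) * ml_sine_transform \<alpha> t))" for t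
    by simp
  ultimately show ?thesis unfolding L_def by (simp only:)
qed

lemma mittag_leffler_sine_transform:
  assumes t: "t > 0"
  shows "t * mittag_leffler \<alpha> 2 (- (t powr \<alpha>)) = 2 / pi * sin (\<alpha> * pi / 2) * ml_sine_transform \<alpha> t"
proof (rule Laplace_transform_unique[where \<sigma> = 1 and L = "\<lambda>s. s powr (\<alpha> - 2) / (1 + s powr \<alpha>)"
      and f = "\<lambda>t. t * mittag_leffler \<alpha> 2 (- (t powr \<alpha>))"
      and g = "\<lambda>t. 2 / pi * sin (\<alpha> * pi / 2) * ml_sine_transform \<alpha> t"])
  have "isCont (\<lambda>t. mittag_leffler \<alpha> 2 (- (t powr \<alpha>))) t" if "t > 0" for t
    using that \<alpha> by (intro isCont_o2[OF _ continuous_mittag_leffler] continuous_intros) auto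
  then show "continuous_on {0<..} (\<lambda>t. t * mittag_leffler \<alpha> 2 (- (t powr \<alpha>)))"
    by (intro continuous_on_mult continuous_on_id continuous_at_imp_continuous_on) auto
  show "continuous_on {0<..} (\<lambda>t. 2 / pi * sin (\<alpha> * pi / 2) * ml_sine_transform \<alpha> t)"
    by (intro continuous_intros continuous_at_imp_continuous_on ballI continuous_ml_sine_transform)
qed (use Laplace_transform_mittag_leffler[OF \<alpha>(1)] Laplace_transform_ml_sine_transform t in auto)

end

section \<open>Sign and decay of the Mittag-Leffler function\<close>

lemma one_minus_cos_le:
  fixes y :: real
  assumes "y \<ge> 0"
  shows "\<bar>1 - cos y\<bar> \<le> y"
proof -
  have "1 - cos y = 2 * (sin (y / 2))\<^sup>2"
    using cos_double_sin[of "y / 2"] by simp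
  also have "\<dots> \<le> 2 * \<bar>sin (y / 2)\<bar>"
    using abs_sin_le_one[of "y / 2"] mult_left_le[of "\<bar>sin (y / 2)\<bar>" "\<bar>sin (y / 2)\<bar>"]
    by (simp add: power2_eq_square flip: abs_mult)
  also have "\<dots> \<le> y" using abs_sin_x_le_abs_x[of "y / 2"] assms by simp
  finally show ?thesis using cos_le_one[of y] by simp
qed

context
  fixes \<alpha> :: real
  assumes \<alpha>: "1 < \<alpha>" "\<alpha> < 2"
begin

lemma ml_density_derivative:
  assumes x: "x > 0"
  shows "(ml_density \<alpha> has_real_derivative - ml_slope \<alpha> x) (at x)"
proof -
  define \<kappa> where "\<kappa> = cos (\<alpha> * pi / 2)"
  define w where "w = x powr \<alpha>"
  define D where "D = ml_denom \<alpha> w"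
  have D: "D \<noteq> 0" using ml_denom_pos[OF \<alpha>, of w] by (simp add: D_def)
  have 1: "((\<lambda>x. x powr (\<alpha> - 2)) has_real_derivative ((\<alpha> - 2) * x powr (\<alpha> - 3))) (at x)"
    using has_real_derivative_powr[OF x, of "\<alpha> - 2"] by (simp add: algebra_simps)
  have 2: "((\<lambda>x. x powr \<alpha>) has_real_derivative (\<alpha> * x powr (\<alpha> - 1))) (at x)"
    using has_real_derivative_powr[OF x, of \<alpha>] by simp
  have 3: "((\<lambda>x. ml_denom \<alpha> (x powr \<alpha>)) has_real_derivative (2 * \<kappa> + 2 * w) * (\<alpha> * x powr (\<alpha> - 1))) (at x)"
    unfolding ml_denom_def using x by (auto intro!: derivative_eq_intros 2 simp: \<kappa>_def w_def algebra_simps)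
  have "(ml_density \<alpha> has_real_derivative
      (((\<alpha> - 2) * x powr (\<alpha> - 3)) * D - x powr (\<alpha> - 2) * ((2 * \<kappa> + 2 * w) * (\<alpha> * x powr (\<alpha> - 1)))) / (D * D)) (at x)"
    using DERIV_divide[OF 1 3] D unfolding ml_density_def[abs_def] D_def w_def by simp
  moreover have "x powr (\<alpha> - 2) * x powr (\<alpha> - 1) = x powr (\<alpha> - 3) * w"
    using x unfolding w_def powr_add[symmetric] by (simp add: algebra_simps)
  then have "((\<alpha> - 2) * x powr (\<alpha> - 3)) * D - x powr (\<alpha> - 2) * ((2 * \<kappa> + 2 * w) * (\<alpha> * x powr (\<alpha> - 1)))
    = x powr (\<alpha> - 3) * ((\<alpha> - 2) * D - (2 * \<kappa> + 2 * w) * \<alpha> * w)"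
    by (simp add: algebra_simps)
  moreover have "(\<alpha> - 2) * D - (2 * \<kappa> + 2 * w) * \<alpha> * w = - ((2 - \<alpha>) + 4 * \<kappa> * w + (2 + \<alpha>) * w\<^sup>2)"
    by (simp add: D_def ml_denom_def \<kappa>_def power2_eq_square algebra_simps)
  moreover have "x powr (\<alpha> - 3) * (- N) / (D * D) = - (x powr (\<alpha> - 3) * (N / (D * D)))" for N by simp
  ultimately show ?thesis
    unfolding ml_slope_def D_def[symmetric] w_def[symmetric] \<kappa>_def[symmetric] power2_eq_square[of D] by (simp only:)
qed

lemma ml_slope_le:
  assumes x: "x > 0"
  shows "\<bar>ml_slope \<alpha> x\<bar> \<le> 6 / (1 + cos (\<alpha> * pi / 2)) * (ml_density \<alpha> x / x)"
proof -
  define \<kappa> where "\<kappa> = cos (\<alpha> * pi / 2)"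
  define w where "w = x powr \<alpha>"
  define D where "D = ml_denom \<alpha> w"
  have w: "w > 0" using x by (simp add: w_def)
  have D: "D > 0" "(1 + \<kappa>) * (1 + w\<^sup>2) \<le> D" "1 + \<kappa> > 0" "\<bar>\<kappa>\<bar> \<le> 1"
    using ml_denom_pos[OF \<alpha>, of w] ml_denom_ge[OF \<alpha>, of w] one_plus_cos_pos[OF \<alpha>] by (auto simp: D_def \<kappa>_def)
  have "\<bar>(2 - \<alpha>) + 4 * \<kappa> * w + (2 + \<alpha>) * w\<^sup>2\<bar> \<le> (2 - \<alpha>) + 4 * w + (2 + \<alpha>) * w\<^sup>2"
  proof -
    have "\<bar>\<kappa> * w\<bar> \<le> w" using D(4) w by (simp add: abs_mult mult_left_le_one_le)
    moreover have "0 \<le> (2 + \<alpha>) * w\<^sup>2" using \<alpha> by simp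
    ultimately show ?thesis using \<alpha> by linarith
  qed
  also have "\<dots> \<le> 6 * (1 + w\<^sup>2)"
  proof -
    have "0 \<le> 2 * (w - 1)\<^sup>2 + (2 + \<alpha>) + (2 - \<alpha>) * w\<^sup>2"
      using \<alpha> by (intro add_nonneg_nonneg mult_nonneg_nonneg) auto
    then show ?thesis by (simp add: power2_eq_square algebra_simps)
  qed
  also have "\<dots> \<le> 6 / (1 + \<kappa>) * D" using D by (simp add: field_simps)
  finally have "\<bar>(2 - \<alpha>) + 4 * \<kappa> * w + (2 + \<alpha>) * w\<^sup>2\<bar> \<le> 6 / (1 + \<kappa>) * D" .
  then have "\<bar>(2 - \<alpha>) + 4 * \<kappa> * w + (2 + \<alpha>) * w\<^sup>2\<bar> / D\<^sup>2 \<le> 6 / (1 + \<kappa>) * D / D\<^sup>2"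
    by (rule divide_right_mono) simp
  also have "6 / (1 + \<kappa>) * D / D\<^sup>2 = 6 / (1 + \<kappa>) / D"
    using D(1) by (simp add: power2_eq_square)
  finally have "\<bar>((2 - \<alpha>) + 4 * \<kappa> * w + (2 + \<alpha>) * w\<^sup>2) / D\<^sup>2\<bar> \<le> 6 / (1 + \<kappa>) / D"
    by (simp only: abs_divide abs_power2)
  then have "x powr (\<alpha> - 3) * \<bar>((2 - \<alpha>) + 4 * \<kappa> * w + (2 + \<alpha>) * w\<^sup>2) / D\<^sup>2\<bar> \<le> x powr (\<alpha> - 3) * (6 / (1 + \<kappa>) / D)"
    by (intro mult_left_mono) auto
  moreover have "x powr (\<alpha> - 2) / x = x powr (\<alpha> - 3)"
    using x powr_diff[of x "\<alpha> - 2" 1] by simp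
  moreover have "\<bar>ml_slope \<alpha> x\<bar> = x powr (\<alpha> - 3) * \<bar>((2 - \<alpha>) + 4 * \<kappa> * w + (2 + \<alpha>) * w\<^sup>2) / D\<^sup>2\<bar>"
    unfolding ml_slope_def w_def[symmetric] D_def[symmetric] \<kappa>_def[symmetric] by (simp add: abs_mult)
  moreover have "ml_density \<alpha> x / x = (x powr (\<alpha> - 2) / x) / D"
    by (simp add: ml_density_def w_def D_def)
  ultimately show ?thesis by (simp add: \<kappa>_def[symmetric] mult.commute[of "x powr (\<alpha> - 3)" 6])
qed

lemma continuous_ml_slope: "x > 0 \<Longrightarrow> isCont (ml_slope \<alpha>) x"
  using ml_denom_pos[OF \<alpha>, of "x powr \<alpha>"]
  unfolding ml_slope_def[abs_def] ml_denom_def[abs_def] by (intro continuous_intros) auto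

lemma cos_slope_integrable:
  assumes t: "t > 0"
  shows "integrable lborel (\<lambda>x. indicator {0<..} x * ((1 - cos (x * t)) * ml_slope \<alpha> x))"
proof (rule Bochner_Integration.integrable_bound)
  define K where "K = 6 / (1 + cos (\<alpha> * pi / 2))"
  show "integrable lborel (\<lambda>x. K * t * (indicator {0<..} x * ml_density \<alpha> x))"
    using ml_density_integrable[OF \<alpha>] by simp
  show "AE x in lborel. norm (indicator {0<..} x * ((1 - cos (x * t)) * ml_slope \<alpha> x))
     \<le> norm (K * t * (indicator {0<..} x * ml_density \<alpha> x))"
  proof (rule AE_I2)
    fix x :: real
    show "norm (indicator {0<..} x * ((1 - cos (x * t)) * ml_slope \<alpha> x))
     \<le> norm (K * t * (indicator {0<..} x * ml_density \<alpha> x))"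
    proof (cases "x > 0")
      case True
      have "\<bar>1 - cos (x * t)\<bar> \<le> x * t"
        using one_minus_cos_le[of "x * t"] True t by simp
      then have "\<bar>1 - cos (x * t)\<bar> * \<bar>ml_slope \<alpha> x\<bar> \<le> (x * t) * (K * (ml_density \<alpha> x / x))"
        using ml_slope_le[OF True] t True by (intro mult_mono) (auto simp: K_def)
      also have "\<dots> = K * t * ml_density \<alpha> x" using True by simp
      also have "\<dots> \<le> norm (K * t * ml_density \<alpha> x)" by simp
      finally show ?thesis using True by (simp add: abs_mult)
    qed simp
  qed
qed (use ml_slope_measurable[OF \<alpha>] in measurable)

text \<open>
  The boundary terms vanish because the density is \<open>O(x\<^sup>\<alpha>\<^sup>-\<^sup>2)\<close> both at \<open>0\<close> and at infinity. What is gained is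
  the nonnegative kernel \<open>1 - cos (x t)\<close> in place of the oscillating \<open>sin (x t)\<close>.
\<close>

lemma ml_sine_transform_by_parts:
  assumes t: "t > 0"
  shows "t * ml_sine_transform \<alpha> t = (\<integral>x. indicator {0<..} x * ((1 - cos (x * t)) * ml_slope \<alpha> x) \<partial>lborel)"
proof -
  define \<delta> where "\<delta> = 1 + cos (\<alpha> * pi / 2)"
  have \<delta>: "\<delta> > 0" using one_plus_cos_pos[OF \<alpha>] by (simp add: \<delta>_def)
  define P where "P x = (1 - cos (x * t)) * ml_density \<alpha> x" for x
  define p where "p x = t * (sin (x * t) * ml_density \<alpha> x) - (1 - cos (x * t)) * ml_slope \<alpha> x" for x
  have i1: "integrable lborel (\<lambda>x. t * (indicator {0<..} x * (sin (x * t) * ml_density \<alpha> x)))"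
    using sine_density_integrable[OF \<alpha>] by simp
  note i2 = cos_slope_integrable[OF t]
  have split: "indicator {0<..} x * p x = t * (indicator {0<..} x * (sin (x * t) * ml_density \<alpha> x))
      - indicator {0<..} x * ((1 - cos (x * t)) * ml_slope \<alpha> x)" for x
    by (simp add: p_def algebra_simps)
  have contd: "isCont (ml_density \<alpha>) x" if "x > 0" for x
    using ml_density_derivative[OF that] by (rule DERIV_isCont)
  have "(LBINT x=0..\<infinity>. p x) = 0 - 0"
  proof (rule interval_integral_FTC_integrable[where F = P])
    fix x :: real assume "0 < ereal x"
    then have x: "x > 0" by simp
    have "(P has_real_derivative p x) (at x)"
      unfolding P_def[abs_def] p_def
      by (auto intro!: derivative_eq_intros ml_density_derivative[OF x] simp: algebra_simps)
    then show "(P has_vector_derivative p x) (at x)"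
      by (simp add: has_real_derivative_iff_has_vector_derivative)
    show "isCont p x"
      unfolding p_def[abs_def] by (intro continuous_intros contd continuous_ml_slope x)
  next
    show "set_integrable lborel (einterval 0 \<infinity>) p"
      using Bochner_Integration.integrable_diff[OF i1 i2]
      by (simp add: set_integrable_def einterval_def greaterThan_def[symmetric] split)
    have "(P \<longlongrightarrow> 0) (at_right 0)"
    proof (rule Lim_null_comparison)
      have "norm (P x) \<le> t / \<delta> * x powr (\<alpha> - 1)" if x: "x > 0" for x
      proof -
        have "\<bar>1 - cos (x * t)\<bar> \<le> x * t"
          using one_minus_cos_le[of "x * t"] x t by simp
        then have "\<bar>1 - cos (x * t)\<bar> * \<bar>ml_density \<alpha> x\<bar> \<le> (x * t) * (x powr (\<alpha> - 2) / \<delta>)"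
          using ml_density_le[OF \<alpha>, of x] ml_density_nonneg[OF \<alpha>, of x] x t by (intro mult_mono) (auto simp: \<delta>_def)
        also have "x powr (\<alpha> - 1) = x * x powr (\<alpha> - 2)"
          using x powr_add[of x 1 "\<alpha> - 2"] by simp
        then have "(x * t) * (x powr (\<alpha> - 2) / \<delta>) = t / \<delta> * x powr (\<alpha> - 1)" by simp
        finally show ?thesis by (simp add: P_def abs_mult)
      qed
      then show "\<forall>\<^sub>F x in at_right 0. norm (P x) \<le> t / \<delta> * x powr (\<alpha> - 1)"
        by (auto intro!: eventually_mono[OF eventually_at_right_less])
      have "((\<lambda>x. t / \<delta> * x powr (\<alpha> - 1)) \<longlongrightarrow> t / \<delta> * 0 powr (\<alpha> - 1)) (at_right 0)"
        using \<alpha> by (intro tendsto_intros tendsto_powr') (auto intro!: eventually_mono[OF eventually_at_right_less])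
      then show "((\<lambda>x. t / \<delta> * x powr (\<alpha> - 1)) \<longlongrightarrow> 0) (at_right 0)" by simp
    qed
    then show "((P \<circ> real_of_ereal) \<longlongrightarrow> 0) (at_right 0)"
      unfolding zero_ereal_def ereal_tendsto_simps .
    have "(P \<longlongrightarrow> 0) at_top"
    proof (rule Lim_null_comparison)
      have "norm (P x) \<le> 2 * (x powr (\<alpha> - 2) / \<delta>)" for x
      proof -
        have "\<bar>1 - cos (x * t)\<bar> \<le> 2" using cos_ge_minus_one[of "x * t"] cos_le_one[of "x * t"] by linarith
        then have "\<bar>1 - cos (x * t)\<bar> * \<bar>ml_density \<alpha> x\<bar> \<le> 2 * (x powr (\<alpha> - 2) / \<delta>)"
          using ml_density_le[OF \<alpha>, of x] ml_density_nonneg[OF \<alpha>, of x] by (intro mult_mono) (auto simp: \<delta>_def)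
        then show ?thesis by (simp add: P_def abs_mult)
      qed
      then show "\<forall>\<^sub>F x in at_top. norm (P x) \<le> 2 * (x powr (\<alpha> - 2) / \<delta>)" by simp
      have "((\<lambda>x. x powr (\<alpha> - 2)) \<longlongrightarrow> 0) at_top"
        using \<alpha> by (intro tendsto_neg_powr filterlim_ident) auto
      then have "((\<lambda>x. 2 * (x powr (\<alpha> - 2) / \<delta>)) \<longlongrightarrow> 2 * (0 / \<delta>)) at_top"
        using \<delta> by (intro tendsto_intros) auto
      then show "((\<lambda>x. 2 * (x powr (\<alpha> - 2) / \<delta>)) \<longlongrightarrow> 0) at_top" by simp
    qed
    then show "((P \<circ> real_of_ereal) \<longlongrightarrow> 0) (at_left \<infinity>)"
      unfolding ereal_tendsto_simps .
  qed simp
  then have "(\<integral>x. indicator {0<..} x * p x \<partial>lborel) = 0"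
    by (simp add: interval_lebesgue_integral_0_infty set_lebesgue_integral_def)
  then show ?thesis
    unfolding split Bochner_Integration.integral_diff[OF i1 i2] integral_mult_right_zero
    by (simp add: ml_sine_transform_def)
qed

text \<open>
  On \<open>[pi / (2 t), pi / t]\<close> the kernel is at least \<open>1\<close>; the function \<open>h\<close> accounts for the places where the
  density increases, where the kernel is at most \<open>2\<close>.
\<close>

lemma ml_sine_transform_ge:
  assumes t: "t > 0" and m: "m \<ge> 0"
    and near: "\<And>x. pi / (2 * t) \<le> x \<Longrightarrow> x \<le> pi / t \<Longrightarrow> m \<le> ml_slope \<alpha> x"
    and h: "integrable lborel h" "\<And>x. h x \<ge> 0" "\<And>x. x > 0 \<Longrightarrow> - 2 * ml_slope \<alpha> x \<le> h x"
  shows "m * (pi / (2 * t)) - (\<integral>x. h x \<partial>lborel) \<le> t * ml_sine_transform \<alpha> t"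
proof -
  have ind: "integrable lborel (indicator {pi / (2 * t)..pi / t} :: real \<Rightarrow> real)"
    by (rule integrable_real_indicator) (auto simp: emeasure_lborel_Icc_eq)
  have "m * (pi / (2 * t)) - (\<integral>x. h x \<partial>lborel) = (\<integral>x. m * indicator {pi / (2 * t)..pi / t} x - h x \<partial>lborel)"
    using t h(1) ind by (subst Bochner_Integration.integral_diff) (auto simp: field_simps)
  also have "\<dots> \<le> (\<integral>x. indicator {0<..} x * ((1 - cos (x * t)) * ml_slope \<alpha> x) \<partial>lborel)"
  proof (rule integral_mono)
    show "integrable lborel (\<lambda>x. m * indicator {pi / (2 * t)..pi / t} x - h x)"
      using h(1) ind by (intro Bochner_Integration.integrable_diff integrable_mult_right) auto
    show "integrable lborel (\<lambda>x. indicator {0<..} x * ((1 - cos (x * t)) * ml_slope \<alpha> x))"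
      by (rule cos_slope_integrable[OF t])
    fix x :: real
    have c: "0 \<le> 1 - cos (x * t)" "1 - cos (x * t) \<le> 2"
      using cos_ge_minus_one[of "x * t"] by auto
    show "m * indicator {pi / (2 * t)..pi / t} x - h x \<le> indicator {0<..} x * ((1 - cos (x * t)) * ml_slope \<alpha> x)"
    proof (cases "x \<in> {pi / (2 * t)..pi / t}")
      case True
      then have x: "x > 0" using t by (auto intro: less_le_trans[of 0 "pi / (2 * t)"])
      have "pi / 2 \<le> x * t" "x * t \<le> pi" using True t by (auto simp: field_simps)
      then have "cos (x * t) \<le> 0" using cos_monotone_0_pi_le[of "pi / 2" "x * t"] by simp
      then have "m * 1 \<le> ml_slope \<alpha> x * (1 - cos (x * t))"
        using near[of x] True m by (intro mult_mono) auto
      then show ?thesis using True x h(2)[of x] by (simp add: mult.commute)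
    next
      case False
      have "- h x \<le> (1 - cos (x * t)) * ml_slope \<alpha> x" if x: "x > 0"
      proof (cases "ml_slope \<alpha> x \<ge> 0")
        case True
        then have "0 \<le> (1 - cos (x * t)) * ml_slope \<alpha> x" using c by simp
        then show ?thesis using h(2)[of x] by linarith
      next
        case False
        then have "2 * ml_slope \<alpha> x \<le> (1 - cos (x * t)) * ml_slope \<alpha> x"
          using c by (intro mult_right_mono_neg) auto
        then show ?thesis using h(3)[OF x] by linarith
      qed
      then show ?thesis using False h(2)[of x] by (cases "x > 0") auto
    qed
  qed
  finally show ?thesis using ml_sine_transform_by_parts[OF t] by simp
qed

text \<open>
  For \<open>\<alpha> \<le> 4/3\<close> one has \<open>- 1/2 \<le> cos (\<alpha> * pi / 2)\<close>, so the quadratic polynomial in \<open>ml_slope\<close> has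
  negative discriminant: the density decreases, and its sine transform is positive.
\<close>

lemma mittag_leffler_pos:
  fixes x :: real
  assumes \<alpha>': "\<alpha> \<le> 4/3" and x: "x > 0"
  shows "mittag_leffler \<alpha> 2 (- x) > 0"
proof -
  define \<kappa> where "\<kappa> = cos (\<alpha> * pi / 2)"
  have "cos (2 * pi / 3) \<le> \<kappa>" unfolding \<kappa>_def
    using \<alpha>' \<alpha> by (intro cos_monotone_0_pi_le) auto
  moreover have "\<kappa> \<le> 0"
    unfolding \<kappa>_def using cos_monotone_0_pi[of "pi / 2" "\<alpha> * pi / 2"] \<alpha> by simp
  moreover have "cos (2 * pi / 3) = - 1 / 2"
    using cos_120 by simp
  ultimately have "\<bar>\<kappa>\<bar> \<le> 1 / 2" by simp
  then have \<kappa>2: "\<kappa>\<^sup>2 \<le> (1 / 2)\<^sup>2" by (metis abs_ge_zero power2_abs power_mono)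
  have slope: "ml_slope \<alpha> y > 0" if y: "y > 0" for y
  proof -
    define w where "w = y powr \<alpha>"
    have "(2 + \<alpha>) * ((2 - \<alpha>) + 4 * \<kappa> * w + (2 + \<alpha>) * w\<^sup>2) = ((2 + \<alpha>) * w + 2 * \<kappa>)\<^sup>2 + (4 - \<alpha>\<^sup>2 - 4 * \<kappa>\<^sup>2)"
      by (simp add: power2_eq_square algebra_simps)
    also have "\<dots> > 0"
    proof -
      have "\<alpha>\<^sup>2 \<le> (4/3)\<^sup>2" using \<alpha> \<alpha>' by (intro power_mono) auto
      with \<kappa>2 have "4 - \<alpha>\<^sup>2 - 4 * \<kappa>\<^sup>2 > 0" by (simp add: power2_eq_square)
      then show ?thesis by (simp add: add_nonneg_pos)
    qed
    finally have "(2 - \<alpha>) + 4 * \<kappa> * w + (2 + \<alpha>) * w\<^sup>2 > 0"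
      using \<alpha> by (simp add: zero_less_mult_iff)
    then show ?thesis
      using y ml_denom_pos[OF \<alpha>, of w] unfolding ml_slope_def w_def[symmetric] \<kappa>_def[symmetric]
      by (intro mult_pos_pos divide_pos_pos) auto
  qed
  define t where "t = x powr (1 / \<alpha>)"
  have t: "t > 0" "t powr \<alpha> = x" using x \<alpha> by (auto simp: t_def powr_powr)
  have "pi / (2 * t) \<le> pi / t" "pi / (2 * t) > 0" using t by (auto simp: field_simps)
  then obtain y where y: "y \<in> {pi / (2 * t)..pi / t}" "\<And>z. z \<in> {pi / (2 * t)..pi / t} \<Longrightarrow> ml_slope \<alpha> y \<le> ml_slope \<alpha> z"
    using continuous_attains_inf[of "{pi / (2 * t)..pi / t}" "ml_slope \<alpha>"]
      continuous_at_imp_continuous_on[of "{pi / (2 * t)..pi / t}" "ml_slope \<alpha>"] continuous_ml_slope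
    by fastforce
  have y0: "y > 0" using y(1) \<open>pi / (2 * t) > 0\<close> by (auto intro: less_le_trans)
  have "ml_slope \<alpha> y * (pi / (2 * t)) - (\<integral>x. 0 \<partial>(lborel :: real measure)) \<le> t * ml_sine_transform \<alpha> t"
    using t(1) y slope y0 by (intro ml_sine_transform_ge[where h = "\<lambda>_. 0"]) (auto intro: less_imp_le)
  moreover have "ml_slope \<alpha> y * (pi / (2 * t)) > 0" using slope[OF y0] t by simp
  ultimately have "0 < t * ml_sine_transform \<alpha> t" by simp
  then have "0 < ml_sine_transform \<alpha> t" using t(1) by (simp add: zero_less_mult_iff)
  moreover have "sin (\<alpha> * pi / 2) > 0" using \<alpha> by (intro sin_gt_zero) auto
  ultimately have "0 < t * mittag_leffler \<alpha> 2 (- (t powr \<alpha>))"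
    unfolding mittag_leffler_sine_transform[OF \<alpha> t(1)] by simp
  then show ?thesis using t by (simp add: zero_less_mult_iff)
qed

text \<open>
  Near \<open>0\<close> the slope is at least a multiple of \<open>x\<^sup>\<alpha>\<^sup>-\<^sup>3\<close>, which contributes a multiple of \<open>t\<^sup>2\<^sup>-\<^sup>\<alpha>\<close> to \<open>t\<close>
  times the sine transform. Away from \<open>0\<close> the slope is integrable and contributes at least a constant
  \<open>- B\<close>, which is negligible as \<open>t\<close> grows because \<open>\<alpha> < 2\<close>.
\<close>

lemma mittag_leffler_decay_lower:
  "\<exists>c>0. \<exists>X>0. \<forall>x\<ge>X. c / x \<le> (mittag_leffler \<alpha> 2 (- x) :: real)"
proof -
  define \<delta> where "\<delta> = 1 + cos (\<alpha> * pi / 2)"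
  have \<delta>: "\<delta> > 0" using one_plus_cos_pos[OF \<alpha>] by (simp add: \<delta>_def)
  define R where "R x = ((2 - \<alpha>) + 4 * cos (\<alpha> * pi / 2) * x powr \<alpha> + (2 + \<alpha>) * (x powr \<alpha>)\<^sup>2) / (ml_denom \<alpha> (x powr \<alpha>))\<^sup>2" for x
  define k where "k = (2 - \<alpha>) / 2"
  have k: "k > 0" using \<alpha> by (simp add: k_def)
  have "((\<lambda>x. x powr \<alpha>) \<longlongrightarrow> 0 powr \<alpha>) (at_right 0)"
    using \<alpha> by (intro tendsto_powr' tendsto_intros) (auto intro!: eventually_mono[OF eventually_at_right_less])
  then have "((\<lambda>x. x powr \<alpha>) \<longlongrightarrow> 0) (at_right 0)" by simp
  then have "(R \<longlongrightarrow> ((2 - \<alpha>) + 4 * cos (\<alpha> * pi / 2) * 0 + (2 + \<alpha>) * 0\<^sup>2) / (1 + 2 * cos (\<alpha> * pi / 2) * 0 + 0\<^sup>2)\<^sup>2) (at_right 0)"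
    unfolding R_def[abs_def] ml_denom_def by (intro tendsto_intros) auto
  then have "(R \<longlongrightarrow> 2 - \<alpha>) (at_right 0)" by simp
  moreover have "k < 2 - \<alpha>" using \<alpha> by (simp add: k_def)
  ultimately have "\<forall>\<^sub>F x in at_right 0. k < R x" by (rule order_tendstoD)
  then obtain r where r: "r > 0" "\<And>x. 0 < x \<Longrightarrow> x < r \<Longrightarrow> k < R x"
    by (auto simp: eventually_at_right_field)
  have slope: "k * x powr (\<alpha> - 3) \<le> ml_slope \<alpha> x" if "0 < x" "x < r" for x
    using mult_left_mono[OF less_imp_le[OF r(2)[OF that]], of "x powr (\<alpha> - 3)"]
    by (simp add: ml_slope_def R_def mult.commute)
  define K where "K = 2 * (6 / \<delta> / r)"
  define h where "h x = K * (indicator {0<..} x * ml_density \<alpha> x)" for x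
  define B where "B = (\<integral>x. h x \<partial>lborel)"
  have K: "K > 0" using \<delta> r(1) by (simp add: K_def)
  have h1: "integrable lborel h" unfolding h_def using ml_density_integrable[OF \<alpha>] by simp
  have h2: "h x \<ge> 0" for x using K ml_density_nonneg[OF \<alpha>, of x] by (simp add: h_def)
  have h3: "- 2 * ml_slope \<alpha> x \<le> h x" if x: "x > 0" for x
  proof (cases "x < r")
    case True
    have "0 \<le> k * x powr (\<alpha> - 3)" using k by simp
    also have "\<dots> \<le> ml_slope \<alpha> x" using slope[OF x True] .
    finally show ?thesis using h2[of x] by linarith
  next
    case False
    have "\<bar>ml_slope \<alpha> x\<bar> \<le> 6 / \<delta> * (ml_density \<alpha> x / x)" using ml_slope_le[OF x] by (simp add: \<delta>_def)
    also have "\<dots> \<le> 6 / \<delta> * (ml_density \<alpha> x / r)"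
      using False x r(1) \<delta> ml_density_nonneg[OF \<alpha>, of x] by (intro mult_left_mono divide_left_mono) auto
    finally have "2 * \<bar>ml_slope \<alpha> x\<bar> \<le> h x" using x by (simp add: h_def K_def)
    then show ?thesis by linarith
  qed
  define k' where "k' = k * pi powr (\<alpha> - 2) / 2"
  have k': "k' > 0" using k by (simp add: k'_def)
  have lower: "k' * t powr (2 - \<alpha>) - B \<le> t * ml_sine_transform \<alpha> t" if t: "t > pi / r" for t
  proof -
    have t0: "t > 0" using t r(1) by (auto intro: less_trans[of 0 "pi / r"])
    have "k * (pi / t) powr (\<alpha> - 3) * (pi / (2 * t)) - B \<le> t * ml_sine_transform \<alpha> t"
      unfolding B_def
    proof (rule ml_sine_transform_ge[OF t0 _ _ h1 h2 h3])
      show "0 \<le> k * (pi / t) powr (\<alpha> - 3)" using k by simp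
      fix x assume x: "pi / (2 * t) \<le> x" "x \<le> pi / t"
      have x0: "x > 0" using x(1) t0 by (auto intro: less_le_trans[of 0 "pi / (2 * t)"])
      have "pi / t < r" using t r(1) t0 by (simp add: field_simps)
      then have xr: "x < r" using x by simp
      have "(pi / t) powr (\<alpha> - 3) \<le> x powr (\<alpha> - 3)"
        using x x0 \<alpha> by (intro powr_mono2') auto
      then have "k * (pi / t) powr (\<alpha> - 3) \<le> k * x powr (\<alpha> - 3)" using k by simp
      also have "\<dots> \<le> ml_slope \<alpha> x" by (rule slope[OF x0 xr])
      finally show "k * (pi / t) powr (\<alpha> - 3) \<le> ml_slope \<alpha> x" .
    qed
    moreover have "k * (pi / t) powr (\<alpha> - 3) * (pi / (2 * t)) = k' * t powr (2 - \<alpha>)"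
    proof -
      have "(pi / t) powr (\<alpha> - 3) * (pi / t) = (pi / t) powr (\<alpha> - 2)"
        using t0 powr_add[of "pi / t" "\<alpha> - 3" 1] by simp
      also have "\<dots> = pi powr (\<alpha> - 2) * t powr (2 - \<alpha>)"
        using t0 powr_minus_divide[of t "\<alpha> - 2"] by (simp add: powr_divide)
      finally have "(pi / t) powr (\<alpha> - 3) * (pi / t) = pi powr (\<alpha> - 2) * t powr (2 - \<alpha>)" .
      then have "k * ((pi / t) powr (\<alpha> - 3) * (pi / t)) / 2 = k * (pi powr (\<alpha> - 2) * t powr (2 - \<alpha>)) / 2"
        by (rule arg_cong)
      then show ?thesis by (simp add: k'_def)
    qed
    ultimately show ?thesis by simp
  qed
  have "filterlim (\<lambda>t::real. t powr (2 - \<alpha>)) at_top at_top"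
    using \<alpha> by real_asymp
  then have "\<forall>\<^sub>F t in at_top. t powr (2 - \<alpha>) \<ge> 2 * B / k'"
    unfolding filterlim_at_top by blast
  then obtain t1 where t1: "\<And>t. t \<ge> t1 \<Longrightarrow> t powr (2 - \<alpha>) \<ge> 2 * B / k'"
    by (auto simp: eventually_at_top_linorder)
  define s0 where "s0 = max t1 (pi / r + 1)"
  have s0: "s0 > 0" using r(1) by (simp add: s0_def less_max_iff_disj add_pos_pos)
  define u where "u = 2 / pi * sin (\<alpha> * pi / 2)"
  have u: "u > 0" using \<alpha> sin_gt_zero[of "\<alpha> * pi / 2"] by (simp add: u_def)
  have bound: "u * k' / 2 / x \<le> mittag_leffler \<alpha> 2 (- x)" if x: "x \<ge> s0 powr \<alpha>" for x
  proof -
    have x0: "x > 0" using x s0 by (auto intro: less_le_trans[of 0 "s0 powr \<alpha>"])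
    define t where "t = x powr (1 / \<alpha>)"
    have t: "t > 0" "t powr \<alpha> = x" using x0 \<alpha> by (auto simp: t_def powr_powr)
    have "(s0 powr \<alpha>) powr (1 / \<alpha>) \<le> t" unfolding t_def using x \<alpha> by (intro powr_mono2) auto
    then have ts: "t \<ge> s0" using s0 \<alpha> by (simp add: powr_powr)
    then have "2 * B / k' \<le> t powr (2 - \<alpha>)" "t > pi / r" using t1[of t] by (auto simp: s0_def)
    then have "k' / 2 * t powr (2 - \<alpha>) \<le> k' * t powr (2 - \<alpha>) - B" using k' by (simp add: field_simps)
    also have "\<dots> \<le> t * ml_sine_transform \<alpha> t" using lower \<open>t > pi / r\<close> by blast
    finally have "u * (k' / 2 * t powr (2 - \<alpha>)) \<le> u * (t * ml_sine_transform \<alpha> t)"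
      using u by (intro mult_left_mono) auto
    also have "\<dots> = t * (t * mittag_leffler \<alpha> 2 (- x))"
      using mittag_leffler_sine_transform[OF \<alpha> t(1)] t(2) by (simp add: u_def)
    finally have "u * k' / 2 * t powr (2 - \<alpha>) \<le> t\<^sup>2 * mittag_leffler \<alpha> 2 (- x)"
      by (simp add: power2_eq_square mult.assoc)
    moreover have "t powr (2 - \<alpha>) = t\<^sup>2 / x" using t powr_diff[of t 2 \<alpha>] by simp
    ultimately have "t\<^sup>2 * (u * k' / 2 / x) \<le> t\<^sup>2 * mittag_leffler \<alpha> 2 (- x)" by (simp add: mult_ac)
    then show ?thesis by (rule mult_left_le_imp_le) (use t(1) in simp)
  qed
  have "u * k' / 2 > 0" "s0 powr \<alpha> > 0" using u k' s0 by auto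
  with bound show ?thesis by blast
qed

end

section \<open>The stability estimate\<close>

text \<open>
  The spectral form of the estimate: the multiplier \<open>T E\<^sub>\<alpha>\<^sub>,\<^sub>2(- l\<^sub>n T\<^sup>\<alpha>)\<close> is bounded below by a multiple
  of \<open>1 / l\<^sub>n\<close>. For large \<open>l\<^sub>n\<close> this is the decay estimate; the finitely many remaining multipliers do
  not vanish.
\<close>

lemma multiplier_lower_bound:
  fixes l :: "nat \<Rightarrow> real"
  assumes \<alpha>: "1 < \<alpha>" "\<alpha> < 2" and T: "T > 0" and l: "\<And>n. l n > 0" and lim: "filterlim l at_top sequentially"
    and nz: "\<And>n. mittag_leffler \<alpha> 2 (- l n * T powr \<alpha>) \<noteq> 0"
  shows "\<exists>c>0. \<forall>n. c \<le> l n * \<bar>T * mittag_leffler \<alpha> 2 (- l n * T powr \<alpha>)\<bar>"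
proof -
  define m where "m n = l n * \<bar>T * mittag_leffler \<alpha> 2 (- l n * T powr \<alpha>)\<bar>" for n
  have m: "m n > 0" for n using nz[of n] l[of n] T by (simp add: m_def)
  obtain c X where c: "c > 0" "X > 0" and bound: "\<And>x. x \<ge> X \<Longrightarrow> c / x \<le> mittag_leffler \<alpha> 2 (- x :: real)"
    using mittag_leffler_decay_lower[OF \<alpha>] by blast
  have Ta: "T powr \<alpha> > 0" using T by simp
  have "\<forall>\<^sub>F n in sequentially. l n \<ge> X / T powr \<alpha>"
    using lim unfolding filterlim_at_top by blast
  then obtain N where N: "\<And>n. n \<ge> N \<Longrightarrow> l n \<ge> X / T powr \<alpha>"
    by (auto simp: eventually_sequentially)
  define d where "d = T * c / T powr \<alpha>"
  have d: "d > 0" using T c by (simp add: d_def)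
  have large: "d \<le> m n" if "n \<ge> N" for n
  proof -
    have "X \<le> l n * T powr \<alpha>" using N[OF that] Ta by (simp add: field_simps)
    from bound[OF this] have "c / (l n * T powr \<alpha>) \<le> \<bar>mittag_leffler \<alpha> 2 (- l n * T powr \<alpha>)\<bar>"
      by simp
    then have "l n * T * (c / (l n * T powr \<alpha>)) \<le> l n * T * \<bar>mittag_leffler \<alpha> 2 (- l n * T powr \<alpha>)\<bar>"
      using l[of n] T by (intro mult_left_mono) auto
    moreover have "l n * T * (c / (l n * T powr \<alpha>)) = d" using l[of n] by (simp add: d_def)
    ultimately show ?thesis using T by (simp add: m_def abs_mult mult.assoc)
  qed
  define c' where "c' = Min (insert d (m ` {..<N}))"
  have "c' > 0" using m d by (auto simp: c'_def)
  moreover have "c' \<le> m n" for n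
  proof (cases "n < N")
    case True
    then show ?thesis unfolding c'_def by (intro Min_le) auto
  next
    case False
    have "c' \<le> d" unfolding c'_def by (intro Min_le) auto
    with large[of n] False show ?thesis by simp
  qed
  ultimately show ?thesis unfolding m_def by blast
qed

text \<open>
  The weak formulation is tested with the eigenfunction, and the Laplacian is moved onto it; the
  coefficient then solves a scalar fractional equation.
\<close>

lemma solution_coefficient:
  assumes \<Omega>: "open \<Omega>" "bounded \<Omega>" and \<alpha>: "1 < \<alpha>" "\<alpha> < 2" and T: "T > 0"
    and eig: "dirichlet_eigensystem \<Omega> lam \<phi>"
    and sol: "fractional_wave_solution \<alpha> T \<Omega> (\<lambda>x. 0) a1 u"
  shows "L2_inner \<Omega> (u T) (\<phi> n) = L2_inner \<Omega> a1 (\<phi> n) * T * mittag_leffler \<alpha> 2 (- lam n * T powr \<alpha>)"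
proof (rule caputo_equation_solution[OF \<alpha> _ T, where \<psi> = "\<lambda>t. L2_inner \<Omega> (u t) (\<phi> n)"])
  have \<phi>: "\<phi> n \<in> H01_space \<Omega>" "\<phi> n \<in> H2_space \<Omega>" and lap: "has_laplacian \<Omega> (\<phi> n) (\<lambda>x. - lam n * \<phi> n x)"
    using eig by (auto simp: dirichlet_eigensystem_def)
  have "lam 0 > 0" "lam 0 \<le> lam n" using eig by (auto simp: dirichlet_eigensystem_def mono_def)
  then show "lam n > 0" by simp
  have weak: "caputo_regular T (\<lambda>t. L2_inner \<Omega> (u t) (\<phi> n))"
    "((\<lambda>t. L2_inner \<Omega> (u t) (\<phi> n)) has_real_derivative L2_inner \<Omega> a1 (\<phi> n)) (at 0 within {0..T})"
    "AE t in lebesgue_on {0<..<T}. \<exists>g. has_laplacian \<Omega> (u t) g \<and>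
               caputo \<alpha> (\<lambda>s. L2_inner \<Omega> (u s) (\<phi> n)) t - L2_inner \<Omega> g (\<phi> n) = 0"
    using sol \<phi> unfolding fractional_wave_solution_def by blast+
  show "caputo_regular T (\<lambda>t. L2_inner \<Omega> (u t) (\<phi> n))"
    "((\<lambda>t. L2_inner \<Omega> (u t) (\<phi> n)) has_real_derivative L2_inner \<Omega> a1 (\<phi> n)) (at 0 within {0..T})"
    by fact+
  have AE_H: "AE t in lebesgue_on {0<..<T}. u t \<in> H01_space \<Omega>"
    and u0: "AE x in lebesgue_on \<Omega>. u 0 x = 0" and u0L: "u 0 \<in> L2_space \<Omega>"
    using sol T unfolding fractional_wave_solution_def by auto
  have "(\<lambda>x. 0) \<in> L2_space \<Omega>" by (simp add: L2_space_def)
  then have "L2_inner \<Omega> (u 0) (\<phi> n) = L2_inner \<Omega> (\<lambda>x. 0) (\<phi> n)"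
    using u0 u0L \<phi>(1) by (intro L2_inner_AE_cong) (auto simp: H01_space_def)
  then show "L2_inner \<Omega> (u 0) (\<phi> n) = 0" by (simp add: L2_inner_def)
  show "AE t in lebesgue_on {0<..<T}. caputo \<alpha> (\<lambda>s. L2_inner \<Omega> (u s) (\<phi> n)) t = - lam n * L2_inner \<Omega> (u t) (\<phi> n)"
    using weak(3) AE_H
  proof eventually_elim
    case (elim t)
    then obtain g where g: "has_laplacian \<Omega> (u t) g"
      "caputo \<alpha> (\<lambda>s. L2_inner \<Omega> (u s) (\<phi> n)) t = L2_inner \<Omega> g (\<phi> n)" by auto
    from laplacian_symmetric[OF \<Omega> elim(2) \<phi>(1) g(1) lap]
    have "L2_inner \<Omega> g (\<phi> n) = - lam n * L2_inner \<Omega> (u t) (\<phi> n)"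
      by (simp only: L2_inner_scale_right)
    with g(2) show ?case by simp
  qed
qed

theorem theorem2:
  fixes \<Omega> :: "'a::euclidean_space set"
    and \<alpha> \<beta> \<gamma> T :: real
    and lam :: "nat \<Rightarrow> real" and \<phi> :: "nat \<Rightarrow> 'a \<Rightarrow> real"
  assumes "DIM('a) \<in> {1, 2, 3}"
    and "smooth_bounded_domain \<Omega>"
    and "dirichlet_eigensystem \<Omega> lam \<phi>"
    and "1 < \<alpha>" and "\<alpha> < 2"
    and "\<beta> \<in> {0..1}" and "\<gamma> \<in> {0..1}" and "\<gamma> + \<beta> \<noteq> 0"
    and "(\<alpha> \<in> {1<..4/3} \<and> T > 0) \<or>
         (\<alpha> \<in> {4/3<..<2} \<and> T > 0 \<and>
          T powr \<alpha> \<notin> (\<Union>k. (\<lambda>r. r / lam k) ` mittag_leffler_roots \<alpha>))"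
  shows "\<exists>C>0. \<forall>u a1 b M.
           u \<in> L2_time_H01_H2 T \<Omega> \<longrightarrow>
           a1 \<in> frac_domain \<Omega> lam \<phi> \<beta> \<longrightarrow>
           fractional_wave_solution \<alpha> T \<Omega> (\<lambda>x. 0) a1 u \<longrightarrow>
           has_frac_laplacian \<Omega> lam \<phi> \<beta> a1 b \<longrightarrow>
           M > 0 \<longrightarrow> L2_norm \<Omega> b \<le> M \<longrightarrow>
           frac_norm \<Omega> lam \<phi> (- \<gamma>) a1
             \<le> C * M powr ((1 - \<gamma>) / (1 + \<beta>)) * L2_norm \<Omega> (u T) powr ((\<beta> + \<gamma>) / (\<beta> + 1))"
proof -
  note eig = assms(3) and \<alpha> = assms(4,5)
  have \<Omega>: "open \<Omega>" "bounded \<Omega>" using assms(2) by (auto simp: smooth_bounded_domain_def)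
  have T: "T > 0" using assms(9) by auto
  have basis: "L2_orthonormal_basis \<Omega> \<phi>" and lim: "filterlim lam at_top sequentially"
    using eig by (auto simp: dirichlet_eigensystem_def)
  have lam: "lam n > 0" for n
  proof -
    have "lam 0 > 0" "lam 0 \<le> lam n" using eig by (auto simp: dirichlet_eigensystem_def mono_def)
    then show ?thesis by simp
  qed
  have nz: "mittag_leffler \<alpha> 2 (- lam n * T powr \<alpha>) \<noteq> 0" for n
  proof (cases "\<alpha> \<le> 4/3")
    case True
    have "lam n * T powr \<alpha> > 0" using lam[of n] T by simp
    from mittag_leffler_pos[OF \<alpha> True this] show ?thesis by simp
  next
    case False
    then have notin: "T powr \<alpha> \<notin> (\<Union>k. (\<lambda>r. r / lam k) ` mittag_leffler_roots \<alpha>)"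
      using assms(9) by auto
    show ?thesis
    proof
      assume "mittag_leffler \<alpha> 2 (- lam n * T powr \<alpha>) = 0"
      then have "lam n * T powr \<alpha> \<in> mittag_leffler_roots \<alpha>"
        using lam[of n] T by (simp add: mittag_leffler_roots_def)
      moreover have "T powr \<alpha> = lam n * T powr \<alpha> / lam n" using lam[of n] by simp
      ultimately show False using notin by blast
    qed
  qed
  obtain c where c: "c > 0" "\<And>n. c \<le> lam n * \<bar>T * mittag_leffler \<alpha> 2 (- lam n * T powr \<alpha>)\<bar>"
    using multiplier_lower_bound[OF \<alpha> T lam lim nz] by blast
  show ?thesis
  proof (intro exI[of _ "(1 / c) powr ((\<beta> + \<gamma>) / (\<beta> + 1))"] conjI allI impI)
    show "0 < (1 / c) powr ((\<beta> + \<gamma>) / (\<beta> + 1))" using c by simp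
    fix u a1 b M
    assume sol: "fractional_wave_solution \<alpha> T \<Omega> (\<lambda>x. 0) a1 u"
      and b: "has_frac_laplacian \<Omega> lam \<phi> \<beta> a1 b" and M: "M > 0" "L2_norm \<Omega> b \<le> M"
    define a where "a n = L2_inner \<Omega> a1 (\<phi> n)" for n
    define U where "U n = L2_inner \<Omega> (u T) (\<phi> n)" for n
    have uL: "u T \<in> L2_space \<Omega>" using sol T by (simp add: fractional_wave_solution_def)
    have bL: "b \<in> L2_space \<Omega>" using b by (simp add: has_frac_laplacian_def L2_sums_def)
    have U: "U n = a n * T * mittag_leffler \<alpha> 2 (- lam n * T powr \<alpha>)" for n
      unfolding U_def a_def by (rule solution_coefficient[OF \<Omega> \<alpha> T eig sol])
    have "L2_inner \<Omega> b (\<phi> n) = lam n powr \<beta> * a n" for n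
      using L2_sums_coefficient[OF basis] b by (simp add: has_frac_laplacian_def a_def)
    then have "(\<Sum>n<N. (lam n powr \<beta> * a n)\<^sup>2) \<le> (L2_norm \<Omega> b)\<^sup>2" for N
      using Bessel_inequality[OF basis bL, of N] by simp
    then have bM: "(\<Sum>n<N. (lam n powr \<beta> * a n)\<^sup>2) \<le> M\<^sup>2" for N
      using power_mono[OF M(2), of 2] by (auto intro: order.trans)
    have cU: "c * \<bar>a n\<bar> \<le> lam n * \<bar>U n\<bar>" for n
      using mult_right_mono[OF c(2)[of n], of "\<bar>a n\<bar>"] by (simp add: U abs_mult mult_ac)
    have "sqrt (\<Sum>n. \<bar>lam n powr (- \<gamma>) * a n\<bar>\<^sup>2)
      \<le> (1 / c) powr ((\<beta> + \<gamma>) / (\<beta> + 1)) * M powr ((1 - \<gamma>) / (1 + \<beta>)) * L2_norm \<Omega> (u T) powr ((\<beta> + \<gamma>) / (\<beta> + 1))"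
      using assms(6-8) Bessel_inequality[OF basis uL]
      by (intro spectral_interpolation[OF lam c(1) cU M(1) bM]) (auto simp: U_def)
    then show "frac_norm \<Omega> lam \<phi> (- \<gamma>) a1
      \<le> (1 / c) powr ((\<beta> + \<gamma>) / (\<beta> + 1)) * M powr ((1 - \<gamma>) / (1 + \<beta>)) * L2_norm \<Omega> (u T) powr ((\<beta> + \<gamma>) / (\<beta> + 1))"
      by (simp add: frac_norm_def a_def)
  qed
qed

end
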